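(* Let $A$ be a closed densely defined nonnegative symmetric operator in the Hilbert space $\mathfrak H$, let $\{\mathcal H,\Gamma\}$ be a boundary pair for $A$ and $\{\mathcal H,G_*,\Gamma\}$ the corresponding boundary triplet for $L$. Assume $\mathcal D_0\ne\{0\}$. Then there is a bijective correspondence between all $m$-accretive quasi-selfadjoint extensions $\tilde A$ of $A$ and all $m$-accretive linear relations $\mathbf Z$ in $\mathcal H$ such that $\operatorname{dom}(\mathbf Z)\subseteq\mathcal D_0$ and $$\operatorname{Re}(\mathbf Z e,e)_{\mathcal H}\ge\|\hat A_F^{-1/2}\gamma(i)e\|^2\qquad\text{for all }e\in\operatorname{dom}(\mathbf Z).$$ This correspondence is given by $$\operatorname{dom}(\tilde A)=\{u\in\operatorname{dom}(A^* ):G_*u\in(\mathbf Z-2i\gamma^*(i)\gamma(i))\Gamma u\},\qquad \tilde Au=A^*u.$$ Moreover, (1) a number $\lambda\in\rho(A_F)$ is a regular point of $\tilde A$ if and only if $\bigl(\mathbf Z-\frac{\lambda+i}{\lambda-i}\mathcal Q(\lambda)\bigr)^{-1}$ is a bounded everywhere defined operator in $\mathcal H$, and then $$(\tilde A-\lambda I)^{-1}=(A_F-\lambda I)^{-1}+\gamma(\lambda)\Bigl(\mathbf Z-\frac{\lambda+i}{\lambda-i}\mathcal Q(\lambda)\Bigr)^{-1}\gamma^*(\bar\lambda);$$ (2) a number $\lambda\in\rho(A_F)$ is an eigenvalue of $\tilde A$ if and only if $\ker\bigl(\mathbf Z-\frac{\lambda+i}{\lambda-i}\mathcal Q(\lambda)\bigr)\ne\{0\}$,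 and then $$\ker(\tilde A-\lambda I)=\gamma(\lambda)\ker\Bigl(\mathbf Z-\frac{\lambda+i}{\lambda-i}\mathcal Q(\lambda)\Bigr).$$
   Context: Inner products are linear in the first argument. An extension $\tilde A$ of $A$ is quasi-selfadjoint if $A\subset\tilde A\subset A^*$. An operator $T$ is accretive if $\operatorname{Re}(Tu,u)\ge0$ on its domain, $m$-accretive if it is accretive, closed and has no proper accretive extension in $\mathfrak H$. An $m$-accretive linear relation $\mathbf Z$ in $\mathcal H$ is a linear subspace of $\mathcal H\times\mathcal H$ with $\operatorname{Re}(h,e)\ge0$ for all $\langle e,h\rangle\in\mathbf Z$ having no proper extension with this property; $\mathbf Z(e)=\{h:\langle e,h\rangle\in\mathbf Z\}$, and $(\mathbf Z e,g)_{\mathcal H}:=(h,g)_{\mathcal H}$ with $h\in\mathbf Z(e)$ is well defined for $e,g\in\operatorname{dom}(\mathbf Z)$. $A_F$ is the Friedrichs extension of $A$, $D[A]=D[A_F]=\operatorname{dom}(A_F^{1/2})$ the domain of its closed form; $\hat A_F=A_F\upharpoonright\overline{\operatorname{ran}(A_F)}$ is injective and $\hat A_F^{-1/2}$ is defined on $\operatorname{ran}(A_F^{1/2})$. $\mathfrak N_\lambda=\ker(A^*-\lambda I)$. $\mathfrak L:=D[A]\dotplus\mathfrak N_z$ is independent of $z\in\rho(A_F)$; $\mathcal P_{z,F},\mathcal P_z$ are the skew projectors of $\mathfrak L$ onto $D[A]$ and $\mathfrak N_z$; $\mathcal P_F:=\mathcal P_{i,F}$ and $\mathcal P_i$ is $\mathcal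 P_z$ for $z=i$. $\mathfrak L$ is a Hilbert space with the inner product $(A_F^{1/2}\mathcal P_{-1,F}u,A_F^{1/2}\mathcal P_{-1,F}v)+(\mathcal P_{-1}u,\mathcal P_{-1}v)+(u,v)$. A boundary pair for $A$ is $\{\mathcal H,\Gamma\}$ with $\mathcal H$ a Hilbert space and $\Gamma:\mathfrak L\to\mathcal H$ bounded linear, $\ker\Gamma=D[A]$, $\operatorname{ran}\Gamma=\mathcal H$. $\gamma(\lambda):=(\Gamma\upharpoonright\mathfrak N_\lambda)^{-1}$, bounded from $\mathcal H$ to $\mathfrak H$, $\gamma^*(\lambda):=(\gamma(\lambda))^*$, $\lambda\in\rho(A_F)$. $\mathcal Q(\lambda)=(\lambda-i)\gamma^*(i)\gamma(\lambda)$, so $\frac{\lambda+i}{\lambda-i}\mathcal Q(\lambda)=(\lambda+i)\gamma^*(i)\gamma(\lambda)$, the latter being its meaning at $\lambda=i$. On $\mathfrak L$ put $l[u,v]=(A_F^{1/2}\mathcal P_Fu,A_F^{1/2}\mathcal P_Fv)-i(\mathcal P_iu,\mathcal P_Fv)-i(\mathcal P_Fu,\mathcal P_iv)-i(\mathcal P_iu,\mathcal P_iv)$. The operator $L$ has $\operatorname{dom}(L)=\operatorname{dom}(A_F)\dotplus\mathfrak N_i=\operatorname{dom}(A^* )$, $L(u_F+u_i)=A_Fu_F-iu_i$. $\{\mathcal H,G_*,\Gamma\}$ is the boundary triplet for $L$ if $G_*:\operatorname{dom}(L)\to\mathcal H$ is the (unique) linear operator with $l[u,v]=(Lu,v)-(G_*u,\Gamma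 v)_{\mathcal H}$ for all $u\in\operatorname{dom}(L)$, $v\in\mathfrak L$. $\mathcal D_0=\Gamma D[A_N]=\{e\in\mathcal H:\gamma(i)e\in\operatorname{ran}(A_F^{1/2})\}$, where $A_N$ is the Kreĭn–von Neumann extension of $A$ (the minimal nonnegative selfadjoint extension in the sense of forms) and $D[A_N]=\operatorname{dom}(A_N^{1/2})$. *)

theory Defs
  imports "HOL-Analysis.Analysis"
begin

section \<open>Complex Hilbert spaces\<close>

text \<open>The inner product is linear in the first argument. The real vector space structure, the
  norm and completeness are those of the library class \<^class>\<open>banach\<close>; the trivial space is allowed.\<close>

class complex_hilbert = banach +
  fixes scaleC :: "complex \<Rightarrow> 'a \<Rightarrow> 'a"  (infixr "*\<^sub>C" 75)
    and cinner :: "'a \<Rightarrow> 'a \<Rightarrow> complex"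
  assumes scaleC_add_right: "a *\<^sub>C (x + y) = a *\<^sub>C x + a *\<^sub>C y"
    and scaleC_add_left: "(a + b) *\<^sub>C x = a *\<^sub>C x + b *\<^sub>C x"
    and scaleC_scaleC: "a *\<^sub>C (b *\<^sub>C x) = (a * b) *\<^sub>C x"
    and scaleC_of_real: "complex_of_real r *\<^sub>C x = r *\<^sub>R x"
    and cinner_commute: "cinner x y = cnj (cinner y x)"
    and cinner_add_left: "cinner (x + y) z = cinner x z + cinner y z"
    and cinner_scaleC_left: "cinner (a *\<^sub>C x) y = a * cinner x y"
    and cinner_norm: "cinner x x = complex_of_real ((norm x)\<^sup>2)"

instantiation complex :: complex_hilbert
begin

definition "scaleC_complex (a :: complex) (x :: complex) = a * x"
definition "cinner_complex (x :: complex) (y :: complex) = x * cnj y"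

instance
proof
  fix a b x y z :: complex and r :: real
  show "a *\<^sub>C (x + y) = a *\<^sub>C x + a *\<^sub>C y"
    by (simp add: scaleC_complex_def distrib_left)
  show "(a + b) *\<^sub>C x = a *\<^sub>C x + b *\<^sub>C x"
    by (simp add: scaleC_complex_def distrib_right)
  show "a *\<^sub>C (b *\<^sub>C x) = (a * b) *\<^sub>C x"
    by (simp add: scaleC_complex_def mult.assoc)
  show "complex_of_real r *\<^sub>C x = r *\<^sub>R x"
    by (simp add: scaleC_complex_def scaleR_conv_of_real)
  show "cinner x y = cnj (cinner y x)"
    by (simp add: cinner_complex_def mult.commute)
  show "cinner (x + y) z = cinner x z + cinner y z"
    by (simp add: cinner_complex_def distrib_right)
  show "cinner (a *\<^sub>C x) y = a * cinner x y"
    by (simp add: cinner_complex_def scaleC_complex_def mult.assoc)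
  show "cinner x x = complex_of_real ((norm x)\<^sup>2)"
    by (simp add: cinner_complex_def complex_norm_square del: of_real_power)
qed

end


section \<open>Linear relations and operators\<close>

text \<open>Relations are subsets of a product space, and an unbounded operator is identified with its
  graph. Hence domain, range, inverse and extension are \<^const>\<open>Domain\<close>, \<^const>\<open>Range\<close>,
  \<^const>\<open>converse\<close> and inclusion.\<close>

definition linear_relation :: "('a::complex_hilbert \<times> 'b::complex_hilbert) set \<Rightarrow> bool" where
  "linear_relation T \<longleftrightarrow>
     (0, 0) \<in> T \<and>
     (\<forall>x y x' y'. (x, y) \<in> T \<longrightarrow> (x', y') \<in> T \<longrightarrow> (x + x', y + y') \<in> T) \<and>
     (\<forall>c x y. (x, y) \<in> T \<longrightarrow> (c *\<^sub>C x, c *\<^sub>C y) \<in> T)"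

definition linear_operator :: "('a::complex_hilbert \<times> 'b::complex_hilbert) set \<Rightarrow> bool" where
  "linear_operator T \<longleftrightarrow> linear_relation T \<and> single_valued T"

definition app :: "('a \<times> 'b) set \<Rightarrow> 'a \<Rightarrow> 'b" where
  "app T x = (THE y. (x, y) \<in> T)"

definition bounded_everywhere_defined ::
    "('a::complex_hilbert \<times> 'b::complex_hilbert) set \<Rightarrow> bool" where
  "bounded_everywhere_defined T \<longleftrightarrow>
     linear_operator T \<and> Domain T = UNIV \<and> (\<exists>C. \<forall>(x, y) \<in> T. norm y \<le> C * norm x)"

definition relation_minus ::
    "('a::complex_hilbert \<times> 'b::complex_hilbert) set \<Rightarrow> ('a \<Rightarrow> 'b) \<Rightarrow> ('a \<times> 'b) set" where
  "relation_minus T B = {(x, y - B x) | x y. (x, y) \<in> T}"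

definition rel_kernel :: "('a::complex_hilbert \<times> 'b::complex_hilbert) set \<Rightarrow> 'a set" where
  "rel_kernel T = {x. (x, 0) \<in> T}"

definition shift :: "('a::complex_hilbert \<times> 'a) set \<Rightarrow> complex \<Rightarrow> ('a \<times> 'a) set" where
  "shift T z = relation_minus T (\<lambda>x. z *\<^sub>C x)"

definition resolvent :: "('a::complex_hilbert \<times> 'a) set \<Rightarrow> complex \<Rightarrow> ('a \<times> 'a) set" where
  "resolvent T z = (shift T z)\<inverse>"

definition resolvent_set :: "('a::complex_hilbert \<times> 'a) set \<Rightarrow> complex set" where
  "resolvent_set T = {z. bounded_everywhere_defined (resolvent T z)}"

definition eigenvalue :: "('a::complex_hilbert \<times> 'a) set \<Rightarrow> complex \<Rightarrow> bool" where
  "eigenvalue T z \<longleftrightarrow> (\<exists>u. u \<noteq> 0 \<and> (u, z *\<^sub>C u) \<in> T)"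

definition adjoint_relation ::
    "('a::complex_hilbert \<times> 'b::complex_hilbert) set \<Rightarrow> ('b \<times> 'a) set" where
  "adjoint_relation T = {(u, w). \<forall>(x, y) \<in> T. cinner y u = cinner x w}"

text \<open>Adjoint of an everywhere defined bounded operator given as a function.\<close>

definition bounded_adjoint :: "('a::complex_hilbert \<Rightarrow> 'b::complex_hilbert) \<Rightarrow> 'b \<Rightarrow> 'a" where
  "bounded_adjoint B y = (THE x. \<forall>e. cinner (B e) y = cinner e x)"

definition symmetric_operator :: "('a::complex_hilbert \<times> 'a) set \<Rightarrow> bool" where
  "symmetric_operator T \<longleftrightarrow>
     linear_operator T \<and> (\<forall>(x, y) \<in> T. \<forall>(x', y') \<in> T. cinner y x' = cinner x y')"

text \<open>Selfadjointness in a closed subspace \<open>M\<close>, regarded as a Hilbert space of its own.\<close>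

definition selfadjoint_in :: "'a::complex_hilbert set \<Rightarrow> ('a \<times> 'a) set \<Rightarrow> bool" where
  "selfadjoint_in M T \<longleftrightarrow>
     linear_operator T \<and> T \<subseteq> M \<times> M \<and> closure (Domain T) = M \<and>
     adjoint_relation T \<inter> M \<times> M = T"

definition accretive :: "('a::complex_hilbert \<times> 'a) set \<Rightarrow> bool" where
  "accretive T \<longleftrightarrow> (\<forall>(x, y) \<in> T. 0 \<le> Re (cinner y x))"

text \<open>A symmetric operator is nonnegative iff it is accretive, its quadratic form being real.\<close>

definition nonnegative_symmetric :: "('a::complex_hilbert \<times> 'a) set \<Rightarrow> bool" where
  "nonnegative_symmetric T \<longleftrightarrow> symmetric_operator T \<and> accretive T"

text \<open>In \<open>m_accretive_operator\<close> only extensions that are operators compete, in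
  \<open>m_accretive_relation\<close> all linear relations do.\<close>

definition m_accretive_operator :: "('a::complex_hilbert \<times> 'a) set \<Rightarrow> bool" where
  "m_accretive_operator T \<longleftrightarrow>
     linear_operator T \<and> accretive T \<and> closed T \<and>
     (\<forall>S. linear_operator S \<longrightarrow> accretive S \<longrightarrow> T \<subseteq> S \<longrightarrow> S = T)"

definition m_accretive_relation :: "('a::complex_hilbert \<times> 'a) set \<Rightarrow> bool" where
  "m_accretive_relation Z \<longleftrightarrow>
     linear_relation Z \<and> accretive Z \<and>
     (\<forall>S. linear_relation S \<longrightarrow> accretive S \<longrightarrow> Z \<subseteq> S \<longrightarrow> S = Z)"

text \<open>The nonnegative selfadjoint square root of a nonnegative operator that is selfadjoint in \<open>M\<close>.\<close>

definition op_sqrt_in :: "'a::complex_hilbert set \<Rightarrow> ('a \<times> 'a) set \<Rightarrow> ('a \<times> 'a) set" where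
  "op_sqrt_in M T = (THE B. selfadjoint_in M B \<and> accretive B \<and> B O B = T)"


section \<open>The Friedrichs extension\<close>

text \<open>\<open>form_converges A X u\<close>: the sequence \<open>X\<close> in the domain of \<open>A\<close> converges to \<open>u\<close> and is
  Cauchy for the form \<open>(Ax, x)\<close>. The closure of the form is defined by limits along such sequences,
  and the Friedrichs extension is the operator associated with the closed form.\<close>

definition form_converges ::
    "('a::complex_hilbert \<times> 'a) set \<Rightarrow> (nat \<Rightarrow> 'a) \<Rightarrow> 'a \<Rightarrow> bool" where
  "form_converges A X u \<longleftrightarrow>
     (\<forall>n. X n \<in> Domain A) \<and> X \<longlonglongrightarrow> u \<and>
     (\<forall>\<epsilon>>0. \<exists>N. \<forall>m\<ge>N. \<forall>n\<ge>N. Re (cinner (app A (X m - X n)) (X m - X n)) < \<epsilon>)"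

definition closed_form_domain :: "('a::complex_hilbert \<times> 'a) set \<Rightarrow> 'a set" where
  "closed_form_domain A = {u. \<exists>X. form_converges A X u}"

definition closed_form :: "('a::complex_hilbert \<times> 'a) set \<Rightarrow> 'a \<Rightarrow> 'a \<Rightarrow> complex" where
  "closed_form A u v =
     (THE c. \<forall>X Y. form_converges A X u \<longrightarrow> form_converges A Y v \<longrightarrow>
        (\<lambda>n. cinner (app A (X n)) (Y n)) \<longlonglongrightarrow> c)"

definition friedrichs :: "('a::complex_hilbert \<times> 'a) set \<Rightarrow> ('a \<times> 'a) set" where
  "friedrichs A =
     {(u, w). u \<in> closed_form_domain A \<and>
        (\<forall>v \<in> closed_form_domain A. closed_form A u v = cinner w v)}"

abbreviation sqrtF :: "('a::complex_hilbert \<times> 'a) set \<Rightarrow> ('a \<times> 'a) set" where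
  "sqrtF A \<equiv> op_sqrt_in UNIV (friedrichs A)"

text \<open>\<open>formD A\<close> is \<open>D[A] = D[A\<^sub>F]\<close>.\<close>

definition formD :: "('a::complex_hilbert \<times> 'a) set \<Rightarrow> 'a set" where
  "formD A = Domain (sqrtF A)"

text \<open>The part of \<open>A\<^sub>F\<close> in the closure of its range, and the inverse of its square root there, which
  is defined on the range of \<open>sqrtF A\<close>.\<close>

definition ranF :: "('a::complex_hilbert \<times> 'a) set \<Rightarrow> 'a set" where
  "ranF A = closure (Range (friedrichs A))"

definition friedrichs_hat :: "('a::complex_hilbert \<times> 'a) set \<Rightarrow> ('a \<times> 'a) set" where
  "friedrichs_hat A = {(u, w) \<in> friedrichs A. u \<in> ranF A}"

definition inv_sqrt_hat :: "('a::complex_hilbert \<times> 'a) set \<Rightarrow> ('a \<times> 'a) set" where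
  "inv_sqrt_hat A = (op_sqrt_in (ranF A) (friedrichs_hat A))\<inverse>"


section \<open>Boundary pairs and boundary triplets\<close>

definition defect :: "('a::complex_hilbert \<times> 'a) set \<Rightarrow> complex \<Rightarrow> 'a set" where
  "defect A z = {u. (u, z *\<^sub>C u) \<in> adjoint_relation A}"

text \<open>\<open>D[A] + defect A z\<close> does not depend on the choice of \<open>z\<close> in the resolvent set of \<open>A\<^sub>F\<close>, which
  contains \<open>-1\<close>.\<close>

definition Lspace :: "('a::complex_hilbert \<times> 'a) set \<Rightarrow> 'a set" where
  "Lspace A = {f + w | f w. f \<in> formD A \<and> w \<in> defect A (-1)}"

definition projF :: "('a::complex_hilbert \<times> 'a) set \<Rightarrow> complex \<Rightarrow> 'a \<Rightarrow> 'a" where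
  "projF A z u = (THE f. f \<in> formD A \<and> u - f \<in> defect A z)"

definition projN :: "('a::complex_hilbert \<times> 'a) set \<Rightarrow> complex \<Rightarrow> 'a \<Rightarrow> 'a" where
  "projN A z u = (THE w. w \<in> defect A z \<and> u - w \<in> formD A)"

definition Linner :: "('a::complex_hilbert \<times> 'a) set \<Rightarrow> 'a \<Rightarrow> 'a \<Rightarrow> complex" where
  "Linner A u v =
     cinner (app (sqrtF A) (projF A (-1) u)) (app (sqrtF A) (projF A (-1) v))
     + cinner (projN A (-1) u) (projN A (-1) v) + cinner u v"

text \<open>Maps on \<open>Lspace A\<close> or on the domain of the adjoint are total functions of which only
  the values there matter.\<close>

definition linear_on :: "'a set \<Rightarrow> ('a::complex_hilbert \<Rightarrow> 'b::complex_hilbert) \<Rightarrow> bool" where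
  "linear_on S f \<longleftrightarrow>
     (\<forall>u\<in>S. \<forall>v\<in>S. f (u + v) = f u + f v) \<and> (\<forall>c. \<forall>u\<in>S. f (c *\<^sub>C u) = c *\<^sub>C f u)"

definition boundary_pair ::
    "('a::complex_hilbert \<times> 'a) set \<Rightarrow> ('a \<Rightarrow> 'h::complex_hilbert) \<Rightarrow> bool" where
  "boundary_pair A \<Gamma> \<longleftrightarrow>
     linear_on (Lspace A) \<Gamma> \<and>
     (\<exists>C. \<forall>u\<in>Lspace A. norm (\<Gamma> u) \<le> C * sqrt (Re (Linner A u u))) \<and>
     {u \<in> Lspace A. \<Gamma> u = 0} = formD A \<and>
     \<Gamma> ` Lspace A = UNIV"

definition gammaf ::
    "('a::complex_hilbert \<times> 'a) set \<Rightarrow> ('a \<Rightarrow> 'h::complex_hilbert) \<Rightarrow> complex \<Rightarrow> 'h \<Rightarrow> 'a" where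
  "gammaf A \<Gamma> z e = (THE u. u \<in> defect A z \<and> \<Gamma> u = e)"

definition gamma_adj ::
    "('a::complex_hilbert \<times> 'a) set \<Rightarrow> ('a \<Rightarrow> 'h::complex_hilbert) \<Rightarrow> complex \<Rightarrow> 'a \<Rightarrow> 'h" where
  "gamma_adj A \<Gamma> z = bounded_adjoint (gammaf A \<Gamma> z)"

definition Qfun ::
    "('a::complex_hilbert \<times> 'a) set \<Rightarrow> ('a \<Rightarrow> 'h::complex_hilbert) \<Rightarrow> complex \<Rightarrow> 'h \<Rightarrow> 'h" where
  "Qfun A \<Gamma> z e = (z - \<i>) *\<^sub>C gamma_adj A \<Gamma> \<i> (gammaf A \<Gamma> z e)"

text \<open>\<open>((z + \<i>) / (z - \<i>)) Q(z)\<close>, continued to \<open>z = \<i>\<close>.\<close>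

definition Qscaled ::
    "('a::complex_hilbert \<times> 'a) set \<Rightarrow> ('a \<Rightarrow> 'h::complex_hilbert) \<Rightarrow> complex \<Rightarrow> 'h \<Rightarrow> 'h" where
  "Qscaled A \<Gamma> z e =
     (if z = \<i> then (z + \<i>) *\<^sub>C gamma_adj A \<Gamma> \<i> (gammaf A \<Gamma> z e)
      else ((z + \<i>) / (z - \<i>)) *\<^sub>C Qfun A \<Gamma> z e)"

definition lform :: "('a::complex_hilbert \<times> 'a) set \<Rightarrow> 'a \<Rightarrow> 'a \<Rightarrow> complex" where
  "lform A u v =
     cinner (app (sqrtF A) (projF A \<i> u)) (app (sqrtF A) (projF A \<i> v))
     - \<i> * cinner (projN A \<i> u) (projF A \<i> v)
     - \<i> * cinner (projF A \<i> u) (projN A \<i> v)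
     - \<i> * cinner (projN A \<i> u) (projN A \<i> v)"

definition Lop :: "('a::complex_hilbert \<times> 'a) set \<Rightarrow> ('a \<times> 'a) set" where
  "Lop A = {(f + w, g - \<i> *\<^sub>C w) | f g w. (f, g) \<in> friedrichs A \<and> w \<in> defect A \<i>}"

definition boundary_triplet ::
    "('a::complex_hilbert \<times> 'a) set \<Rightarrow> ('a \<Rightarrow> 'h::complex_hilbert) \<Rightarrow> ('a \<Rightarrow> 'h) \<Rightarrow> bool" where
  "boundary_triplet A G \<Gamma> \<longleftrightarrow>
     boundary_pair A \<Gamma> \<and> linear_on (Domain (Lop A)) G \<and>
     (\<forall>u\<in>Domain (Lop A). \<forall>v\<in>Lspace A.
        lform A u v = cinner (app (Lop A) u) v - cinner (G u) (\<Gamma> v))"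

text \<open>Equivalently, the image under \<open>\<Gamma>\<close> of the form domain of the Krein-von Neumann extension of \<open>A\<close>;
  the description through the range of \<open>A\<^sub>F\<close>'s square root is the one taken as definition.\<close>

definition D0 ::
    "('a::complex_hilbert \<times> 'a) set \<Rightarrow> ('a \<Rightarrow> 'h::complex_hilbert) \<Rightarrow> 'h set" where
  "D0 A \<Gamma> = {e. gammaf A \<Gamma> \<i> e \<in> Range (sqrtF A)}"


section \<open>The two sides of the correspondence\<close>

definition quasi_selfadjoint_extension ::
    "('a::complex_hilbert \<times> 'a) set \<Rightarrow> ('a \<times> 'a) set \<Rightarrow> bool" where
  "quasi_selfadjoint_extension A T \<longleftrightarrow> linear_operator T \<and> A \<subseteq> T \<and> T \<subseteq> adjoint_relation A"

definition admissible_relation ::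
    "('a::complex_hilbert \<times> 'a) set \<Rightarrow> ('a \<Rightarrow> 'h::complex_hilbert) \<Rightarrow> ('h \<times> 'h) set \<Rightarrow> bool" where
  "admissible_relation A \<Gamma> Z \<longleftrightarrow>
     m_accretive_relation Z \<and> Domain Z \<subseteq> D0 A \<Gamma> \<and>
     (\<forall>(e, h) \<in> Z. Re (cinner h e) \<ge> (norm (app (inv_sqrt_hat A) (gammaf A \<Gamma> \<i> e)))\<^sup>2)"

definition extension_of ::
    "('a::complex_hilbert \<times> 'a) set \<Rightarrow> ('a \<Rightarrow> 'h::complex_hilbert) \<Rightarrow> ('a \<Rightarrow> 'h) \<Rightarrow>
     ('h \<times> 'h) set \<Rightarrow> ('a \<times> 'a) set" where
  "extension_of A G \<Gamma> Z =
     {(u, w) \<in> adjoint_relation A.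
        (\<Gamma> u, G u) \<in> relation_minus Z
           (\<lambda>e. (2 * \<i>) *\<^sub>C gamma_adj A \<Gamma> \<i> (gammaf A \<Gamma> \<i> e))}"

end

theory Submission
  imports Defs
begin

text \<open>The proof rests on one vector. For \<open>(u, w)\<close> in the graph of \<open>A\<^sup>*\<close> put \<open>e = \<Gamma> u\<close> and
  \<open>h = \<gamma>\<^sup>*(i) (w + i u)\<close>. Testing the triplet identity with \<open>\<gamma>(i) e'\<close> gives
  \<open>h = G u + 2i \<gamma>\<^sup>*(i) \<gamma>(i) e\<close> (\<open>triplet_bmap\<close>), so the operator belonging to \<open>Z\<close> is the restriction
  of \<open>A\<^sup>*\<close> to those \<open>u\<close> with \<open>(e, h) \<in> Z\<close>. Since \<open>(u, w) \<mapsto> (e, h)\<close> maps the graph of \<open>A\<^sup>*\<close> onto all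
  pairs of boundary vectors with kernel \<open>A\<close> (\<open>bmap_surjective\<close>, \<open>bmap_kernel\<close>), this is a bijection between all
  linear relations and all quasi-selfadjoint extensions. It remains to match the accretive ones.

  The same vector is \<open>h = \<gamma>\<^sup>*(\<lambda>') (w - \<lambda> u) + Q' e\<close>, where \<open>\<lambda>'\<close> is the conjugate of \<open>\<lambda>\<close> and \<open>Q'\<close> the scaled
  \<open>Q\<close>-function at \<open>\<lambda>\<close> (\<open>bmap_eq\<close>). Hence \<open>(T - \<lambda>) u = f\<close> means that
  \<open>u = (A\<^sub>F - \<lambda>)\<inverse> f + \<gamma>(\<lambda>) e\<close> for some \<open>e\<close> with \<open>(e, \<gamma>\<^sup>*(\<lambda>') f) \<in> Z - Q'\<close> (\<open>ext_resolvent\<close>). The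
  statements on regular points, resolvents and eigenvalues follow, because \<open>\<gamma>(\<lambda>)\<close> is bounded and
  bounded below, and therefore \<open>\<gamma>\<^sup>*(\<lambda>')\<close> is onto.

  For accretivity, let \<open>v = u - \<gamma>(i) e\<close>, a vector of the form domain. The form of \<open>A\<^sup>*\<close> at \<open>u\<close> has real part
  \<open>\<parallel>A\<^sub>F\<^sup>1\<^sup>/\<^sup>2 v\<parallel>\<^sup>2 + 2 Im (v, \<gamma>(i) e) + Re (h, e)\<close> (\<open>form_identity\<close>). Vectors of the domain of \<open>A\<close> may be
  added to \<open>u\<close> without changing \<open>(e, h)\<close>, and they form a core of the root of \<open>A\<^sub>F\<close>; so \<open>T\<close> is accretive
  iff this expression is nonnegative for all \<open>v\<close> in the form domain and all \<open>(e, h) \<in> Z\<close>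
  (\<open>accretive_ext_iff\<close>). The infimum over \<open>v\<close> of the first two terms is minus the squared norm of the
  inverse root at \<open>\<gamma>(i) e\<close>, or minus infinity if \<open>\<gamma>(i) e\<close> is not in the range of the root
  (\<open>inverse_sqrt_bound\<close>). This is the condition on \<open>Z\<close> in the theorem.

  For maximality, \<open>T\<close> is m-accretive iff \<open>T + 1\<close> is onto, that is, iff \<open>Z - Q'\<close> is onto for \<open>\<lambda> = -1\<close>. The
  choice \<open>v = \<gamma>(-1) e - \<gamma>(i) e\<close> in the inequality above yields \<open>Re (h - Q' e, e) \<ge> \<parallel>\<gamma>(-1) e\<parallel>\<^sup>2\<close>
  (\<open>strict_lower_bound\<close>). So \<open>Z - Q'\<close> is strictly accretive; for such a relation surjectivity is
  maximality, and maximality is inherited by \<open>Z\<close> and from \<open>Z\<close> because \<open>Q'\<close> is bounded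
  (\<open>m_accretive_bounded_perturbation\<close>, \<open>m_accretive_ext_iff\<close>).

  The operator theory underneath is built from minimizing sequences (\<open>riesz_sequence\<close>): they give
  the Riesz theorem, the surjectivity of \<open>A\<^sub>F + 1\<close>, and the range of an unbounded root. The root itself is
  composed of two bounded roots (\<open>nonneg_selfadjoint_parametrization\<close>), and the boundedness of the
  \<open>\<gamma>\<close>-field comes from uniform boundedness (\<open>bounded_inverse\<close>).\<close>

section \<open>Geometry of complex Hilbert spaces\<close>

lemma scaleC_zero_left [simp]: "0 *\<^sub>C x = 0"
  using scaleC_of_real[of 0 x] by simp

lemma scaleC_one [simp]: "1 *\<^sub>C x = x"
  using scaleC_of_real[of 1 x] by simp

lemma scaleC_zero_right [simp]: "a *\<^sub>C (0 :: 'a::complex_hilbert) = 0"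
  using scaleC_add_right[of a 0 "0 :: 'a"] by simp

lemma scaleC_minus_right [simp]: "a *\<^sub>C (- x) = - (a *\<^sub>C x)"
  using scaleC_add_right[of a x "- x"] by (simp add: eq_neg_iff_add_eq_0 add.commute)

lemma scaleC_minus_left [simp]: "(- a) *\<^sub>C x = - (a *\<^sub>C x)"
  using scaleC_add_left[of a "- a" x] by (simp add: eq_neg_iff_add_eq_0 add.commute)

lemma scaleC_diff_right: "a *\<^sub>C (x - y) = a *\<^sub>C x - a *\<^sub>C y"
  using scaleC_add_right[of a x "- y"] by simp

lemma scaleC_diff_left: "(a - b) *\<^sub>C x = a *\<^sub>C x - b *\<^sub>C x"
  using scaleC_add_left[of a "- b" x] by simp

lemma cinner_add_right: "cinner x (y + z) = cinner x y + cinner x z"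
  by (metis cinner_add_left cinner_commute complex_cnj_add)

lemma cinner_scaleC_right: "cinner x (a *\<^sub>C y) = cnj a * cinner x y"
  by (metis cinner_commute cinner_scaleC_left complex_cnj_mult)

lemma cinner_zero_left [simp]: "cinner 0 x = 0"
  using cinner_add_left[of 0 0 x] by simp

lemma cinner_zero_right [simp]: "cinner x 0 = 0"
  using cinner_add_right[of x 0 0] by simp

lemma cinner_minus_left [simp]: "cinner (- x) y = - cinner x y"
  using cinner_add_left[of x "- x" y] by (simp add: eq_neg_iff_add_eq_0 add.commute)

lemma cinner_minus_right [simp]: "cinner x (- y) = - cinner x y"
  using cinner_add_right[of x y "- y"] by (simp add: eq_neg_iff_add_eq_0 add.commute)

lemma cinner_diff_left: "cinner (x - y) z = cinner x z - cinner y z"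
  using cinner_add_left[of x "- y" z] by simp

lemma cinner_diff_right: "cinner x (y - z) = cinner x y - cinner x z"
  using cinner_add_right[of x y "- z"] by simp

lemmas cinner_simps = cinner_add_left cinner_add_right cinner_diff_left cinner_diff_right
  cinner_scaleC_left cinner_scaleC_right

lemma Re_cinner_commute: "Re (cinner x y) = Re (cinner y x)"
  using cinner_commute[of x y] by simp

lemma Im_cinner_commute: "Im (cinner x y) = - Im (cinner y x)"
  using cinner_commute[of x y] by simp

lemma Re_cinner_self: "Re (cinner x x) = (norm x)\<^sup>2"
  by (simp add: cinner_norm del: of_real_power)

lemma Re_cinner_self_nonneg [simp]: "0 \<le> Re (cinner x x)"
  by (simp add: Re_cinner_self)

lemma norm_scaleC [simp]: "norm (a *\<^sub>C x) = cmod a * norm x"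
proof -
  have "complex_of_real ((norm (a *\<^sub>C x))\<^sup>2) = a * cnj a * complex_of_real ((norm x)\<^sup>2)"
    by (simp only: cinner_norm[symmetric] cinner_scaleC_left cinner_scaleC_right ac_simps)
  also have "\<dots> = complex_of_real ((cmod a * norm x)\<^sup>2)"
    by (simp add: complex_norm_square[symmetric] power_mult_distrib)
  finally have "(norm (a *\<^sub>C x))\<^sup>2 = (cmod a * norm x)\<^sup>2"
    by (simp only: of_real_eq_iff)
  then show ?thesis by (simp add: power2_eq_iff_nonneg)
qed

lemma norm_add_squared: "(norm (x + y))\<^sup>2 = (norm x)\<^sup>2 + (norm y)\<^sup>2 + 2 * Re (cinner x y)"
  by (simp add: Re_cinner_self[symmetric] cinner_simps Re_cinner_commute[of y x])

lemma norm_diff_squared: "(norm (x - y))\<^sup>2 = (norm x)\<^sup>2 + (norm y)\<^sup>2 - 2 * Re (cinner x y)"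
  using norm_add_squared[of x "- y"] by simp

definition complex_subspace :: "'a::complex_hilbert set \<Rightarrow> bool" where
  "complex_subspace V \<longleftrightarrow>
     0 \<in> V \<and> (\<forall>x\<in>V. \<forall>y\<in>V. x + y \<in> V) \<and> (\<forall>c. \<forall>x\<in>V. c *\<^sub>C x \<in> V)"

lemma complex_subspace_UNIV [simp]: "complex_subspace UNIV"
  by (simp add: complex_subspace_def)

lemma complex_subspaceD:
  assumes "complex_subspace V"
  shows "0 \<in> V" "x \<in> V \<Longrightarrow> y \<in> V \<Longrightarrow> x + y \<in> V" "x \<in> V \<Longrightarrow> c *\<^sub>C x \<in> V"
    "x \<in> V \<Longrightarrow> - x \<in> V" "x \<in> V \<Longrightarrow> y \<in> V \<Longrightarrow> x - y \<in> V"
proof -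
  show 0: "0 \<in> V" and 1: "\<And>x y. x \<in> V \<Longrightarrow> y \<in> V \<Longrightarrow> x + y \<in> V" and
    2: "\<And>c x. x \<in> V \<Longrightarrow> c *\<^sub>C x \<in> V"
    using assms by (auto simp: complex_subspace_def)
  show 3: "- x \<in> V" if "x \<in> V" for x using 2[OF that, of "- 1"] by simp
  show "x - y \<in> V" if "x \<in> V" "y \<in> V" using 1[OF that(1) 3[OF that(2)]] by simp
qed

lemma discriminant_bound:
  fixes a r \<epsilon> :: real
  assumes "\<And>t. a * t\<^sup>2 + 2 * t * r \<ge> - \<epsilon>" "0 \<le> a"
  shows "r\<^sup>2 \<le> a * \<epsilon>"
proof (cases "a = 0")
  case True
  have "r = 0"
  proof (rule ccontr)
    assume "r \<noteq> 0"
    then show False using assms(1)[of "- (\<epsilon> + 1) / (2 * r)"] True by simp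
  qed
  then show ?thesis using True by simp
next
  case False
  then have "0 < a" using assms by simp
  then show ?thesis
    using assms(1)[of "- r / a"] by (simp add: field_simps power2_eq_square)
qed

lemma semi_inner_cauchy_schwarz:
  fixes V :: "'a::complex_hilbert set" and q :: "'a \<Rightarrow> 'a \<Rightarrow> complex"
  assumes V: "complex_subspace V"
    and qa: "\<And>x y z. x \<in> V \<Longrightarrow> y \<in> V \<Longrightarrow> z \<in> V \<Longrightarrow> q (x + y) z = q x z + q y z"
    and qs: "\<And>c x y. x \<in> V \<Longrightarrow> y \<in> V \<Longrightarrow> q (c *\<^sub>C x) y = c * q x y"
    and qh: "\<And>x y. x \<in> V \<Longrightarrow> y \<in> V \<Longrightarrow> q x y = cnj (q y x)"
    and qp: "\<And>x. x \<in> V \<Longrightarrow> 0 \<le> Re (q x x)"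
    and xy: "x \<in> V" "y \<in> V"
  shows "(cmod (q x y))\<^sup>2 \<le> Re (q x x) * Re (q y y)"
proof (cases "q x y = 0")
  case True
  then show ?thesis using qp xy by simp
next
  case False
  let ?z = "q x y"
  have "((cmod ?z)\<^sup>2)\<^sup>2 \<le> ((cmod ?z)\<^sup>2 * Re (q y y)) * Re (q x x)"
  proof (rule discriminant_bound)
    fix t :: real
    let ?c = "complex_of_real t * ?z"
    have w: "?c *\<^sub>C y \<in> V" "x + ?c *\<^sub>C y \<in> V" using complex_subspaceD(2,3)[OF V] xy by blast+
    have right: "q u (x + ?c *\<^sub>C y) = q u x + cnj ?c * q u y" if u: "u \<in> V" for u
    proof -
      have "q u (x + ?c *\<^sub>C y) = cnj (q (x + ?c *\<^sub>C y) u)" by (rule qh[OF u w(2)])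
      also have "\<dots> = cnj (q x u) + cnj ?c * cnj (q y u)"
        by (simp only: qa[OF xy(1) w(1) u] qs[OF xy(2) u] complex_cnj_add complex_cnj_mult)
      finally show ?thesis by (simp only: qh[OF u xy(1), symmetric] qh[OF u xy(2), symmetric])
    qed
    have "q (x + ?c *\<^sub>C y) (x + ?c *\<^sub>C y) = q x (x + ?c *\<^sub>C y) + ?c * q y (x + ?c *\<^sub>C y)"
      by (simp only: qa[OF xy(1) w] qs[OF xy(2) w(2)])
    also have "\<dots> = q x x + cnj ?c * ?z + ?c * (cnj ?z + cnj ?c * q y y)"
      by (simp only: right[OF xy(1)] right[OF xy(2)] qh[OF xy(2,1)])
    finally have "Re (q (x + ?c *\<^sub>C y) (x + ?c *\<^sub>C y))
        = Re (q x x + complex_of_real (2 * t) * (?z * cnj ?z) + complex_of_real (t * t) * (?z * cnj ?z) * q y y)"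
      by (simp add: algebra_simps)
    then show "- Re (q x x) \<le> (cmod ?z)\<^sup>2 * Re (q y y) * t\<^sup>2 + 2 * t * (cmod ?z)\<^sup>2"
      using qp[OF w(2)] unfolding complex_norm_square[symmetric] of_real_mult[symmetric]
      by (simp add: power2_eq_square algebra_simps del: of_real_mult of_real_power)
  qed (use qp xy in simp)
  then have "(cmod ?z)\<^sup>2 * (cmod ?z)\<^sup>2 \<le> (cmod ?z)\<^sup>2 * (Re (q x x) * Re (q y y))"
    by (simp add: power2_eq_square mult_ac)
  moreover have "0 < (cmod ?z)\<^sup>2" using False by simp
  ultimately show ?thesis by (simp only: mult_le_cancel_left_pos)
qed

lemma cauchy_schwarz: "cmod (cinner x y) \<le> norm x * norm y"
proof (rule power2_le_imp_le)
  have "(cmod (cinner x y))\<^sup>2 \<le> Re (cinner x x) * Re (cinner y y)"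
  proof (rule semi_inner_cauchy_schwarz[OF complex_subspace_UNIV])
    show "cinner x y = cnj (cinner y x)" for x y :: 'a by (rule cinner_commute)
  qed (simp_all add: cinner_simps)
  then show "(cmod (cinner x y))\<^sup>2 \<le> (norm x * norm y)\<^sup>2"
    by (simp only: Re_cinner_self power_mult_distrib)
qed simp

lemma bounded_bilinear_cinner: "bounded_bilinear cinner"
proof
  show "cinner (r *\<^sub>R a) b = r *\<^sub>R cinner a b" for r and a b :: 'a
    using cinner_scaleC_left[of "complex_of_real r" a b]
    by (simp add: scaleC_of_real scaleR_conv_of_real)
  show "cinner a (r *\<^sub>R b) = r *\<^sub>R cinner a b" for r and a b :: 'a
    using cinner_scaleC_right[of a "complex_of_real r" b]
    by (simp add: scaleC_of_real scaleR_conv_of_real)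
  show "\<exists>K. \<forall>a b :: 'a. norm (cinner a b) \<le> norm a * norm b * K"
    by (intro exI[of _ 1]) (simp add: cauchy_schwarz)
qed (simp_all add: cinner_simps)

lemmas tendsto_cinner = bounded_bilinear.tendsto[OF bounded_bilinear_cinner]

lemma bounded_linear_scaleC: "bounded_linear (\<lambda>x. a *\<^sub>C x)"
  by (rule bounded_linear_intro[of _ "cmod a"])
    (simp_all add: scaleC_add_right scaleC_of_real[symmetric] scaleC_scaleC mult.commute)

lemmas tendsto_scaleC = bounded_linear.tendsto[OF bounded_linear_scaleC]

lemma closed_orthogonal: "closed {y. cinner x y = 0}"
proof -
  have "continuous_on UNIV (cinner x)"
    by (rule linear_continuous_on[OF bounded_bilinear.bounded_linear_right[OF bounded_bilinear_cinner]])
  then show ?thesis using continuous_closed_preimage_constant[of UNIV "cinner x" 0] by simp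
qed

lemma orthogonal_to_closure:
  assumes "\<And>v. v \<in> V \<Longrightarrow> cinner x v = 0" "v \<in> closure V"
  shows "cinner x v = 0"
proof -
  have "closure V \<subseteq> {y. cinner x y = 0}"
    by (rule closure_minimal) (use assms closed_orthogonal in auto)
  then show ?thesis using assms by auto
qed

lemma orthogonal_to_dense:
  assumes "closure V = UNIV" "\<And>v. v \<in> V \<Longrightarrow> cinner x v = 0"
  shows "x = 0"
  using orthogonal_to_closure[of V x x] assms Re_cinner_self[of x] by simp

lemma cinner_eq_dense:
  assumes "closure V = UNIV" "\<And>v. v \<in> V \<Longrightarrow> cinner x v = cinner y v"
  shows "x = y"
  using orthogonal_to_dense[of V "x - y"] assms by (simp add: cinner_diff_left)

lemma cinner_eqI: "(\<And>v. cinner x v = cinner y v) \<Longrightarrow> x = y"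
  by (rule cinner_eq_dense[of UNIV]) auto

lemma complex_subspace_closure:
  assumes "complex_subspace V" shows "complex_subspace (closure V)"
  unfolding complex_subspace_def
proof (intro conjI ballI allI)
  show "0 \<in> closure V" using complex_subspaceD(1)[OF assms] closure_subset by blast
  fix x assume x: "x \<in> closure V"
  then obtain X where X: "\<And>n. X n \<in> V" "X \<longlonglongrightarrow> x" unfolding closure_sequential by blast
  show "x + y \<in> closure V" if "y \<in> closure V" for y
  proof -
    obtain Y where Y: "\<And>n. Y n \<in> V" "Y \<longlonglongrightarrow> y" using \<open>y \<in> closure V\<close>
      unfolding closure_sequential by blast
    show ?thesis unfolding closure_sequential
      using X Y complex_subspaceD(2)[OF assms] by (intro exI[of _ "\<lambda>n. X n + Y n"]) (auto intro: tendsto_add)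
  qed
  show "c *\<^sub>C x \<in> closure V" for c
    unfolding closure_sequential
    using X complex_subspaceD(3)[OF assms] by (intro exI[of _ "\<lambda>n. c *\<^sub>C X n"]) (auto intro: tendsto_scaleC)
qed

text \<open>Any sequence that minimizes \<open>q v v - 2 Re (l v)\<close> is Cauchy for \<open>q\<close> by the parallelogram law, and the
  numbers \<open>q (X n) v\<close> tend to \<open>l v\<close> because the derivative at a minimum vanishes. The inner product \<open>q\<close> may be
  degenerate and incomplete, hence a sequence instead of a vector. With the given inner product of a
  closed subspace this becomes the Riesz theorem; with a form given by an unbounded operator it
  produces elements of the domain of the closed form.\<close>

lemma riesz_sequence:
  fixes V :: "'a::complex_hilbert set" and q :: "'a \<Rightarrow> 'a \<Rightarrow> complex" and l :: "'a \<Rightarrow> complex"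
  assumes V: "complex_subspace V"
    and qa: "\<And>x y z. x \<in> V \<Longrightarrow> y \<in> V \<Longrightarrow> z \<in> V \<Longrightarrow> q (x + y) z = q x z + q y z"
    and qs: "\<And>c x y. x \<in> V \<Longrightarrow> y \<in> V \<Longrightarrow> q (c *\<^sub>C x) y = c * q x y"
    and qh: "\<And>x y. x \<in> V \<Longrightarrow> y \<in> V \<Longrightarrow> q x y = cnj (q y x)"
    and qp: "\<And>x. x \<in> V \<Longrightarrow> 0 \<le> Re (q x x)"
    and la: "\<And>x y. x \<in> V \<Longrightarrow> y \<in> V \<Longrightarrow> l (x + y) = l x + l y"
    and ls: "\<And>c x. x \<in> V \<Longrightarrow> l (c *\<^sub>C x) = cnj c * l x"
    and lb: "\<And>v. v \<in> V \<Longrightarrow> (cmod (l v))\<^sup>2 \<le> C * Re (q v v)" and C: "0 \<le> C"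
  obtains X where "\<And>n::nat. X n \<in> V"
    "\<And>\<epsilon>. 0 < \<epsilon> \<Longrightarrow> \<exists>N. \<forall>m\<ge>N. \<forall>n\<ge>N. Re (q (X m - X n) (X m - X n)) < \<epsilon>"
    "\<And>v. v \<in> V \<Longrightarrow> (\<lambda>n. q (X n) v) \<longlonglongrightarrow> l v"
proof -
  note VD = complex_subspaceD[OF V]
  define J where "J v = Re (q v v) - 2 * Re (l v)" for v
  have qa2: "q z (x + y) = q z x + q z y" if "x \<in> V" "y \<in> V" "z \<in> V" for x y z
    using qh[of z "x + y"] qh[of z x] qh[of z y] qa[of x y z] that VD by simp
  have qs2: "q y (c *\<^sub>C x) = cnj c * q y x" if "x \<in> V" "y \<in> V" for c x y
    using qh[of y "c *\<^sub>C x"] qs[of x y c] qh[of y x] that VD by simp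
  have Re_qh: "Re (q y x) = Re (q x y)" if "x \<in> V" "y \<in> V" for x y
    using qh[of y x] that by simp
  have Jlow: "- C \<le> J v" if "v \<in> V" for v
  proof -
    have "(2 * cmod (l v))\<^sup>2 \<le> 4 * (C * Re (q v v))" using lb[OF that] by (simp add: power_mult_distrib)
    also have "\<dots> \<le> (C + Re (q v v))\<^sup>2"
      using zero_le_power2[of "C - Re (q v v)"] by (simp add: power2_eq_square algebra_simps)
    finally have "2 * cmod (l v) \<le> C + Re (q v v)"
      using C qp[OF that] by (meson add_nonneg_nonneg power2_le_imp_le)
    then show ?thesis using complex_Re_le_cmod[of "l v"] by (simp add: J_def)
  qed
  have bdd: "bdd_below (J ` V)" using Jlow by (auto intro!: bdd_belowI[of _ "- C"])
  define m where "m = Inf (J ` V)"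
  have mle: "m \<le> J v" if "v \<in> V" for v using cInf_lower[OF imageI[OF that, of J] bdd] by (simp add: m_def)
  have "\<exists>x\<in>V. J x < m + 1 / (real n + 1)" for n :: nat
  proof -
    have "\<exists>y\<in>J ` V. y < m + 1 / (real n + 1)"
      unfolding m_def by (rule cInf_lessD) (use VD(1) in auto)
    then show ?thesis by auto
  qed
  then obtain X where X: "\<And>n::nat. X n \<in> V" "\<And>n. J (X n) < m + 1 / (real n + 1)" by metis
  have Jt: "J (x + complex_of_real t *\<^sub>C v) = J x + Re (q v v) * t\<^sup>2 + 2 * t * Re (q x v - l v)"
    if "x \<in> V" "v \<in> V" for x v t
  proof -
    let ?w = "complex_of_real t *\<^sub>C v"
    have w: "?w \<in> V" "x + ?w \<in> V" using that VD by blast+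
    have "q (x + ?w) (x + ?w) = q x x + t * q x v + t * q v x + t * t * q v v"
      by (simp only: qa[OF that(1) w] qa2[OF that(1) w(1) that(1)] qa2[OF that(1) w(1) w(1)]
        qs[OF that(2,1)] qs[OF that(2) w(1)] qs2[OF that(2,1)] qs2[OF that(2,2)]) (simp add: algebra_simps)
    then show ?thesis
      by (simp add: J_def la[OF that(1) w(1)] ls[OF that(2)] Re_qh[OF that] power2_eq_square algebra_simps)
  qed
  have cauchy: "Re (q (X i - X j) (X i - X j)) \<le> 2 / (real i + 1) + 2 / (real j + 1)" for i j
  proof -
    define x y where "x = X i" and "y = X j"
    have xy: "x \<in> V" "y \<in> V" unfolding x_def y_def by (rule X(1))+
    note V = xy VD(2)[OF xy] VD(4)[OF xy(2)] VD(3)[OF VD(2)[OF xy], of "1 / 2"]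
    have "q ((1 / 2) *\<^sub>C (x + y)) ((1 / 2) *\<^sub>C (x + y)) = (q x x + q x y + q y x + q y y) / 4"
      by (simp only: qs[OF V(3,5)] qs2[OF V(3,3)] qa[OF V(1,2,3)] qa2[OF V(1,2,1)] qa2[OF V(1,2,2)]) simp
    moreover have "l ((1 / 2) *\<^sub>C (x + y)) = (l x + l y) / 2"
      by (simp add: ls[OF V(3)] la[OF V(1,2)])
    moreover have "q (- y) z = - q y z" "q z (- y) = - q z y" if "z \<in> V" for z
      using qs[OF V(2) that, of "- 1"] qs2[OF V(2) that, of "- 1"] by simp_all
    then have "q (x + - y) (x + - y) = q x x - q x y - q y x + q y y"
      using V VD(2)[OF V(1,4)] by (simp add: qa[OF V(1,4)] qa2[OF V(1,4)] del: add_uminus_conv_diff)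
    ultimately have "Re (q ((1 / 2) *\<^sub>C (x + y)) ((1 / 2) *\<^sub>C (x + y)))
        = (Re (q x x) + Re (q x y) + Re (q y x) + Re (q y y)) / 4"
      "Re (l ((1 / 2) *\<^sub>C (x + y))) = (Re (l x) + Re (l y)) / 2"
      "Re (q (x - y) (x - y)) = Re (q x x) - Re (q x y) - Re (q y x) + Re (q y y)"
      by (simp_all only: add_uminus_conv_diff) simp_all
    then have "4 * J ((1 / 2) *\<^sub>C (x + y)) = 2 * J x + 2 * J y - Re (q (x - y) (x - y))"
      by (simp add: J_def)
    moreover have "4 * m \<le> 4 * J ((1 / 2) *\<^sub>C (x + y))" using mle[OF V(5)] by simp
    ultimately show ?thesis using X(2)[of i] X(2)[of j] by (simp add: x_def y_def)
  qed
  have inv: "(\<lambda>n. 1 / (real n + 1)) \<longlonglongrightarrow> 0"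
    using LIMSEQ_inverse_real_of_nat by (simp add: inverse_eq_divide add.commute)
  have Re_lim: "(\<lambda>n. Re (q (X n) v - l v)) \<longlonglongrightarrow> 0" if v: "v \<in> V" for v
  proof -
    have le: "(Re (q (X n) v - l v))\<^sup>2 \<le> Re (q v v) * (1 / (real n + 1))" for n
    proof (rule discriminant_bound)
      fix t :: real
      have "X n + complex_of_real t *\<^sub>C v \<in> V" using X v VD by blast
      then show "- (1 / (real n + 1)) \<le> Re (q v v) * t\<^sup>2 + 2 * t * Re (q (X n) v - l v)"
        using mle Jt[OF X(1)[of n] v, of t] X(2)[of n] by fastforce
    qed (use qp[OF v] in auto)
    have lim0: "(\<lambda>n. Re (q v v) * (1 / (real n + 1))) \<longlonglongrightarrow> 0"
      using tendsto_mult[OF tendsto_const inv] by simp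
    have "(\<lambda>n. (Re (q (X n) v - l v))\<^sup>2) \<longlonglongrightarrow> 0"
      by (rule tendsto_sandwich[OF always_eventually always_eventually tendsto_const lim0])
        (intro allI zero_le_power2 le)+
    from tendsto_real_sqrt[OF this] show ?thesis
      by (simp only: real_sqrt_abs real_sqrt_zero tendsto_rabs_zero_iff)
  qed
  have lim: "(\<lambda>n. q (X n) v) \<longlonglongrightarrow> l v" if v: "v \<in> V" for v
  proof -
    have iv: "\<i> *\<^sub>C v \<in> V" using v VD by blast
    have "Re (q (X n) (\<i> *\<^sub>C v) - l (\<i> *\<^sub>C v)) = Im (q (X n) v - l v)" for n
      using v X by (simp add: qs2 ls)
    then have "(\<lambda>n. Im (q (X n) v - l v)) \<longlonglongrightarrow> 0" using Re_lim[OF iv] by simp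
    with Re_lim[OF v] have "(\<lambda>n. Complex (Re (q (X n) v - l v)) (Im (q (X n) v - l v))) \<longlonglongrightarrow> Complex 0 0"
      by (rule tendsto_Complex)
    then have "(\<lambda>n. q (X n) v - l v) \<longlonglongrightarrow> 0" by (simp only: complex_surj zero_complex.code)
    then show ?thesis by (simp add: LIM_zero_iff)
  qed
  have "\<exists>N. \<forall>m\<ge>N. \<forall>n\<ge>N. Re (q (X m - X n) (X m - X n)) < \<epsilon>" if "0 < \<epsilon>" for \<epsilon>
  proof -
    from inv that obtain N where N: "\<And>n. n \<ge> N \<Longrightarrow> 1 / (real n + 1) < \<epsilon> / 4"
      using order_tendstoD(2)[of _ 0 sequentially "\<epsilon> / 4"] by (fastforce simp: eventually_sequentially)
    have "Re (q (X i - X j) (X i - X j)) < \<epsilon>" if "i \<ge> N" "j \<ge> N" for i j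
      using cauchy[of i j] N[OF that(1)] N[OF that(2)] by linarith
    then show ?thesis by blast
  qed
  then show thesis by (rule that[OF X(1) _ lim])
qed

lemma Cauchy_norm_squared:
  fixes Y :: "nat \<Rightarrow> 'a::complex_hilbert"
  assumes "\<And>\<epsilon>. 0 < \<epsilon> \<Longrightarrow> \<exists>N. \<forall>m\<ge>N. \<forall>n\<ge>N. (norm (Y m - Y n))\<^sup>2 < \<epsilon>"
  shows "Cauchy Y"
proof (rule CauchyI)
  fix e :: real assume "0 < e"
  then obtain N where "\<forall>m\<ge>N. \<forall>n\<ge>N. (norm (Y m - Y n))\<^sup>2 < e\<^sup>2" using assms[of "e\<^sup>2"] by auto
  then show "\<exists>M. \<forall>m\<ge>M. \<forall>n\<ge>M. norm (Y m - Y n) < e"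
    using \<open>0 < e\<close> by (metis less_imp_le power2_less_imp_less)
qed

lemma riesz_representation:
  fixes V :: "'a::complex_hilbert set"
  assumes V: "complex_subspace V" "closed V"
    and la: "\<And>x y. x \<in> V \<Longrightarrow> y \<in> V \<Longrightarrow> l (x + y) = l x + l y"
    and ls: "\<And>c x. x \<in> V \<Longrightarrow> l (c *\<^sub>C x) = cnj c * l x"
    and lb: "\<And>v. v \<in> V \<Longrightarrow> cmod (l v) \<le> C * norm v"
  obtains x where "x \<in> V" "\<And>v. v \<in> V \<Longrightarrow> cinner x v = l v"
proof -
  have lb': "(cmod (l v))\<^sup>2 \<le> C\<^sup>2 * Re (cinner v v)" if "v \<in> V" for v
    using power_mono[OF lb[OF that] norm_ge_zero, of 2] by (simp add: Re_cinner_self power_mult_distrib)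
  show thesis
  proof (rule riesz_sequence[OF V(1), of cinner l "C\<^sup>2"])
    show "cinner x y = cnj (cinner y x)" for x y :: 'a by (rule cinner_commute)
  next
    fix X :: "nat \<Rightarrow> 'a"
    assume X: "\<And>n. X n \<in> V"
      "\<And>\<epsilon>. 0 < \<epsilon> \<Longrightarrow> \<exists>N. \<forall>m\<ge>N. \<forall>n\<ge>N. Re (cinner (X m - X n) (X m - X n)) < \<epsilon>"
      "\<And>v. v \<in> V \<Longrightarrow> (\<lambda>n. cinner (X n) v) \<longlonglongrightarrow> l v"
    have "Cauchy X" using X(2) unfolding Re_cinner_self by (rule Cauchy_norm_squared)
    then obtain x where x: "X \<longlonglongrightarrow> x" using Cauchy_convergent convergent_def by blast
    show thesis
    proof (rule that)
      show "x \<in> V" using closed_sequentially[OF V(2) X(1) x] .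
      show "cinner x v = l v" if "v \<in> V" for v
        using LIMSEQ_unique[OF tendsto_cinner[OF x tendsto_const] X(3)[OF that]] .
    qed
  qed (simp_all add: la ls lb' cinner_add_left cinner_scaleC_left)
qed

lemma orthogonal_projection:
  fixes V :: "'a::complex_hilbert set"
  assumes "complex_subspace V" "closed V"
  obtains p where "p \<in> V" "\<And>v. v \<in> V \<Longrightarrow> cinner (x - p) v = 0"
proof -
  show thesis
  proof (rule riesz_representation[OF assms, of "cinner x" "norm x"])
    fix p assume "p \<in> V" "\<And>v. v \<in> V \<Longrightarrow> cinner p v = cinner x v"
    then show thesis by (intro that[of p]) (simp_all add: cinner_diff_left)
  qed (simp_all add: cinner_simps cauchy_schwarz)
qed

lemma closure_eq_UNIV_if_orthogonal_trivial:
  assumes V: "complex_subspace V" and "\<And>y. (\<And>v. v \<in> V \<Longrightarrow> cinner y v = 0) \<Longrightarrow> y = 0"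
  shows "closure V = UNIV"
proof (intro equalityI subset_UNIV subsetI)
  fix x
  obtain p where p: "p \<in> closure V" "\<And>v. v \<in> closure V \<Longrightarrow> cinner (x - p) v = 0"
    using orthogonal_projection[OF complex_subspace_closure[OF V] closed_closure, of x] by blast
  have "x - p = 0" by (rule assms(2), rule p(2)) (use closure_subset in blast)
  then show "x \<in> closure V" using p by simp
qed

subsection \<open>Bounded operators and their adjoints\<close>

definition bounded_clinear :: "('a::complex_hilbert \<Rightarrow> 'b::complex_hilbert) \<Rightarrow> bool" where
  "bounded_clinear B \<longleftrightarrow> linear_on UNIV B \<and> (\<exists>C. \<forall>x. norm (B x) \<le> C * norm x)"

lemma bounded_clinearD:
  assumes "bounded_clinear B"
  shows "B (x + y) = B x + B y" "B (c *\<^sub>C x) = c *\<^sub>C B x" "B 0 = 0" "B (- x) = - B x"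
    "B (x - y) = B x - B y" "bounded_linear B"
proof -
  show 1: "\<And>x y. B (x + y) = B x + B y" and 2: "\<And>c x. B (c *\<^sub>C x) = c *\<^sub>C B x"
    using assms by (auto simp: bounded_clinear_def linear_on_def)
  show "B 0 = 0" using 2[of 0 0] by simp
  show 3: "B (- x) = - B x" for x using 2[of "- 1" x] by simp
  show "B (x - y) = B x - B y" using 1[of x "- y"] 3[of y] by simp
  show "bounded_linear B"
  proof -
    obtain C where C: "\<And>x. norm (B x) \<le> C * norm x" using assms by (auto simp: bounded_clinear_def)
    show ?thesis
      by (rule bounded_linear_intro[of _ C])
        (use C in \<open>auto simp: 1 2 scaleC_of_real[symmetric] mult.commute\<close>)
  qed
qed

lemma bounded_clinearI:
  assumes "\<And>x y. B (x + y) = B x + B y" "\<And>c x. B (c *\<^sub>C x) = c *\<^sub>C B x"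
    "\<And>x. norm (B x) \<le> C * norm x"
  shows "bounded_clinear B"
  using assms by (auto simp: bounded_clinear_def linear_on_def)

lemma bounded_clinear_bound:
  assumes "bounded_clinear B"
  obtains C where "0 < C" "\<And>x. norm (B x) \<le> C * norm x"
  using bounded_linear.pos_bounded[OF bounded_clinearD(6)[OF assms]] by (metis mult.commute)

lemma bounded_clinear_compose:
  assumes "bounded_clinear f" "bounded_clinear g" shows "bounded_clinear (\<lambda>x. f (g x))"
proof -
  obtain C where C: "0 < C" "\<And>x. norm (f x) \<le> C * norm x" using bounded_clinear_bound[OF assms(1)] by blast
  obtain D where D: "0 < D" "\<And>x. norm (g x) \<le> D * norm x" using bounded_clinear_bound[OF assms(2)] by blast
  show ?thesis
  proof (rule bounded_clinearI[of _ "C * D"])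
    fix x
    have "norm (f (g x)) \<le> C * norm (g x)" by (rule C)
    also have "\<dots> \<le> C * (D * norm x)" using D C by (intro mult_left_mono) auto
    finally show "norm (f (g x)) \<le> C * D * norm x" by simp
  qed (simp_all add: bounded_clinearD[OF assms(1)] bounded_clinearD[OF assms(2)])
qed

lemma bounded_clinear_add:
  assumes "bounded_clinear f" "bounded_clinear g" shows "bounded_clinear (\<lambda>x. f x + g x)"
proof -
  obtain C where C: "0 < C" "\<And>x. norm (f x) \<le> C * norm x" using bounded_clinear_bound[OF assms(1)] by blast
  obtain D where D: "0 < D" "\<And>x. norm (g x) \<le> D * norm x" using bounded_clinear_bound[OF assms(2)] by blast
  show ?thesis
  proof (rule bounded_clinearI[of _ "C + D"])
    show "norm (f x + g x) \<le> (C + D) * norm x" for x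
      using norm_triangle_ineq[of "f x" "g x"] C(2)[of x] D(2)[of x] by (simp add: distrib_right)
  qed (simp_all add: bounded_clinearD[OF assms(1)] bounded_clinearD[OF assms(2)] scaleC_add_right)
qed

lemma bounded_clinear_scaleC: "bounded_clinear (\<lambda>x. a *\<^sub>C x)"
  by (rule bounded_clinearI[of _ "cmod a"]) (simp_all add: scaleC_add_right scaleC_scaleC mult.commute)

lemma bounded_clinear_uminus: "bounded_clinear f \<Longrightarrow> bounded_clinear (\<lambda>x. - f x)"
  using bounded_clinear_compose[OF bounded_clinear_scaleC[of "- 1"]] by simp

lemma cinner_bounded_adjoint:
  assumes B: "bounded_clinear B"
  shows "cinner (B e) y = cinner e (bounded_adjoint B y)"
proof -
  obtain C where C: "0 < C" "\<And>x. norm (B x) \<le> C * norm x" using bounded_clinear_bound[OF B] by blast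
  have "cmod (cinner y (B v)) \<le> (norm y * C) * norm v" for v
    using order_trans[OF cauchy_schwarz mult_left_mono[OF C(2) norm_ge_zero]] by (simp add: mult.assoc)
  note bd = this
  have "\<exists>x. \<forall>v. cinner x v = cinner y (B v)"
  proof (rule riesz_representation[of UNIV "\<lambda>v. cinner y (B v)" "norm y * C"])
    show "\<exists>x. \<forall>v. cinner x v = cinner y (B v)"
      if "\<And>v. v \<in> UNIV \<Longrightarrow> cinner x v = cinner y (B v)" for x
      using that by blast
  qed (simp_all add: bd bounded_clinearD(1,2)[OF B] cinner_simps)
  then obtain x where x: "\<And>v. cinner x v = cinner y (B v)" by blast
  have 1: "cinner (B e) y = cinner e x" for e
    using x[of e] cinner_commute[of "B e" y] cinner_commute[of e x] by simp
  have 2: "x' = x" if "\<forall>e. cinner (B e) y = cinner e x'" for x'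
  proof (rule cinner_eqI)
    fix v show "cinner x' v = cinner x v"
      using that 1 cinner_commute[of x' v] cinner_commute[of x v] by simp
  qed
  have "bounded_adjoint B y = x"
    unfolding bounded_adjoint_def by (rule the_equality) (use 1 2 in auto)
  with 1 show ?thesis by simp
qed

lemma bounded_clinear_adjoint:
  assumes B: "bounded_clinear B"
  shows "bounded_clinear (bounded_adjoint B)"
proof -
  obtain C where C: "0 < C" "\<And>x. norm (B x) \<le> C * norm x" using bounded_clinear_bound[OF B] by blast
  note adj = cinner_bounded_adjoint[OF B]
  have adj': "cinner (bounded_adjoint B y) e = cinner y (B e)" for e y
    using adj by (metis cinner_commute)
  show ?thesis
  proof (rule bounded_clinearI[of _ C])
    show "bounded_adjoint B (x + y) = bounded_adjoint B x + bounded_adjoint B y" for x y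
      by (rule cinner_eqI) (simp add: adj' cinner_simps)
    show "bounded_adjoint B (c *\<^sub>C x) = c *\<^sub>C bounded_adjoint B x" for c x
      by (rule cinner_eqI) (simp add: adj' cinner_simps)
    show "norm (bounded_adjoint B y) \<le> C * norm y" for y
    proof (cases "bounded_adjoint B y = 0")
      case False
      let ?z = "bounded_adjoint B y"
      have "(norm ?z)\<^sup>2 \<le> norm (B ?z) * norm y"
        using cauchy_schwarz[of "B ?z" y] complex_Re_le_cmod[of "cinner (B ?z) y"]
        by (simp add: adj Re_cinner_self[symmetric])
      also have "\<dots> \<le> (C * norm ?z) * norm y" by (intro mult_right_mono C) auto
      finally have "norm ?z * norm ?z \<le> norm ?z * (C * norm y)" by (simp add: power2_eq_square mult_ac)
      then show ?thesis using False by simp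
    qed (use C in simp)
  qed
qed


subsection \<open>Bounded bijections onto a Hilbert space\<close>

text \<open>By Baire's theorem one of the closed sets \<open>F k\<close> contains a ball. Subtracting the centre shows
  that all functionals are bounded on the ball of the same radius around zero.\<close>

lemma uniform_boundedness:
  fixes S :: "'h::complex_hilbert set"
  assumes "\<And>e. \<exists>k. \<forall>h\<in>S. cmod (cinner h e) \<le> k"
  obtains c where "\<And>h. h \<in> S \<Longrightarrow> norm h \<le> c"
proof -
  define F where "F k = {e. \<forall>h\<in>S. cmod (cinner h e) \<le> real k}" for k
  have cl: "closed (F k)" for k
  proof -
    have "closed {e. cmod (cinner h e) \<le> real k}" for h
    proof (rule closed_Collect_le)
      have "continuous_on UNIV (cinner h)"
        by (rule linear_continuous_on[OF bounded_bilinear.bounded_linear_right[OF bounded_bilinear_cinner]])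
      then show "continuous_on UNIV (\<lambda>e. cmod (cinner h e))" by (rule continuous_on_norm)
    qed (rule continuous_on_const)
    then have "closed (\<Inter>h\<in>S. {e. cmod (cinner h e) \<le> real k})" by (intro closed_INT) blast
    moreover have "F k = (\<Inter>h\<in>S. {e. cmod (cinner h e) \<le> real k})" by (auto simp: F_def)
    ultimately show ?thesis by simp
  qed
  have un: "\<Union>(range F) = UNIV"
  proof (intro equalityI subset_UNIV subsetI)
    fix e
    obtain k where k: "\<forall>h\<in>S. cmod (cinner h e) \<le> k" using assms by blast
    obtain n where "k \<le> real n" using real_arch_simple by blast
    with k have "e \<in> F n" by (force simp: F_def)
    then show "e \<in> \<Union>(range F)" by blast
  qed
  have "\<exists>k. interior (F k) \<noteq> {}"
  proof (rule ccontr)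
    assume "\<nexists>k. interior (F k) \<noteq> {}"
    then have "euclidean interior_of \<Union>(range F) = {}"
      by (intro Baire_category_alt) (auto simp: completely_metrizable_space_euclidean cl)
    then show False unfolding un by simp
  qed
  then obtain k e0 where "e0 \<in> interior (F k)" by blast
  then obtain r where r: "0 < r" "ball e0 r \<subseteq> F k" unfolding mem_interior by blast
  show thesis
  proof (rule that)
    fix h assume h: "h \<in> S"
    show "norm h \<le> 4 * real k / r"
    proof (cases "h = 0")
      case False
      define x where "x = complex_of_real (r / (2 * norm h)) *\<^sub>C h"
      have nx: "norm x = r / 2" using False r by (simp add: x_def norm_divide norm_mult)
      have "cmod (cinner h (e0 + x)) \<le> k" "cmod (cinner h e0) \<le> k"
        using r h nx by (auto simp: F_def dist_norm subset_eq)
      then have "cmod (cinner h x) \<le> 2 * k"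
        using norm_triangle_ineq4[of "cinner h (e0 + x)" "cinner h e0"] by (simp add: cinner_add_right)
      moreover have "cinner h x = complex_of_real (r * norm h / 2)"
        using False by (simp add: x_def cinner_scaleC_right cinner_norm power2_eq_square)
      then have "cmod (cinner h x) = r * norm h / 2" using r
        by (simp del: of_real_mult of_real_divide)
      ultimately show ?thesis using r by (simp add: field_simps)
    qed (use r in simp)
  qed
qed

text \<open>A form of the open mapping theorem. The adjoint \<open>L\<close> of \<open>K\<close> is bounded below: the \<open>h\<close> with
  \<open>\<parallel>L h\<parallel> \<le> 1\<close> are pointwise bounded as functionals on the range of \<open>K\<close>, which is everything. Consequently
  \<open>n\<close> is a limit of vectors \<open>L (X j)\<close>, and \<open>(n, L (X j)) = (K n, X j)\<close> is controlled by \<open>\<parallel>K n\<parallel>\<close>.\<close>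

lemma bounded_inverse:
  fixes N :: "'a::complex_hilbert set" and K :: "'a \<Rightarrow> 'h::complex_hilbert"
  assumes N: "complex_subspace N" "closed N"
    and K: "linear_on N K" "\<And>n. n \<in> N \<Longrightarrow> norm (K n) \<le> C * norm n"
    and surj: "K ` N = UNIV" and inj: "\<And>n. n \<in> N \<Longrightarrow> K n = 0 \<Longrightarrow> n = 0"
  obtains c where "\<And>n. n \<in> N \<Longrightarrow> norm n \<le> c * norm (K n)"
proof -
  note ND = complex_subspaceD[OF N(1)]
  have Ka: "K (x + y) = K x + K y" if "x \<in> N" "y \<in> N" for x y using K(1) that by (auto simp: linear_on_def)
  have Ks: "K (a *\<^sub>C x) = a *\<^sub>C K x" if "x \<in> N" for a x using K(1) that by (auto simp: linear_on_def)
  have ex: "\<exists>x\<in>N. \<forall>n\<in>N. cinner x n = cinner h (K n)" for h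
  proof (rule riesz_representation[OF N, of "\<lambda>n. cinner h (K n)" "norm h * C"])
    show "cmod (cinner h (K n)) \<le> norm h * C * norm n" if "n \<in> N" for n
      using order_trans[OF cauchy_schwarz mult_left_mono[OF K(2)[OF that] norm_ge_zero]] by (simp add: mult.assoc)
  qed (auto simp: Ka Ks cinner_simps)
  define L where "L h = (SOME x. x \<in> N \<and> (\<forall>n\<in>N. cinner x n = cinner h (K n)))" for h
  have L: "L h \<in> N \<and> (\<forall>n\<in>N. cinner (L h) n = cinner h (K n))" for h
    unfolding L_def by (rule someI_ex) (use ex in blast)
  have L1: "L h \<in> N" and L2: "n \<in> N \<Longrightarrow> cinner (L h) n = cinner h (K n)" for h n using L by blast+
  have LI: "x = L h" if "x \<in> N" "\<And>n. n \<in> N \<Longrightarrow> cinner x n = cinner h (K n)" for x h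
  proof -
    have "x - L h \<in> N" by (rule ND(5)[OF that(1) L1])
    then have "cinner (x - L h) (x - L h) = 0" using that(2) L2 by (simp add: cinner_diff_left)
    then show ?thesis using Re_cinner_self[of "x - L h"] by simp
  qed
  have La: "L (h + h') = L h + L h'" for h h'
    by (rule LI[symmetric]) (simp_all add: ND L1 L2 cinner_add_left)
  have Ls: "L (a *\<^sub>C h) = a *\<^sub>C L h" for a h
    by (rule LI[symmetric]) (simp_all add: ND L1 L2 cinner_scaleC_left)
  have Ld: "L (h - h') = L h - L h'" for h h'
    using La[of h "- h'"] Ls[of "- 1" h'] by simp
  obtain c where c: "\<And>h. h \<in> {h. norm (L h) \<le> 1} \<Longrightarrow> norm h \<le> c"
  proof (rule uniform_boundedness[of "{h. norm (L h) \<le> 1}"])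
    fix e :: 'h
    obtain n where n: "n \<in> N" "K n = e" using surj by (metis UNIV_I imageE)
    have "cmod (cinner h e) \<le> norm n" if "norm (L h) \<le> 1" for h
    proof -
      have "cmod (cinner h e) \<le> norm (L h) * norm n"
        using cauchy_schwarz[of "L h" n] L2[OF n(1), of h] n(2) by simp
      also have "\<dots> \<le> 1 * norm n" using that by (intro mult_right_mono) auto
      finally show ?thesis by simp
    qed
    then show "\<exists>k. \<forall>h\<in>{h. norm (L h) \<le> 1}. cmod (cinner h e) \<le> k" by blast
  qed (use that in blast)
  have below: "norm h \<le> c * norm (L h)" for h
  proof (cases "L h = 0")
    case False
    let ?a = "complex_of_real (1 / norm (L h))"
    have "norm (L (?a *\<^sub>C h)) \<le> 1" using False by (simp add: Ls norm_divide)
    then have "norm (?a *\<^sub>C h) \<le> c" using c by blast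
    then show ?thesis using False by (simp add: norm_divide field_simps)
  next
    case True
    have "h = 0"
    proof (rule ccontr)
      assume "h \<noteq> 0"
      let ?b = "complex_of_real ((\<bar>c\<bar> + 1) / norm h)"
      have "norm (L (?b *\<^sub>C h)) \<le> 1" using True by (simp add: Ls)
      then have "norm (?b *\<^sub>C h) \<le> c" using c by blast
      moreover have "norm (?b *\<^sub>C h) = \<bar>c\<bar> + 1" using \<open>h \<noteq> 0\<close> by (simp add: norm_divide del: of_real_divide)
      ultimately show False by simp
    qed
    then show ?thesis using True by simp
  qed
  have "norm n \<le> c * norm (K n)" if n: "n \<in> N" for n
  proof (rule riesz_sequence[OF complex_subspace_UNIV, of "\<lambda>h h'. cinner (L h) (L h')"
        "\<lambda>h. cinner n (L h)" "(norm n)\<^sup>2"])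
    show "(cmod (cinner n (L h)))\<^sup>2 \<le> (norm n)\<^sup>2 * Re (cinner (L h) (L h))" for h
      using power_mono[OF cauchy_schwarz norm_ge_zero, of n "L h" 2] by (simp add: Re_cinner_self power_mult_distrib)
    show "cinner (L x) (L y) = cnj (cinner (L y) (L x))" for x y by (rule cinner_commute)
  next
    fix X :: "nat \<Rightarrow> 'h"
    assume X: "\<And>\<epsilon>. 0 < \<epsilon> \<Longrightarrow> \<exists>N. \<forall>m\<ge>N. \<forall>n\<ge>N. Re (cinner (L (X m - X n)) (L (X m - X n))) < \<epsilon>"
      "\<And>h. h \<in> UNIV \<Longrightarrow> (\<lambda>j. cinner (L (X j)) (L h)) \<longlonglongrightarrow> cinner n (L h)"
    have "Cauchy (\<lambda>j. L (X j))" using X(1) unfolding Re_cinner_self Ld by (rule Cauchy_norm_squared)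
    then obtain m where m: "(\<lambda>j. L (X j)) \<longlonglongrightarrow> m" using Cauchy_convergent convergent_def by blast
    have mN: "m \<in> N" by (rule closed_sequentially[OF N(2) L1 m])
    have ip: "cinner k (L h) = cinner (K k) h" if "k \<in> N" for k h
      using L2[OF that, of h] cinner_commute[of k "L h"] cinner_commute[of "K k" h] by simp
    have "cinner (K m) h = cinner (K n) h" for h
      using LIMSEQ_unique[OF tendsto_cinner[OF m tendsto_const] X(2), of h] ip[OF mN] ip[OF n] by simp
    then have "K m = K n" by (rule cinner_eqI)
    then have "K (m + (- 1) *\<^sub>C n) = 0" using mN n ND(3)[OF n, of "- 1"] by (simp only: Ka Ks) simp
    then have "m = n" using inj[of "m - n"] ND(5)[OF mN n] by simp
    have "Re (cinner n (L (X j))) \<le> norm (K n) * c * norm (L (X j))" for j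
    proof -
      have "Re (cinner n (L (X j))) \<le> norm (K n) * norm (X j)"
        using complex_Re_le_cmod cauchy_schwarz order_trans unfolding ip[OF n] by blast
      also have "\<dots> \<le> norm (K n) * (c * norm (L (X j)))" by (intro mult_left_mono below) auto
      finally show ?thesis by simp
    qed
    moreover have "(\<lambda>j. Re (cinner n (L (X j)))) \<longlonglongrightarrow> Re (cinner n n)"
      using m \<open>m = n\<close> by (intro tendsto_Re tendsto_cinner tendsto_const) simp
    moreover have "(\<lambda>j. norm (K n) * c * norm (L (X j))) \<longlonglongrightarrow> norm (K n) * c * norm n"
      using m \<open>m = n\<close> by (intro tendsto_mult tendsto_const tendsto_norm) simp
    ultimately have "Re (cinner n n) \<le> norm (K n) * c * norm n"
      by (intro LIMSEQ_le[of _ _ "\<lambda>j. norm (K n) * c * norm (L (X j))"]) auto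
    then have "norm n * norm n \<le> norm n * (c * norm (K n))" by (simp add: Re_cinner_self power2_eq_square mult_ac)
    moreover have "0 \<le> c * norm (K n)"
      using order_trans[OF norm_ge_zero below[of "K n"]] norm_ge_zero[of "L (K n)"]
        order_trans[OF norm_ge_zero c, of 0] Ls[of 0 0] by simp
    ultimately show "norm n \<le> c * norm (K n)" by (cases "n = 0") auto
  qed (simp_all add: La Ls cinner_simps)
  then show thesis by (rule that)
qed


section \<open>Linear relations\<close>

lemma linear_relationD:
  assumes "linear_relation T"
  shows "(0, 0) \<in> T" "(x, y) \<in> T \<Longrightarrow> (x', y') \<in> T \<Longrightarrow> (x + x', y + y') \<in> T"
    "(x, y) \<in> T \<Longrightarrow> (c *\<^sub>C x, c *\<^sub>C y) \<in> T"
    "(x, y) \<in> T \<Longrightarrow> (x', y') \<in> T \<Longrightarrow> (x - x', y - y') \<in> T"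
proof -
  show 0: "(0, 0) \<in> T" and 1: "\<And>x y x' y'. (x, y) \<in> T \<Longrightarrow> (x', y') \<in> T \<Longrightarrow> (x + x', y + y') \<in> T"
    and 2: "\<And>c x y. (x, y) \<in> T \<Longrightarrow> (c *\<^sub>C x, c *\<^sub>C y) \<in> T"
    using assms by (auto simp: linear_relation_def)
  show "(x - x', y - y') \<in> T" if "(x, y) \<in> T" "(x', y') \<in> T"
    using 1[OF that(1) 2[OF that(2), of "- 1"]] by simp
qed

lemma linear_operator_relation: "linear_operator T \<Longrightarrow> linear_relation T"
  by (simp add: linear_operator_def)

lemma linear_operator_unique: "linear_operator T \<Longrightarrow> (x, y) \<in> T \<Longrightarrow> (x, z) \<in> T \<Longrightarrow> y = z"
  by (auto simp: linear_operator_def dest: single_valuedD)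

lemma app_eq: "linear_operator T \<Longrightarrow> (x, y) \<in> T \<Longrightarrow> app T x = y"
  unfolding app_def by (blast dest: linear_operator_unique)

lemma app_in: "linear_operator T \<Longrightarrow> x \<in> Domain T \<Longrightarrow> (x, app T x) \<in> T"
  using app_eq by blast

lemma linear_operatorI:
  assumes "linear_relation T" "\<And>y. (0, y) \<in> T \<Longrightarrow> y = 0"
  shows "linear_operator T"
  unfolding linear_operator_def
proof (intro conjI single_valuedI assms(1))
  fix x y z assume "(x, y) \<in> T" "(x, z) \<in> T"
  then show "y = z" using linear_relationD(4)[OF assms(1)] assms(2)[of "y - z"] by fastforce
qed

lemma linear_relation_converse:
  assumes "linear_relation T" shows "linear_relation (T\<inverse>)"
  using linear_relationD(1-3)[OF assms] by (auto simp: linear_relation_def)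

lemma complex_subspace_Domain: "linear_relation T \<Longrightarrow> complex_subspace (Domain T)"
  unfolding complex_subspace_def by (auto dest: linear_relationD(1) intro: linear_relationD(2,3) DomainI)

lemma complex_subspace_Range: "linear_relation T \<Longrightarrow> complex_subspace (Range T)"
  using complex_subspace_Domain[OF linear_relation_converse] by simp

lemma app_linear:
  assumes "linear_operator T" "x \<in> Domain T" "y \<in> Domain T"
  shows "app T (x + y) = app T x + app T y" "app T (c *\<^sub>C x) = c *\<^sub>C app T x"
    "app T (x - y) = app T x - app T y"
proof -
  note TD = linear_relationD[OF linear_operator_relation[OF assms(1)]]
  note x = app_in[OF assms(1,2)] and y = app_in[OF assms(1,3)]
  show "app T (x + y) = app T x + app T y" by (rule app_eq[OF assms(1) TD(2)[OF x y]])
  show "app T (c *\<^sub>C x) = c *\<^sub>C app T x" by (rule app_eq[OF assms(1) TD(3)[OF x]])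
  show "app T (x - y) = app T x - app T y" by (rule app_eq[OF assms(1) TD(4)[OF x y]])
qed

lemma relation_minus_iff [simp]: "(x, y) \<in> relation_minus T B \<longleftrightarrow> (x, y + B x) \<in> T"
proof
  assume "(x, y + B x) \<in> T"
  then have "\<exists>x' y'. (x, y) = (x', y' - B x') \<and> (x', y') \<in> T"
    by (intro exI[of _ x] exI[of _ "y + B x"]) simp
  then show "(x, y) \<in> relation_minus T B" by (simp add: relation_minus_def)
qed (auto simp: relation_minus_def)

lemma shift_iff [simp]: "(x, y) \<in> shift T z \<longleftrightarrow> (x, y + z *\<^sub>C x) \<in> T"
  by (simp add: shift_def)

lemma resolvent_iff [simp]: "(y, x) \<in> resolvent T z \<longleftrightarrow> (x, y + z *\<^sub>C x) \<in> T"
  by (simp add: resolvent_def)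

lemma linear_relation_minus:
  assumes "linear_relation T" "linear_on UNIV B"
  shows "linear_relation (relation_minus T B)"
proof -
  have B: "B (x + y) = B x + B y" "B (c *\<^sub>C x) = c *\<^sub>C B x" for x y c using assms(2) by (auto simp: linear_on_def)
  have B0: "B 0 = 0" using B(2)[of 0 0] by simp
  show ?thesis
    unfolding linear_relation_def relation_minus_iff
  proof (intro conjI allI impI)
    show "(0, 0 + B 0) \<in> T" using linear_relationD(1)[OF assms(1)] by (simp add: B0)
    show "(x + x', y + y' + B (x + x')) \<in> T" if "(x, y + B x) \<in> T" "(x', y' + B x') \<in> T" for x y x' y'
      using linear_relationD(2)[OF assms(1) that] by (simp add: B ac_simps)
    show "(c *\<^sub>C x, c *\<^sub>C y + B (c *\<^sub>C x)) \<in> T" if "(x, y + B x) \<in> T" for c x y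
      using linear_relationD(3)[OF assms(1) that] by (simp add: B scaleC_add_right)
  qed
qed

lemma linear_relation_shift: "linear_relation T \<Longrightarrow> linear_relation (shift T z)"
  unfolding shift_def
  by (rule linear_relation_minus) (auto simp: linear_on_def scaleC_add_right scaleC_scaleC mult.commute)

lemma closed_relationI:
  fixes T :: "('a::metric_space \<times> 'b::metric_space) set"
  assumes "\<And>X Y x y. (\<And>n::nat. (X n, Y n) \<in> T) \<Longrightarrow> X \<longlonglongrightarrow> x \<Longrightarrow> Y \<longlonglongrightarrow> y \<Longrightarrow> (x, y) \<in> T"
  shows "closed T"
  unfolding closed_sequential_limits
proof (intro allI impI, elim conjE)
  fix Z l assume Z: "\<forall>n. Z n \<in> T" "Z \<longlonglongrightarrow> l"
  show "l \<in> T"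
    using assms[of "\<lambda>n. fst (Z n)" "\<lambda>n. snd (Z n)" "fst l" "snd l"] Z
    by (simp add: tendsto_fst tendsto_snd)
qed

lemma closed_relationD:
  assumes "closed T" "\<And>n::nat. (X n, Y n) \<in> T" "X \<longlonglongrightarrow> x" "Y \<longlonglongrightarrow> y"
  shows "(x, y) \<in> T"
  using closed_sequentially[OF assms(1) _ tendsto_Pair[OF assms(3,4)]] assms(2) by blast

lemma closed_shift:
  assumes "closed T" shows "closed (shift T z)"
proof (rule closed_relationI)
  fix X Y x y assume XY: "\<And>n::nat. (X n, Y n) \<in> shift T z" "X \<longlonglongrightarrow> x" "Y \<longlonglongrightarrow> y"
  have "(x, y + z *\<^sub>C x) \<in> T"
  proof (rule closed_relationD[OF assms _ XY(2)])
    show "(X n, Y n + z *\<^sub>C X n) \<in> T" for n using XY(1) by simp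
    show "(\<lambda>n. Y n + z *\<^sub>C X n) \<longlonglongrightarrow> y + z *\<^sub>C x"
      by (rule tendsto_add[OF XY(3) tendsto_scaleC[OF XY(2)]])
  qed
  then show "(x, y) \<in> shift T z" by simp
qed

lemma closed_adjoint: "closed (adjoint_relation T)"
proof (rule closed_relationI)
  fix X Y x y assume *: "\<And>n::nat. (X n, Y n) \<in> adjoint_relation T" "X \<longlonglongrightarrow> x" "Y \<longlonglongrightarrow> y"
  have "cinner b x = cinner a y" if "(a, b) \<in> T" for a b
  proof (rule LIMSEQ_unique)
    show "(\<lambda>n. cinner b (X n)) \<longlonglongrightarrow> cinner b x" by (intro tendsto_cinner tendsto_const *)
    have "cinner b (X n) = cinner a (Y n)" for n using *(1)[of n] that by (auto simp: adjoint_relation_def)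
    then show "(\<lambda>n. cinner b (X n)) \<longlonglongrightarrow> cinner a y" by (simp add: tendsto_cinner *)
  qed
  then show "(x, y) \<in> adjoint_relation T" by (auto simp: adjoint_relation_def)
qed

lemma adjoint_relationI:
  "(\<And>x y. (x, y) \<in> T \<Longrightarrow> cinner y u = cinner x w) \<Longrightarrow> (u, w) \<in> adjoint_relation T"
  by (auto simp: adjoint_relation_def)

lemma adjoint_relationD: "(u, w) \<in> adjoint_relation T \<Longrightarrow> (x, y) \<in> T \<Longrightarrow> cinner y u = cinner x w"
  by (auto simp: adjoint_relation_def)

lemma adjoint_antimono: "S \<subseteq> T \<Longrightarrow> adjoint_relation T \<subseteq> adjoint_relation S"
  by (auto simp: adjoint_relation_def)

lemma linear_relation_adjoint: "linear_relation (adjoint_relation T)"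
  unfolding linear_relation_def
proof (intro conjI allI impI adjoint_relationI)
  fix u w u' w' x y assume *: "(u, w) \<in> adjoint_relation T" "(u', w') \<in> adjoint_relation T" "(x, y) \<in> T"
  show "cinner y (u + u') = cinner x (w + w')"
    using adjoint_relationD[OF *(1,3)] adjoint_relationD[OF *(2,3)] by (simp add: cinner_add_right)
next
  fix c u w x y assume *: "(u, w) \<in> adjoint_relation T" "(x, y) \<in> T"
  show "cinner y (c *\<^sub>C u) = cinner x (c *\<^sub>C w)"
    using adjoint_relationD[OF *] by (simp add: cinner_scaleC_right)
qed simp

lemma linear_operator_adjoint:
  assumes "closure (Domain T) = UNIV"
  shows "linear_operator (adjoint_relation T)"
proof (rule linear_operatorI[OF linear_relation_adjoint])
  fix y assume y: "(0, y) \<in> adjoint_relation T"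
  show "y = 0"
  proof (rule orthogonal_to_dense[OF assms])
    fix x assume "x \<in> Domain T"
    then obtain w where "(x, w) \<in> T" by blast
    then have "cinner x y = 0" using adjoint_relationD[OF y] by fastforce
    then show "cinner y x = 0" using cinner_commute[of y x] by simp
  qed
qed

lemma closed_Range_if_bounded_below:
  fixes T :: "('a::complex_hilbert \<times> 'b::complex_hilbert) set"
  assumes T: "linear_relation T" "closed T" and c: "0 < c"
    and below: "\<And>x y. (x, y) \<in> T \<Longrightarrow> c * norm x \<le> norm y"
  shows "closed (Range T)"
  unfolding closed_sequential_limits
proof (intro allI impI, elim conjE)
  fix Y y assume Y: "\<forall>n. Y n \<in> Range T" "Y \<longlonglongrightarrow> y"
  then obtain X where X: "\<And>n. (X n, Y n) \<in> T" unfolding Range_iff by metis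
  have "Cauchy X"
  proof (rule CauchyI)
    fix e :: real assume e: "0 < e"
    have "Cauchy Y" using Y LIMSEQ_imp_Cauchy by blast
    then obtain M where M: "\<forall>m\<ge>M. \<forall>n\<ge>M. norm (Y m - Y n) < c * e" using CauchyD[of Y "c * e"] c e by auto
    have "norm (X m - X n) < e" if "m \<ge> M" "n \<ge> M" for m n
    proof -
      have "c * norm (X m - X n) < c * e" using below[OF linear_relationD(4)[OF T(1) X[of m] X[of n]]] M that by fastforce
      then show ?thesis using c by simp
    qed
    then show "\<exists>M. \<forall>m\<ge>M. \<forall>n\<ge>M. norm (X m - X n) < e" by blast
  qed
  then obtain x where x: "X \<longlonglongrightarrow> x" using Cauchy_convergent convergent_def by blast
  have "(x, y) \<in> T" by (rule closed_relationD[OF T(2) X x Y(2)])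
  then show "y \<in> Range T" by blast
qed

lemma Range_UNIV_if_bounded_below:
  fixes T :: "('a::complex_hilbert \<times> 'b::complex_hilbert) set"
  assumes T: "linear_relation T" "closed T" and c: "0 < c"
    and below: "\<And>x y. (x, y) \<in> T \<Longrightarrow> c * norm x \<le> norm y"
    and orth: "\<And>w. (\<And>x y. (x, y) \<in> T \<Longrightarrow> cinner w y = 0) \<Longrightarrow> w = 0"
  shows "Range T = UNIV"
proof -
  have "closure (Range T) = UNIV"
    by (rule closure_eq_UNIV_if_orthogonal_trivial[OF complex_subspace_Range[OF T(1)]]) (use orth in blast)
  then show ?thesis using closed_Range_if_bounded_below[OF assms(1-4)] by (simp add: closure_closed)
qed


section \<open>Maximal accretive relations\<close>

lemma accretiveD: "accretive T \<Longrightarrow> (x, y) \<in> T \<Longrightarrow> 0 \<le> Re (cinner y x)"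
  by (auto simp: accretive_def)

lemma accretive_bounded_below:
  assumes "accretive T" "(x, y) \<in> T"
  shows "c * norm x \<le> norm (y + complex_of_real c *\<^sub>C x)"
proof (cases "x = 0")
  case False
  have "c * (norm x)\<^sup>2 \<le> Re (cinner (y + complex_of_real c *\<^sub>C x) x)"
    using accretiveD[OF assms] by (simp add: cinner_simps Re_cinner_self)
  also have "\<dots> \<le> norm (y + complex_of_real c *\<^sub>C x) * norm x"
    using complex_Re_le_cmod cauchy_schwarz order_trans by blast
  finally show ?thesis using False by (simp add: power2_eq_square)
qed simp

lemma linear_relation_closure:
  fixes T :: "('a::complex_hilbert \<times> 'b::complex_hilbert) set"
  assumes "linear_relation T" shows "linear_relation (closure T)"
proof -
  have seq: "\<exists>X Y. (\<forall>n::nat. (X n, Y n) \<in> T) \<and> X \<longlonglongrightarrow> x \<and> Y \<longlonglongrightarrow> y" if xy: "(x, y) \<in> closure T" for x y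
  proof -
    obtain Z where Z: "\<forall>n. Z n \<in> T" "Z \<longlonglongrightarrow> (x, y)" using xy unfolding closure_sequential by blast
    have "(\<lambda>n. fst (Z n)) \<longlonglongrightarrow> x" "(\<lambda>n. snd (Z n)) \<longlonglongrightarrow> y"
      using tendsto_fst[OF Z(2)] tendsto_snd[OF Z(2)] by simp_all
    then show ?thesis using Z(1) by (intro exI[of _ "\<lambda>n. fst (Z n)"] exI[of _ "\<lambda>n. snd (Z n)"]) simp
  qed
  have qes: "(x, y) \<in> closure T" if "\<And>n::nat. (X n, Y n) \<in> T" "X \<longlonglongrightarrow> x" "Y \<longlonglongrightarrow> y" for X Y x y
    unfolding closure_sequential
    by (intro exI[of _ "\<lambda>n. (X n, Y n)"] conjI allI tendsto_Pair that)
  note TD = linear_relationD[OF assms]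
  show ?thesis unfolding linear_relation_def
  proof (intro conjI allI impI)
    show "(0, 0) \<in> closure T" using TD(1) closure_subset by blast
    fix x y assume "(x, y) \<in> closure T"
    then obtain X Y where XY: "\<And>n::nat. (X n, Y n) \<in> T" "X \<longlonglongrightarrow> x" "Y \<longlonglongrightarrow> y" using seq by blast
    show "(c *\<^sub>C x, c *\<^sub>C y) \<in> closure T" for c
      by (rule qes[of "\<lambda>n. c *\<^sub>C X n" "\<lambda>n. c *\<^sub>C Y n"]) (intro TD(3) tendsto_scaleC XY)+
    fix x' y' assume "(x', y') \<in> closure T"
    then obtain X' Y' where XY': "\<And>n::nat. (X' n, Y' n) \<in> T" "X' \<longlonglongrightarrow> x'" "Y' \<longlonglongrightarrow> y'" using seq by blast
    show "(x + x', y + y') \<in> closure T"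
      by (rule qes[of "\<lambda>n. X n + X' n" "\<lambda>n. Y n + Y' n"]) (intro TD(2) tendsto_add XY XY')+
  qed
qed

lemma accretive_closure:
  assumes "accretive T" shows "accretive (closure T)"
proof -
  have "closed {p :: 'a \<times> 'a. 0 \<le> Re (cinner (snd p) (fst p))}"
  proof (rule closed_Collect_le[OF continuous_on_const])
    have "continuous_on UNIV (\<lambda>p :: 'a \<times> 'a. cinner (snd p) (fst p))"
      by (intro bounded_bilinear.continuous_on[OF bounded_bilinear_cinner] continuous_on_fst
          continuous_on_snd continuous_on_id)
    then show "continuous_on UNIV (\<lambda>p :: 'a \<times> 'a. Re (cinner (snd p) (fst p)))" by (rule continuous_on_Re)
  qed
  then have "closure T \<subseteq> {p. 0 \<le> Re (cinner (snd p) (fst p))}"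
    by (rule closure_minimal[rotated]) (use assms in \<open>auto simp: accretive_def\<close>)
  then show ?thesis by (auto simp: accretive_def)
qed

lemma m_accretive_relationD:
  assumes "m_accretive_relation Z"
  shows "linear_relation Z" "accretive Z"
    "linear_relation S \<Longrightarrow> accretive S \<Longrightarrow> Z \<subseteq> S \<Longrightarrow> S = Z" "closed Z"
proof -
  show 1: "linear_relation Z" and 2: "accretive Z" and
    3: "\<And>S. linear_relation S \<Longrightarrow> accretive S \<Longrightarrow> Z \<subseteq> S \<Longrightarrow> S = Z"
    using assms by (auto simp: m_accretive_relation_def)
  have "closure Z = Z"
    using 3[OF linear_relation_closure[OF 1] accretive_closure[OF 2] closure_subset] .
  then show "closed Z" by (metis closed_closure)
qed

text \<open>A vector \<open>w\<close> orthogonal to the range of \<open>Z + c\<close> could be used to extend \<open>Z\<close> by \<open>(w, c w)\<close>: the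
  mixed terms of the quadratic form cancel.\<close>

lemma m_accretive_surjective:
  assumes Z: "m_accretive_relation Z" and c: "0 < c"
  obtains x y where "(x, y) \<in> Z" "y + complex_of_real c *\<^sub>C x = f"
proof -
  note lin = m_accretive_relationD(1)[OF Z] and acc = m_accretive_relationD(2)[OF Z]
  let ?T = "shift Z (- complex_of_real c)"
  have "Range ?T = UNIV"
  proof (rule Range_UNIV_if_bounded_below[OF linear_relation_shift[OF lin]
        closed_shift[OF m_accretive_relationD(4)[OF Z]] c])
    show "c * norm x \<le> norm y" if "(x, y) \<in> ?T" for x y
      using accretive_bounded_below[OF acc, of x "y - complex_of_real c *\<^sub>C x" c] that by simp
  next
    fix w assume w: "\<And>x y. (x, y) \<in> ?T \<Longrightarrow> cinner w y = 0"
    have w': "cinner w y + c * cinner w x = 0" if "(x, y) \<in> Z" for x y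
      using w[of x "y + complex_of_real c *\<^sub>C x"] that by (simp add: cinner_simps)
    define S where "S = {(x + \<alpha> *\<^sub>C w, y + (\<alpha> * c) *\<^sub>C w) | x y \<alpha>. (x, y) \<in> Z}"
    have SI: "(x + \<alpha> *\<^sub>C w, y + (\<alpha> * c) *\<^sub>C w) \<in> S" if "(x, y) \<in> Z" for x y \<alpha> using that by (auto simp: S_def)
    have "linear_relation S" unfolding linear_relation_def
    proof (intro conjI allI impI)
      show "(0, 0) \<in> S" using SI[OF linear_relationD(1)[OF lin], of 0] by simp
      fix p q assume "(p, q) \<in> S"
      then obtain x y \<alpha> where xy: "p = x + \<alpha> *\<^sub>C w" "q = y + (\<alpha> * c) *\<^sub>C w" "(x, y) \<in> Z" by (auto simp: S_def)
      show "(a *\<^sub>C p, a *\<^sub>C q) \<in> S" for a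
        using SI[OF linear_relationD(3)[OF lin xy(3), of a], of "a * \<alpha>"]
        by (simp add: xy scaleC_add_right scaleC_scaleC mult.assoc)
      fix p' q' assume "(p', q') \<in> S"
      then obtain x' y' \<alpha>' where xy': "p' = x' + \<alpha>' *\<^sub>C w" "q' = y' + (\<alpha>' * c) *\<^sub>C w" "(x', y') \<in> Z"
        by (auto simp: S_def)
      show "(p + p', q + q') \<in> S"
        using SI[OF linear_relationD(2)[OF lin xy(3) xy'(3)], of "\<alpha> + \<alpha>'"]
        by (simp add: xy xy' scaleC_add_left distrib_right add.assoc add.commute add.left_commute)
    qed
    moreover have "accretive S"
    proof -
      have "0 \<le> Re (cinner (y + (\<alpha> * c) *\<^sub>C w) (x + \<alpha> *\<^sub>C w))" if xy: "(x, y) \<in> Z"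
        for x y and \<alpha> :: complex
      proof -
        have "cinner y w = cnj (cinner w y)" by (rule cinner_commute)
        also have "\<dots> = - c * cinner x w"
          using w'[OF xy] cinner_commute[of x w] by (simp add: eq_neg_iff_add_eq_0[symmetric])
        finally have yw: "cinner y w = - c * cinner x w" .
        have "cinner (y + (\<alpha> * c) *\<^sub>C w) (x + \<alpha> *\<^sub>C w)
            = cinner y x + (\<alpha> * c * cinner w x - cnj (\<alpha> * c * cinner w x)) + c * (\<alpha> * cnj \<alpha> * cinner w w)"
          using cinner_commute[of x w] by (simp add: cinner_simps yw algebra_simps)
        also have "\<alpha> * cnj \<alpha> * cinner w w = complex_of_real ((cmod \<alpha> * norm w)\<^sup>2)"
          by (simp add: cinner_norm complex_norm_square[symmetric] power_mult_distrib)
        finally show ?thesis using accretiveD[OF acc xy] c by (simp del: of_real_power of_real_mult)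
      qed
      then show ?thesis by (auto simp: accretive_def S_def)
    qed
    moreover have "Z \<subseteq> S" using SI[of _ _ 0] by auto
    ultimately have "S = Z" by (rule m_accretive_relationD(3)[OF Z])
    then have "(w, complex_of_real c *\<^sub>C w) \<in> Z" using SI[OF linear_relationD(1)[OF lin], of 1] by simp
    from w'[OF this] have "complex_of_real (2 * c * (norm w)\<^sup>2) = 0"
      by (simp add: cinner_scaleC_right cinner_norm)
    then show "w = 0" using c by (simp del: of_real_mult of_real_power)
  qed
  then obtain x where "(x, f) \<in> ?T" by blast
  then show thesis by (intro that[of x "f - complex_of_real c *\<^sub>C x"]) auto
qed

text \<open>From an element of an extension subtract an element of \<open>Z\<close> with the same value of \<open>y + c x\<close>. The
  difference has the form \<open>(k, - c k)\<close>, which is accretive only for \<open>k = 0\<close>.\<close>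

lemma m_accretiveI_shifted:
  assumes lin: "linear_relation Z" and acc: "accretive Z" and c: "0 < c"
    and surj: "\<And>f. \<exists>x y. (x, y) \<in> Z \<and> y + complex_of_real c *\<^sub>C x = f"
  shows "m_accretive_relation Z"
  unfolding m_accretive_relation_def
proof (intro conjI lin acc allI impI equalityI subrelI)
  fix S x y assume S: "linear_relation S" "accretive S" "Z \<subseteq> S" and xy: "(x, y) \<in> S"
  obtain x' y' where z: "(x', y') \<in> Z" "y' + complex_of_real c *\<^sub>C x' = y + complex_of_real c *\<^sub>C x"
    using surj by blast
  have d: "(x - x', y - y') \<in> S" using linear_relationD(4)[OF S(1) xy] z S by blast
  have "(y - y') + complex_of_real c *\<^sub>C (x - x')
      = (y + complex_of_real c *\<^sub>C x) - (y' + complex_of_real c *\<^sub>C x')"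
    by (simp add: scaleC_diff_right)
  then have "(y - y') + complex_of_real c *\<^sub>C (x - x') = 0" using z(2) by simp
  then have "c * norm (x - x') \<le> 0" using accretive_bounded_below[OF S(2) d, of c] by simp
  then have "x = x'" using c by (simp add: mult_le_0_iff)
  then show "(x, y) \<in> Z" using z by simp
qed auto

text \<open>From an element of an extension subtract an element of \<open>Z\<close> with the same second component. The
  difference is a kernel vector, and kernel vectors of an accretive relation are orthogonal to its range.\<close>

lemma m_accretiveI_surjective:
  assumes lin: "linear_relation Z" and acc: "accretive Z" and surj: "Range Z = UNIV"
  shows "m_accretive_relation Z"
  unfolding m_accretive_relation_def
proof (intro conjI lin acc allI impI equalityI subrelI)
  fix S x y assume S: "linear_relation S" "accretive S" "Z \<subseteq> S" and xy: "(x, y) \<in> S"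
  obtain x' where z: "(x', y) \<in> Z" using surj by (metis UNIV_I RangeE)
  define k where "k = x' - x"
  have k: "(k, 0) \<in> S" using linear_relationD(4)[OF S(1) _ xy, of x' y] z S by (auto simp: k_def)
  have "k = 0"
  proof -
    obtain a where a: "(a, k) \<in> Z" using surj by (metis UNIV_I RangeE)
    have "0 \<le> Re (cinner k a) - t * (norm k)\<^sup>2" for t
    proof -
      have "(a - complex_of_real t *\<^sub>C k, k - 0) \<in> S"
        using linear_relationD(4)[OF S(1), of a k "complex_of_real t *\<^sub>C k" 0]
          linear_relationD(3)[OF S(1) k, of "complex_of_real t"] a S by auto
      from accretiveD[OF S(2) this] show ?thesis by (simp add: cinner_simps Re_cinner_self)
    qed
    from this[of "(Re (cinner k a) + 1) / (norm k)\<^sup>2"] show ?thesis by (cases "k = 0") auto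
  qed
  then show "(x, y) \<in> Z" using z by (simp add: k_def)
qed auto

text \<open>For large \<open>c\<close> the inverse of \<open>Z + c\<close> has norm at most \<open>1 / c\<close>, so that
  \<open>x \<mapsto> (Z + c)\<inverse> (f + B x)\<close> is a contraction. Its fixed point solves the perturbed equation.\<close>

lemma m_accretive_bounded_perturbation:
  assumes Z: "m_accretive_relation Z" and B: "bounded_clinear B" and acc: "accretive (relation_minus Z B)"
  shows "m_accretive_relation (relation_minus Z B)"
proof -
  obtain C where C: "0 < C" "\<And>x. norm (B x) \<le> C * norm x" using bounded_clinear_bound[OF B] by blast
  \<comment> \<open>the contraction constant is \<open>C / c = 1 / 2\<close>\<close>
  define c where "c = 2 * C"
  have c: "0 < c" using C by (simp add: c_def)
  note lin = m_accretive_relationD(1)[OF Z] and Zacc = m_accretive_relationD(2)[OF Z]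
  have "\<exists>x. (x, g - complex_of_real c *\<^sub>C x) \<in> Z" for g
    by (rule m_accretive_surjective[OF Z c, of g]) (metis add_diff_cancel_right')
  then obtain R where R: "\<And>g. (R g, g - complex_of_real c *\<^sub>C R g) \<in> Z" by metis
  have lip: "c * norm (R g - R h) \<le> norm (g - h)" for g h
    using accretive_bounded_below[OF Zacc linear_relationD(4)[OF lin R[of g] R[of h]], of c]
    by (simp add: scaleC_diff_right algebra_simps)
  show ?thesis
  proof (rule m_accretiveI_shifted[OF _ acc c])
    show "linear_relation (relation_minus Z B)"
      using B by (intro linear_relation_minus[OF lin]) (simp add: bounded_clinear_def)
    fix f
    have "\<exists>!x. R (f + B x) = x"
    proof (rule banach_fix_type[of "1 / 2"])
      show "\<forall>x y. dist (R (f + B x)) (R (f + B y)) \<le> 1 / 2 * dist x y"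
      proof (intro allI)
        fix x y
        have "c * norm (R (f + B x) - R (f + B y)) \<le> norm (B (x - y))"
          using lip[of "f + B x" "f + B y"] by (simp add: bounded_clinearD[OF B])
        also have "\<dots> \<le> C * norm (x - y)" by (rule C)
        finally show "dist (R (f + B x)) (R (f + B y)) \<le> 1 / 2 * dist x y"
          using C(1) by (simp add: c_def dist_norm)
      qed
    qed auto
    then obtain x where "R (f + B x) = x" by blast
    then have "(x, f - complex_of_real c *\<^sub>C x) \<in> relation_minus Z B" using R[of "f + B x"] by (simp add: algebra_simps)
    then show "\<exists>x y. (x, y) \<in> relation_minus Z B \<and> y + complex_of_real c *\<^sub>C x = f"
      by (intro exI[of _ x] exI[of _ "f - complex_of_real c *\<^sub>C x"]) simp
  qed
qed

text \<open>If \<open>(0, h) \<in> S\<close>, then adding its multiples to \<open>(x, y)\<close> changes \<open>Re (y, x)\<close> by \<open>Re (a (h, x))\<close>, which is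
  bounded below in \<open>a\<close> only if \<open>h\<close> is orthogonal to \<open>x\<close>.\<close>

lemma accretive_single_valued:
  assumes lin: "linear_relation S" and acc: "accretive S" and dense: "closure (Domain S) = UNIV"
  shows "linear_operator S"
proof (rule linear_operatorI[OF lin])
  fix h assume h: "(0, h) \<in> S"
  show "h = 0"
  proof (rule orthogonal_to_dense[OF dense])
    fix x assume "x \<in> Domain S"
    then obtain y where xy: "(x, y) \<in> S" by blast
    let ?z = "cinner h x"
    have "0 \<le> Re (cinner y x) - t * (cmod ?z)\<^sup>2" for t
    proof -
      let ?a = "- (complex_of_real t * cnj ?z)"
      have "?a * ?z = - complex_of_real (t * (cmod ?z)\<^sup>2)"
        by (simp add: complex_norm_square mult_ac del: of_real_power)
      then have "Re (?a * ?z) = - (t * (cmod ?z)\<^sup>2)" by (simp only: uminus_complex.sel Re_complex_of_real)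
      then show ?thesis
        using accretiveD[OF acc linear_relationD(2)[OF lin xy linear_relationD(3)[OF lin h, of ?a]]]
        by (simp only: cinner_add_left cinner_scaleC_left scaleC_zero_right add_0_right plus_complex.sel)
    qed
    from this[of "(Re (cinner y x) + 1) / (cmod ?z)\<^sup>2"] show "?z = 0" by (cases "?z = 0") auto
  qed
qed

text \<open>Competing relations in the definition for relations are operators by \<open>accretive_single_valued\<close>.\<close>

lemma m_accretive_operator_iff:
  assumes "linear_operator T" "closure (Domain T) = UNIV"
  shows "m_accretive_operator T \<longleftrightarrow> m_accretive_relation T"
proof
  assume T: "m_accretive_operator T"
  show "m_accretive_relation T" unfolding m_accretive_relation_def
  proof (intro conjI allI impI)
    fix S assume S: "linear_relation S" "accretive S" "T \<subseteq> S"
    have "closure (Domain S) = UNIV" using assms(2) closure_mono[OF Domain_mono[OF S(3)]] by auto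
    then show "S = T" using accretive_single_valued[OF S(1,2)] T S by (auto simp: m_accretive_operator_def)
  qed (use T in \<open>auto simp: m_accretive_operator_def linear_operator_def\<close>)
next
  assume T: "m_accretive_relation T"
  then show "m_accretive_operator T"
    using assms(1) m_accretive_relationD[OF T] by (auto simp: m_accretive_operator_def linear_operator_relation)
qed


section \<open>Square roots\<close>

subsection \<open>Bounded operators\<close>

definition symmetric_fun :: "('a::complex_hilbert \<Rightarrow> 'a) \<Rightarrow> bool" where
  "symmetric_fun B \<longleftrightarrow> (\<forall>x y. cinner (B x) y = cinner x (B y))"

lemma symmetric_funD: "symmetric_fun B \<Longrightarrow> cinner (B x) y = cinner x (B y)"
  by (simp add: symmetric_fun_def)

text \<open>The iteration \<open>Y \<mapsto> (X + Y\<^sup>2) / 2\<close> converges to a solution of \<open>(1 - Y)\<^sup>2 = 1 - X\<close>. Its convergence is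
  governed by the same iteration for the number \<open>1\<close>, since the \<open>Y n\<close> commute.\<close>

fun sqrt_iter :: "('a::complex_hilbert \<Rightarrow> 'a) \<Rightarrow> nat \<Rightarrow> 'a \<Rightarrow> 'a" where
  "sqrt_iter X 0 x = 0"
| "sqrt_iter X (Suc n) x = (1 / 2) *\<^sub>C (X x + sqrt_iter X n (sqrt_iter X n x))"

fun sqrt_scalar_iter :: "nat \<Rightarrow> real" where
  "sqrt_scalar_iter 0 = 0"
| "sqrt_scalar_iter (Suc n) = (1 + (sqrt_scalar_iter n)\<^sup>2) / 2"

lemma sqrt_scalar_iter_bounds: "0 \<le> sqrt_scalar_iter n \<and> sqrt_scalar_iter n \<le> 1"
proof (induction n)
  case (Suc n)
  then have "(sqrt_scalar_iter n)\<^sup>2 \<le> 1" by (simp add: power_le_one)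
  then show ?case by simp
qed simp

lemma sqrt_scalar_iter_mono: "sqrt_scalar_iter n \<le> sqrt_scalar_iter (Suc n)"
  using zero_le_power2[of "1 - sqrt_scalar_iter n"] by (simp add: power2_eq_square algebra_simps)

lemma sqrt_iter_commute:
  assumes C: "bounded_clinear C" and CX: "\<And>x. C (X x) = X (C x)"
  shows "C (sqrt_iter X n x) = sqrt_iter X n (C x)"
  by (induction n arbitrary: x) (simp_all add: bounded_clinearD[OF C] CX)

lemma contraction_sqrt:
  fixes X :: "'a::complex_hilbert \<Rightarrow> 'a"
  assumes X: "bounded_clinear X" "symmetric_fun X" "\<And>x. norm (X x) \<le> norm x"
  obtains R where "bounded_clinear R" "symmetric_fun R" "\<And>x. R (R x) = x - X x"
    "\<And>x. norm (x - R x) \<le> norm x" "\<And>x. 0 \<le> Re (cinner (R x) x)"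
    "\<forall>C. bounded_clinear C \<longrightarrow> (\<forall>x. C (X x) = X (C x)) \<longrightarrow> (\<forall>x. C (R x) = R (C x))"
proof -
  let ?Y = "sqrt_iter X" and ?q = sqrt_scalar_iter
  have add: "?Y n (x + y) = ?Y n x + ?Y n y" for n x y
    by (induction n arbitrary: x y) (simp_all add: bounded_clinearD[OF X(1)] scaleC_add_right ac_simps)
  have scal: "?Y n (c *\<^sub>C x) = c *\<^sub>C ?Y n x" for n c x
    by (induction n arbitrary: x) (simp_all add: bounded_clinearD[OF X(1)] scaleC_add_right scaleC_scaleC mult.commute)
  have bound: "norm (?Y n x) \<le> ?q n * norm x" for n x
  proof (induction n arbitrary: x)
    case (Suc n)
    have "norm (?Y n (?Y n x)) \<le> ?q n * (?q n * norm x)"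
      using order_trans[OF Suc mult_left_mono[OF Suc]] sqrt_scalar_iter_bounds by blast
    then have "norm (X x + ?Y n (?Y n x)) \<le> (1 + (?q n)\<^sup>2) * norm x"
      using norm_triangle_ineq[of "X x" "?Y n (?Y n x)"] X(3)[of x]
      by (simp add: power2_eq_square algebra_simps)
    then show ?case by simp
  qed simp
  have Ylin: "bounded_clinear (?Y n)" for n by (rule bounded_clinearI[OF add scal bound])
  have sym: "cinner (?Y n x) y = cinner x (?Y n y)" for n x y
    by (induction n arbitrary: x y) (simp_all add: cinner_simps symmetric_funD[OF X(2)])
  have YX: "?Y n (X x) = X (?Y n x)" for n x by (rule sqrt_iter_commute[OF X(1), symmetric]) simp
  have YY: "?Y m (?Y n x) = ?Y n (?Y m x)" for m n x by (rule sqrt_iter_commute[OF Ylin]) (rule YX)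
  have contr: "norm (?Y n x) \<le> norm x" for n x
    using order_trans[OF bound mult_right_mono[OF conjunct2[OF sqrt_scalar_iter_bounds] norm_ge_zero]] by simp
  have step: "norm (?Y (Suc n) x - ?Y n x) \<le> (?q (Suc n) - ?q n) * norm x" for n x
  proof (induction n arbitrary: x)
    case 0
    then show ?case using X(3)[of x] by (simp add: bounded_clinearD[OF X(1)])
  next
    case (Suc n)
    let ?a = "?Y (Suc n)" and ?b = "?Y n"
    have "?Y (Suc (Suc n)) x - ?Y (Suc n) x = (1 / 2) *\<^sub>C (?a (?a x) - ?b (?b x))"
      by (simp only: sqrt_iter.simps(2)[of X "Suc n"] sqrt_iter.simps(2)[of X n x] scaleC_diff_right scaleC_add_right)
        simp
    also have "?a (?a x) - ?b (?b x) = ?a (?a x + ?b x) - ?b (?a x + ?b x)"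
      by (simp only: add YY[of n "Suc n" x]) simp
    finally have eq: "?Y (Suc (Suc n)) x - ?Y (Suc n) x = (1 / 2) *\<^sub>C (?a (?a x + ?b x) - ?b (?a x + ?b x))" .
    have "norm (?a (?a x + ?b x) - ?b (?a x + ?b x)) \<le> (?q (Suc n) - ?q n) * norm (?a x + ?b x)" by (rule Suc)
    also have "\<dots> \<le> (?q (Suc n) - ?q n) * ((?q (Suc n) + ?q n) * norm x)"
    proof (rule mult_left_mono)
      show "norm (?a x + ?b x) \<le> (?q (Suc n) + ?q n) * norm x"
        using norm_triangle_ineq[of "?a x" "?b x"] bound[of "Suc n" x] bound[of n x]
        unfolding distrib_right by linarith
      show "0 \<le> ?q (Suc n) - ?q n" using sqrt_scalar_iter_mono[of n] by simp
    qed
    also have "\<dots> = 2 * (?q (Suc (Suc n)) - ?q (Suc n)) * norm x"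
      by (simp only: sqrt_scalar_iter.simps(2)[of "Suc n"] sqrt_scalar_iter.simps(2)[of n, symmetric])
        (simp add: power2_eq_square field_simps)
    finally have "norm (?a (?a x + ?b x) - ?b (?a x + ?b x)) \<le> 2 * ((?q (Suc (Suc n)) - ?q (Suc n)) * norm x)"
      by (simp only: mult.assoc)
    then show ?case unfolding eq norm_scaleC by (simp del: sqrt_iter.simps sqrt_scalar_iter.simps)
  qed
  have diff: "norm (?Y (n + k) x - ?Y n x) \<le> (?q (n + k) - ?q n) * norm x" for n k x
  proof (induction k)
    case (Suc k)
    have "norm (?Y (n + Suc k) x - ?Y n x) \<le> norm (?Y (Suc (n + k)) x - ?Y (n + k) x) + norm (?Y (n + k) x - ?Y n x)"
      using norm_triangle_ineq[of "?Y (Suc (n + k)) x - ?Y (n + k) x" "?Y (n + k) x - ?Y n x"]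
      by (simp del: sqrt_iter.simps)
    also have "\<dots> \<le> (?q (Suc (n + k)) - ?q (n + k)) * norm x + (?q (n + k) - ?q n) * norm x"
      by (intro add_mono step Suc)
    also have "\<dots> = (?q (n + Suc k) - ?q n) * norm x"
      by (simp add: distrib_right[symmetric] del: sqrt_scalar_iter.simps)
    finally show ?case .
  qed simp
  have "incseq ?q" using sqrt_scalar_iter_mono by (rule incseq_SucI)
  then obtain l where "?q \<longlonglongrightarrow> l" using incseq_convergent sqrt_scalar_iter_bounds by blast
  then have qC: "Cauchy ?q" by (rule LIMSEQ_imp_Cauchy)
  have "convergent (\<lambda>n. ?Y n x)" for x
  proof -
    have "Cauchy (\<lambda>n. ?Y n x)"
    proof (rule CauchyI')
      fix e :: real assume e: "0 < e"
      have "0 < e / (norm x + 1)" using e norm_ge_zero[of x] by (intro divide_pos_pos) linarith+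
      then obtain M where M: "\<And>m n. m \<ge> M \<Longrightarrow> n \<ge> M \<Longrightarrow> norm (?q m - ?q n) < e / (norm x + 1)"
        using CauchyD[OF qC] by blast
      have "dist (?Y m x) (?Y n x) < e" if "m \<ge> M" "n > m" for m n
      proof -
        obtain k where k: "n = m + k" using \<open>n > m\<close> less_imp_add_positive by blast
        have "?q n - ?q m < e / (norm x + 1)" using M[of n m] that by simp
        then have "(?q n - ?q m) * (norm x + 1) < e" using norm_ge_zero[of x] by (simp add: less_divide_eq)
        moreover have "?q m \<le> ?q n" using \<open>incseq ?q\<close> that by (simp add: incseq_def)
        ultimately have "(?q n - ?q m) * norm x < e" by (simp add: distrib_left)
        then show ?thesis using diff[of m k x] k by (simp add: dist_norm norm_minus_commute)
      qed
      then show "\<exists>M. \<forall>m\<ge>M. \<forall>n>m. dist (?Y m x) (?Y n x) < e" by blast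
    qed
    then show ?thesis by (rule Cauchy_convergent)
  qed
  then obtain L where L: "\<And>x. (\<lambda>n. ?Y n x) \<longlonglongrightarrow> L x" unfolding convergent_def by metis
  have LI: "z = L x" if "(\<lambda>n. ?Y n x) \<longlonglongrightarrow> z" for x z using LIMSEQ_unique[OF that L] .
  have Llin: "bounded_clinear L"
  proof (rule bounded_clinearI)
    show "L (x + y) = L x + L y" for x y
      by (rule LI[symmetric]) (unfold add, intro tendsto_add L)
    show "L (c *\<^sub>C x) = c *\<^sub>C L x" for c x
      by (rule LI[symmetric]) (unfold scal, intro tendsto_scaleC L)
    show "norm (L x) \<le> 1 * norm x" for x
      using LIMSEQ_le_const2[OF tendsto_norm[OF L]] contr by simp
  qed
  have Lcontr: "norm (L x) \<le> norm x" for x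
    by (rule LIMSEQ_le_const2[OF tendsto_norm[OF L]]) (use contr in blast)
  have Lsym: "cinner (L x) y = cinner x (L y)" for x y
    using LIMSEQ_unique[OF tendsto_cinner[OF L tendsto_const]] tendsto_cinner[OF tendsto_const L]
    unfolding sym by blast
  have LL: "(\<lambda>n. ?Y n (?Y n x)) \<longlonglongrightarrow> L (L x)" for x
  proof -
    have "(\<lambda>n. norm (?Y n x - L x)) \<longlonglongrightarrow> 0" using L[of x] by (simp add: tendsto_norm_zero_iff LIM_zero_iff)
    then have "(\<lambda>n. norm (?Y n (?Y n x - L x))) \<longlonglongrightarrow> 0"
      by (rule tendsto_sandwich[OF always_eventually always_eventually tendsto_const, rotated -1])
        (use contr in auto)
    then have "(\<lambda>n. ?Y n (?Y n x - L x) + ?Y n (L x)) \<longlonglongrightarrow> 0 + L (L x)"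
      by (intro tendsto_add L) (simp only: tendsto_norm_zero_iff)
    moreover have "?Y n (?Y n x - L x) + ?Y n (L x) = ?Y n (?Y n x)" for n
      by (simp add: bounded_clinearD[OF Ylin])
    ultimately show ?thesis by simp
  qed
  have "(\<lambda>n. ?Y (Suc n) x) \<longlonglongrightarrow> (1 / 2) *\<^sub>C (X x + L (L x))" for x
    by (simp only: sqrt_iter.simps) (intro tendsto_scaleC tendsto_add tendsto_const LL)
  then have fix1: "(1 / 2) *\<^sub>C (X x + L (L x)) = L x" for x
    using LIMSEQ_unique[OF _ LIMSEQ_Suc[OF L[of x]]] by blast
  have LLx: "L (L x) = L x + L x - X x" for x
  proof -
    have "L x + L x = (1 / 2 + 1 / 2) *\<^sub>C (X x + L (L x))" by (simp only: scaleC_add_left fix1)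
    then show ?thesis by simp
  qed
  show thesis
  proof (rule that[of "\<lambda>x. x - L x"])
    show "bounded_clinear (\<lambda>x. x - L x)"
      using bounded_clinear_add[OF bounded_clinear_scaleC[of 1] bounded_clinear_uminus[OF Llin]] by simp
    show "symmetric_fun (\<lambda>x. x - L x)" by (simp add: symmetric_fun_def cinner_simps Lsym)
    show "x - L x - L (x - L x) = x - X x" for x by (simp add: bounded_clinearD[OF Llin] LLx)
    show "norm (x - (x - L x)) \<le> norm x" for x using Lcontr by simp
    show "0 \<le> Re (cinner (x - L x) x)" for x
    proof -
      have "Re (cinner (L x) x) \<le> norm (L x) * norm x"
        using complex_Re_le_cmod cauchy_schwarz order_trans by blast
      also have "\<dots> \<le> norm x * norm x" using Lcontr by (intro mult_right_mono) auto
      finally show ?thesis by (simp add: cinner_diff_left Re_cinner_self power2_eq_square)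
    qed
    show "\<forall>C. bounded_clinear C \<longrightarrow> (\<forall>x. C (X x) = X (C x)) \<longrightarrow> (\<forall>x. C (x - L x) = C x - L (C x))"
    proof (intro allI impI)
      fix C :: "'a \<Rightarrow> 'a" and x
      assume C: "bounded_clinear C" and CX: "\<forall>x. C (X x) = X (C x)"
      have "(\<lambda>n. C (?Y n x)) \<longlonglongrightarrow> C (L x)" by (rule bounded_linear.tendsto[OF bounded_clinearD(6)[OF C] L])
      moreover have "C (?Y n x) = ?Y n (C x)" for n by (rule sqrt_iter_commute[OF C]) (simp add: CX)
      ultimately have "C (L x) = L (C x)" by (intro LI) simp
      then show "C (x - L x) = C x - L (C x)" by (simp add: bounded_clinearD[OF C])
    qed
  qed
qed

text \<open>In the form of \<open>E\<close> at \<open>f + E f\<close> only the mixed term \<open>2 \<parallel>E f\<parallel>\<^sup>2\<close> survives.\<close>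

lemma symmetric_fun_eq_0:
  assumes E: "bounded_clinear E" "symmetric_fun E" and 0: "\<And>f. Re (cinner (E f) f) = 0"
  shows "E f = 0"
proof -
  have "0 = Re (cinner (E (f + E f)) (f + E f))" using 0 by simp
  also have "\<dots> = Re (cinner (E f) f) + Re (cinner (E (E f)) (E f)) + 2 * (norm (E f))\<^sup>2"
    by (simp add: bounded_clinearD[OF E(1)] cinner_simps Re_cinner_self symmetric_funD[OF E(2), of "E f" f])
  finally show ?thesis using 0 by simp
qed

text \<open>With \<open>D = R - K\<close> one has \<open>(R + K) D = R\<^sup>2 - K\<^sup>2 = 0\<close>. Hence the nonnegative numbers
  \<open>(R (D x), D x)\<close> and \<open>(K (D x), D x)\<close> are both zero, so is their difference \<open>(D\<^sup>3 x, x)\<close>, and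
  a symmetric operator with \<open>D\<^sup>3 = 0\<close> vanishes.\<close>

lemma positive_sqrt_unique:
  assumes R: "bounded_clinear R" "symmetric_fun R" "\<And>x. 0 \<le> Re (cinner (R x) x)"
    and K: "bounded_clinear K" "symmetric_fun K" "\<And>x. 0 \<le> Re (cinner (K x) x)"
    and comm: "\<And>x. R (K x) = K (R x)" and sq: "\<And>x. R (R x) = K (K x)"
  shows "R f = K f"
proof -
  define D where "D x = R x - K x" for x
  have D: "bounded_clinear D" unfolding D_def
    using bounded_clinear_add[OF R(1) bounded_clinear_uminus[OF K(1)]] by simp
  have Ds: "symmetric_fun D" by (simp add: symmetric_fun_def D_def cinner_simps symmetric_funD[OF R(2)] symmetric_funD[OF K(2)])
  have 0: "Re (cinner (D (D (D x))) x) = 0" for x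
  proof -
    have "R (D x) + K (D x) = 0" by (simp add: D_def bounded_clinearD[OF R(1)] bounded_clinearD[OF K(1)] comm sq)
    then have "cinner (R (D x)) (D x) + cinner (K (D x)) (D x) = 0" by (simp add: cinner_add_left[symmetric])
    then have "Re (cinner (R (D x)) (D x)) + Re (cinner (K (D x)) (D x)) = 0"
      by (metis plus_complex.sel(1) zero_complex.sel(1))
    then have "Re (cinner (R (D x)) (D x)) = 0" "Re (cinner (K (D x)) (D x)) = 0"
      using R(3)[of "D x"] K(3)[of "D x"] by linarith+
    then show ?thesis by (simp add: symmetric_funD[OF Ds, of _ x] D_def[of "D x"] cinner_diff_left)
  qed
  have "D (D (D x)) = 0" for x
    by (rule symmetric_fun_eq_0[of "\<lambda>x. D (D (D x))", OF bounded_clinear_compose[OF D bounded_clinear_compose[OF D D]] _ 0])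
      (simp add: symmetric_fun_def symmetric_funD[OF Ds])
  moreover have DD: "D x = 0" if "D (D x) = 0" for x
    using symmetric_funD[OF Ds, of "D x" x] that Re_cinner_self[of "D x"] by simp
  ultimately have "D f = 0" by blast
  then show ?thesis by (simp add: D_def)
qed

subsection \<open>Nonnegative selfadjoint operators\<close>

definition nonneg_selfadjoint :: "('a::complex_hilbert \<times> 'a) set \<Rightarrow> bool" where
  "nonneg_selfadjoint T \<longleftrightarrow>
     linear_operator T \<and> closure (Domain T) = UNIV \<and> adjoint_relation T = T \<and> accretive T"

lemma selfadjoint_in_UNIV: "selfadjoint_in UNIV T \<and> accretive T \<longleftrightarrow> nonneg_selfadjoint T"
  by (auto simp: selfadjoint_in_def nonneg_selfadjoint_def)

lemma nonneg_selfadjointD: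
  assumes "nonneg_selfadjoint T"
  shows "linear_operator T" "linear_relation T" "closure (Domain T) = UNIV" "adjoint_relation T = T"
    "accretive T" "closed T" "(x, y) \<in> T \<Longrightarrow> (x', y') \<in> T \<Longrightarrow> cinner y x' = cinner x y'"
proof -
  show "linear_operator T" "linear_relation T" "closure (Domain T) = UNIV" and adj: "adjoint_relation T = T"
    and "accretive T"
    using assms by (auto simp: nonneg_selfadjoint_def linear_operator_def)
  show "closed T" using closed_adjoint[of T] by (simp add: adj)
  show "cinner y x' = cinner x y'" if "(x, y) \<in> T" "(x', y') \<in> T"
    using adjoint_relationD[of x' y' T x y] that by (simp add: adj)
qed

text \<open>The operator \<open>S\<close> is \<open>(1 + T)\<inverse>\<close>. A vector \<open>w\<close> orthogonal to the range of \<open>T + 1\<close> satisfies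
  \<open>(w, - w) \<in> T\<close>, the adjoint being \<open>T\<close> itself, and this contradicts accretivity unless \<open>w = 0\<close>.\<close>

lemma nonneg_selfadjoint_resolvent:
  assumes T: "nonneg_selfadjoint T"
  obtains S where "bounded_clinear S" "symmetric_fun S" "\<And>f. (S f, f - S f) \<in> T"
    "\<And>x y. (x, y) \<in> T \<Longrightarrow> S (x + y) = x" "\<And>f. norm (S f) \<le> norm f" "\<And>f. norm (f - S f) \<le> norm f"
proof -
  note lin = nonneg_selfadjointD(2)[OF T] and acc = nonneg_selfadjointD(5)[OF T]
    and sym = nonneg_selfadjointD(7)[OF T]
  have "Range (shift T (- 1)) = UNIV"
  proof (rule Range_UNIV_if_bounded_below[OF linear_relation_shift[OF lin] closed_shift[OF nonneg_selfadjointD(6)[OF T]], of 1])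
    show "1 * norm x \<le> norm y" if "(x, y) \<in> shift T (- 1)" for x y
      using accretive_bounded_below[OF acc, of x "y - x" 1] that by simp
    fix w assume w: "\<And>x y. (x, y) \<in> shift T (- 1) \<Longrightarrow> cinner w y = 0"
    have "(w, - w) \<in> adjoint_relation T"
    proof (rule adjoint_relationI)
      fix x y assume "(x, y) \<in> T"
      then have "cinner w (y + x) = 0" by (intro w[of x]) simp
      then have "cinner (y + x) w = 0" using cinner_commute[of "y + x" w] by simp
      then show "cinner y w = cinner x (- w)" by (simp add: cinner_add_left eq_neg_iff_add_eq_0)
    qed
    then have "(w, - w) \<in> T" by (simp add: nonneg_selfadjointD(4)[OF T])
    from accretiveD[OF acc this] show "w = 0" by (simp add: Re_cinner_self)
  qed simp
  then have "f \<in> Range (shift T (- 1))" for f by simp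
  then have "\<exists>x. (x, f - x) \<in> T" for f unfolding Range_iff by simp
  then obtain S where S: "\<And>f. (S f, f - S f) \<in> T" by metis
  have uniq: "S (x + y) = x" if "(x, y) \<in> T" for x y
  proof -
    define d where "d = S (x + y) - x"
    have "(d, - d) \<in> T" using linear_relationD(4)[OF lin S[of "x + y"] that] by (simp add: d_def)
    from accretiveD[OF acc this] have "d = 0" by (simp add: Re_cinner_self)
    then show ?thesis by (simp add: d_def)
  qed
  have nrm: "(norm f)\<^sup>2 \<ge> (norm (S f))\<^sup>2 + (norm (f - S f))\<^sup>2" for f
    using norm_add_squared[of "f - S f" "S f"] accretiveD[OF acc S[of f]] by simp
  have n1: "norm (S f) \<le> norm f" for f
    by (rule power2_le_imp_le) (use nrm[of f] in \<open>smt (verit) zero_le_power2\<close>, simp)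
  have n2: "norm (f - S f) \<le> norm f" for f
    by (rule power2_le_imp_le) (use nrm[of f] in \<open>smt (verit) zero_le_power2\<close>, simp)
  show thesis
  proof (rule that[OF _ _ S uniq n1 n2])
    show "bounded_clinear S"
    proof (rule bounded_clinearI[of _ 1])
      show "S (f + g) = S f + S g" for f g
        using uniq[OF linear_relationD(2)[OF lin S[of f] S[of g]]] by simp
      show "S (c *\<^sub>C f) = c *\<^sub>C S f" for c f
        using uniq[OF linear_relationD(3)[OF lin S[of f], of c]] by (simp add: scaleC_diff_right)
    qed (simp add: n1)
    show "symmetric_fun S" unfolding symmetric_fun_def
    proof (intro allI)
      fix f g
      have "cinner (S f) g = cinner (S f) (S g) + cinner (S f) (g - S g)" by (simp add: cinner_diff_right)
      also have "cinner (S f) (g - S g) = cinner (f - S f) (S g)" using sym[OF S[of f] S[of g]] by simp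
      finally show "cinner (S f) g = cinner f (S g)" by (simp add: cinner_diff_left)
    qed
  qed
qed

text \<open>With \<open>P\<close>, \<open>Q\<close> the roots of \<open>S = (1 + T)\<inverse>\<close> and of \<open>1 - S = T (1 + T)\<inverse>\<close>, the square root of \<open>T\<close> is
  \<open>Q P\<inverse>\<close>, whose graph is the isometric image of the whole space under \<open>x \<mapsto> (P x, Q x)\<close>.\<close>

lemma nonneg_selfadjoint_parametrization:
  assumes T: "nonneg_selfadjoint T"
  obtains P Q where "bounded_clinear P" "bounded_clinear Q" "symmetric_fun P" "symmetric_fun Q"
    "\<And>x. P (Q x) = Q (P x)" "\<And>x. P (P x) + Q (Q x) = x" "\<And>x. P x = 0 \<Longrightarrow> x = 0"
    "\<And>x. 0 \<le> Re (cinner (Q x) (P x))"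
    "T = range (\<lambda>x. (P (P x), Q (Q x)))"
    "\<And>C x. bounded_clinear C \<Longrightarrow> (\<And>f. (C (P (P f)), C (Q (Q f))) \<in> T) \<Longrightarrow> C (P x) = P (C x)"
    "\<And>C x. bounded_clinear C \<Longrightarrow> (\<And>f. (C (P (P f)), C (Q (Q f))) \<in> T) \<Longrightarrow> C (Q x) = Q (C x)"
proof -
  obtain S where S: "bounded_clinear S" "symmetric_fun S" "\<And>f. (S f, f - S f) \<in> T"
    "\<And>x y. (x, y) \<in> T \<Longrightarrow> S (x + y) = x" "\<And>f. norm (S f) \<le> norm f" "\<And>f. norm (f - S f) \<le> norm f"
    by (rule nonneg_selfadjoint_resolvent[OF T]) (rule that)
  have C1: "bounded_clinear (\<lambda>f. f - S f)"
    using bounded_clinear_add[OF bounded_clinear_scaleC[of 1] bounded_clinear_uminus[OF S(1)]] by simp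
  have C2: "symmetric_fun (\<lambda>f. f - S f)" using S(2) by (simp add: symmetric_fun_def cinner_simps)
  obtain P where P: "bounded_clinear P" "symmetric_fun P" "\<And>x. P (P x) = x - (x - S x)"
    "\<And>x. norm (x - P x) \<le> norm x" "\<And>x. 0 \<le> Re (cinner (P x) x)"
    "\<forall>C. bounded_clinear C \<longrightarrow> (\<forall>x. C (x - S x) = C x - S (C x)) \<longrightarrow> (\<forall>x. C (P x) = P (C x))"
    by (rule contraction_sqrt[OF C1 C2 S(6)]) (rule that)
  obtain Q where Q: "bounded_clinear Q" "symmetric_fun Q" "\<And>x. Q (Q x) = x - S x"
    "\<And>x. norm (x - Q x) \<le> norm x" "\<And>x. 0 \<le> Re (cinner (Q x) x)"
    "\<forall>C. bounded_clinear C \<longrightarrow> (\<forall>x. C (S x) = S (C x)) \<longrightarrow> (\<forall>x. C (Q x) = Q (C x))"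
    by (rule contraction_sqrt[OF S(1,2,5)]) (rule that)
  have PP: "P (P x) = S x" for x using P(3) by simp
  have QC: "C (Q x) = Q (C x)" if "bounded_clinear C" "\<And>x. C (S x) = S (C x)" for C x
    using Q(6)[rule_format, OF that(1)] that by blast
  have PC: "C (P x) = P (C x)" if "bounded_clinear C" "\<And>x. C (S x) = S (C x)" for C x
    using P(6)[rule_format, OF that(1)] that by (simp add: bounded_clinearD[OF that(1)])
  have PS: "P (S x) = S (P x)" for x by (simp only: PP[symmetric])
  have PQ: "P (Q x) = Q (P x)" for x by (rule QC[OF P(1) PS])
  have inj: "x = 0" if "P x = 0" for x
  proof -
    have "S x = 0" using PP[of x] that bounded_clinearD(3)[OF P(1)] by simp
    then have "(0, x) \<in> T" using S(3)[of x] by simp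
    then show ?thesis
      using linear_operator_unique[OF nonneg_selfadjointD(1)[OF T]] linear_relationD(1)[OF nonneg_selfadjointD(2)[OF T]] by blast
  qed
  have Teq: "T = range (\<lambda>x. (P (P x), Q (Q x)))"
  proof (intro equalityI subrelI)
    fix x y assume "(x, y) \<in> T"
    then have "S (x + y) = x" by (rule S(4))
    then have "(x, y) = (P (P (x + y)), Q (Q (x + y)))" by (simp add: PP Q(3))
    then show "(x, y) \<in> range (\<lambda>x. (P (P x), Q (Q x)))" by blast
  qed (use S(3) in \<open>auto simp: PP Q(3)\<close>)
  have comm: "C (S f) = S (C f)" if "bounded_clinear C" "\<And>f. (C (P (P f)), C (Q (Q f))) \<in> T" for C f
    using S(4)[OF that(2)[of f]] by (simp add: PP Q(3) bounded_clinearD[OF that(1)])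
  have pos: "0 \<le> Re (cinner (Q x) (P x))" for x
  proof -
    have D1: "bounded_clinear (\<lambda>f. f - P f)"
      using bounded_clinear_add[OF bounded_clinear_scaleC[of 1] bounded_clinear_uminus[OF P(1)]] by simp
    have D2: "symmetric_fun (\<lambda>f. f - P f)" using P(2) by (simp add: symmetric_fun_def cinner_simps)
    obtain P' where P': "bounded_clinear P'" "symmetric_fun P'" "\<And>x. P' (P' x) = x - (x - P x)"
      "\<forall>C. bounded_clinear C \<longrightarrow> (\<forall>x. C (x - P x) = C x - P (C x)) \<longrightarrow> (\<forall>x. C (P' x) = P' (C x))"
      by (rule contraction_sqrt[OF D1 D2 P(4)]) (rule that)
    have "Q (P' x) = P' (Q x)" by (rule P'(4)[rule_format, OF Q(1)]) (simp add: bounded_clinearD[OF Q(1)] PQ)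
    then have "cinner (Q (P' x)) (P' x) = cinner (Q x) (P x)"
      using symmetric_funD[OF P'(2), of "Q x" "P' x"] P'(3)[of x] by simp
    then show ?thesis using Q(5)[of "P' x"] by simp
  qed
  show thesis
    by (rule that[OF P(1) Q(1) P(2) Q(2) PQ _ inj pos Teq PC[OF _ comm] QC[OF _ comm]])
      (simp_all add: PP Q(3))
qed

text \<open>The graph \<open>B\<close> of \<open>Q P\<inverse>\<close> is its own adjoint since \<open>Q u = P w\<close> is solved by
  \<open>u = P x\<close>, \<open>w = Q x\<close> with \<open>x = P u + Q w\<close>. For another root \<open>B'\<close> the operator \<open>R = B' (1 + T)\<inverse>\<close> is a
  bounded nonnegative root of \<open>S (1 - S) = (Q P)\<^sup>2\<close> which commutes with \<open>T\<close>, so \<open>R = Q P\<close>. This means that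
  \<open>B'\<close> contains \<open>(P (P f), Q (P f))\<close> for all \<open>f\<close>; these pairs are dense in \<open>B\<close> because the range of \<open>P\<close> is dense,
  and a selfadjoint operator has no proper selfadjoint extension. The last assertion says that the
  domain of \<open>T\<close> is a core of \<open>B\<close>.\<close>

theorem nonneg_selfadjoint_sqrt:
  assumes T: "nonneg_selfadjoint T"
  obtains B where "nonneg_selfadjoint B" "B O B = T"
    "\<And>B'. nonneg_selfadjoint B' \<Longrightarrow> B' O B' = T \<Longrightarrow> B' = B"
    "\<And>u w. (u, w) \<in> B \<Longrightarrow> \<exists>X W. (\<forall>n::nat. X n \<in> Domain T \<and> (X n, W n) \<in> B) \<and> X \<longlonglongrightarrow> u \<and> W \<longlonglongrightarrow> w"
proof (rule nonneg_selfadjoint_parametrization[OF T])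
  fix P Q :: "'a \<Rightarrow> 'a"
  assume P: "bounded_clinear P" and Q: "bounded_clinear Q" and sP: "symmetric_fun P" and sQ: "symmetric_fun Q"
    and PQ: "\<And>x. P (Q x) = Q (P x)" and sum: "\<And>x. P (P x) + Q (Q x) = x" and inj: "\<And>x. P x = 0 \<Longrightarrow> x = 0"
    and pos: "\<And>x. 0 \<le> Re (cinner (Q x) (P x))"
    and Teq: "T = range (\<lambda>x. (P (P x), Q (Q x)))"
    and CP: "\<And>C x. bounded_clinear C \<Longrightarrow> (\<And>f. (C (P (P f)), C (Q (Q f))) \<in> T) \<Longrightarrow> C (P x) = P (C x)"
    and CQ: "\<And>C x. bounded_clinear C \<Longrightarrow> (\<And>f. (C (P (P f)), C (Q (Q f))) \<in> T) \<Longrightarrow> C (Q x) = Q (C x)"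
  note Pl = bounded_clinearD[OF P] and Ql = bounded_clinearD[OF Q]
  define B where "B = range (\<lambda>x. (P x, Q x))"
  have BI: "(P x, Q x) \<in> B" for x by (auto simp: B_def)
  have BE: "\<exists>x. u = P x \<and> w = Q x" if "(u, w) \<in> B" for u w using that by (auto simp: B_def)
  have Brel: "linear_relation B" unfolding linear_relation_def
  proof (intro conjI allI impI)
    show "(0, 0) \<in> B" using BI[of 0] by (simp add: Pl Ql)
    fix u w assume "(u, w) \<in> B"
    then obtain x where x: "u = P x" "w = Q x" using BE by blast
    show "(c *\<^sub>C u, c *\<^sub>C w) \<in> B" for c using BI[of "c *\<^sub>C x"] by (simp add: x Pl Ql)
    fix u' w' assume "(u', w') \<in> B"
    then obtain y where y: "u' = P y" "w' = Q y" using BE by blast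
    show "(u + u', w + w') \<in> B" using BI[of "x + y"] by (simp add: x y Pl Ql)
  qed
  have Bop: "linear_operator B"
  proof (rule linear_operatorI[OF Brel])
    fix y assume "(0, y) \<in> B"
    then obtain x where "0 = P x" "y = Q x" using BE by blast
    then show "y = 0" using inj[of x] by (simp add: Ql)
  qed
  have "Domain B = range P" by (auto simp: B_def)
  moreover have ranP: "closure (range P) = UNIV"
  proof (rule closure_eq_UNIV_if_orthogonal_trivial)
    show "complex_subspace (range P)" using complex_subspace_Domain[OF Brel] calculation by simp
    fix y assume "\<And>v. v \<in> range P \<Longrightarrow> cinner y v = 0"
    then have "cinner y (P (P y)) = 0" by blast
    then have "cinner (P y) (P y) = 0" using symmetric_funD[OF sP, of y "P y"] by simp
    then show "y = 0" using inj Re_cinner_self[of "P y"] by simp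
  qed
  ultimately have Bdense: "closure (Domain B) = UNIV" by simp
  have Badj: "adjoint_relation B = B"
  proof (intro equalityI subrelI)
    fix u w assume uw: "(u, w) \<in> adjoint_relation B"
    have "cinner (Q u) x = cinner (P w) x" for x
    proof -
      have "cinner x (Q u) = cinner x (P w)"
        using adjoint_relationD[OF uw BI[of x]] by (simp add: symmetric_funD[OF sP] symmetric_funD[OF sQ])
      then show ?thesis using cinner_commute[of "Q u" x] cinner_commute[of "P w" x] by simp
    qed
    then have eq: "Q u = P w" by (rule cinner_eqI)
    have "P (P u + Q w) = u" using sum[of u] PQ[of w] eq by (simp add: Pl Ql)
    moreover have "Q (P u + Q w) = w" using sum[of w] PQ[of u] eq by (simp add: Pl Ql)
    ultimately show "(u, w) \<in> B" using BI[of "P u + Q w"] by simp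
  next
    fix u w assume "(u, w) \<in> B"
    then obtain z where z: "u = P z" "w = Q z" using BE by blast
    show "(u, w) \<in> adjoint_relation B"
    proof (rule adjoint_relationI)
      fix x y assume "(x, y) \<in> B"
      then obtain x' where "x = P x'" "y = Q x'" using BE by blast
      then show "cinner y u = cinner x w"
        using symmetric_funD[OF sP] symmetric_funD[OF sQ] PQ by (simp add: z)
    qed
  qed
  have Bsa: "nonneg_selfadjoint B"
    unfolding nonneg_selfadjoint_def accretive_def using Bop Bdense Badj pos by (auto dest: BE)
  have BB: "B O B = T"
  proof (intro equalityI subrelI)
    fix u w assume "(u, w) \<in> B O B"
    then obtain x y where xy: "u = P x" "Q x = P y" "w = Q y" using BE by blast
    have "P (P x + Q y) = x" using sum[of x] PQ[of y] xy(2) by (simp add: Pl Ql)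
    moreover have "Q (P x + Q y) = y" using sum[of y] PQ[of x] xy(2) by (simp add: Pl Ql)
    ultimately have "(u, w) = (P (P (P x + Q y)), Q (Q (P x + Q y)))" using xy by simp
    then show "(u, w) \<in> T" unfolding Teq by blast
  next
    fix u w assume "(u, w) \<in> T"
    then obtain x where "u = P (P x)" "w = Q (Q x)" unfolding Teq by blast
    then show "(u, w) \<in> B O B" using BI[of "P x"] BI[of "Q x"] by (auto simp: PQ)
  qed
  have approx: "\<exists>F. (\<lambda>n. P (F n)) \<longlonglongrightarrow> x" for x
  proof -
    have "x \<in> closure (range P)" using ranP by simp
    then obtain X where X: "\<forall>n. X n \<in> range P" "X \<longlonglongrightarrow> x" unfolding closure_sequential by blast
    then have "\<forall>n. \<exists>f. X n = P f" by blast
    then obtain F where "\<And>n. X n = P (F n)" by metis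
    then have "X = (\<lambda>n. P (F n))" by blast
    then show ?thesis using X(2) by blast
  qed
  note Pt = bounded_linear.tendsto[OF bounded_clinearD(6)[OF P]]
    and Qt = bounded_linear.tendsto[OF bounded_clinearD(6)[OF Q]]
  show thesis
  proof (rule that[OF Bsa BB])
    fix u w assume "(u, w) \<in> B"
    then obtain x where x: "u = P x" "w = Q x" using BE by blast
    obtain F where F: "(\<lambda>n. P (F n)) \<longlonglongrightarrow> x" using approx by blast
    show "\<exists>X W. (\<forall>n::nat. X n \<in> Domain T \<and> (X n, W n) \<in> B) \<and> X \<longlonglongrightarrow> u \<and> W \<longlonglongrightarrow> w"
    proof (intro exI conjI allI)
      show "P (P (F n)) \<in> Domain T" for n unfolding Teq by blast
      show "(P (P (F n)), Q (P (F n))) \<in> B" for n by (rule BI)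
    qed (use Pt[OF F] Qt[OF F] x in auto)
  next
    fix B' assume B': "nonneg_selfadjoint B'" and BB': "B' O B' = T"
    note B'op = nonneg_selfadjointD(1)[OF B'] and B'rel = nonneg_selfadjointD(2)[OF B']
      and B'acc = nonneg_selfadjointD(5)[OF B'] and B'sym = nonneg_selfadjointD(7)[OF B']
    define S where "S f = P (P f)" for f
    have QQ: "Q (Q f) = f - S f" for f using sum[of f] by (simp add: S_def algebra_simps)
    have Sl: "bounded_clinear S" unfolding S_def by (rule bounded_clinear_compose[OF P P])
    have ST: "(S f, f - S f) \<in> T" for f unfolding Teq using QQ by (auto simp: S_def)
    have SU: "S (x + y) = x" if "(x, y) \<in> T" for x y
    proof -
      obtain f where f: "x = P (P f)" "y = Q (Q f)" using \<open>(x, y) \<in> T\<close> unfolding Teq by blast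
      then have "x + y = f" using sum by simp
      then show ?thesis using f by (simp add: S_def)
    qed
    have "\<exists>y. (S f, y) \<in> B' \<and> (y, f - S f) \<in> B'" for f using ST[of f] unfolding BB'[symmetric] by blast
    then obtain R where R1: "\<And>f. (S f, R f) \<in> B'" and R2: "\<And>f. (R f, f - S f) \<in> B'" by metis
    have RI: "y = R f" if "(S f, y) \<in> B'" for f y using linear_operator_unique[OF B'op that R1] .
    have Rlin: "bounded_clinear R"
    proof (rule bounded_clinearI[of _ 1])
      show "R (f + g) = R f + R g" for f g
        using RI[of "f + g" "R f + R g"] linear_relationD(2)[OF B'rel R1[of f] R1[of g]]
        by (simp add: bounded_clinearD[OF Sl])
      show "R (c *\<^sub>C f) = c *\<^sub>C R f" for c f
        using RI[of "c *\<^sub>C f" "c *\<^sub>C R f"] linear_relationD(3)[OF B'rel R1[of f]]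
        by (simp add: bounded_clinearD[OF Sl])
      show "norm (R f) \<le> 1 * norm f" for f
      proof -
        have "(norm (R f))\<^sup>2 = Re (cinner (f - S f) (S f))"
          using B'sym[OF R2[of f] R1[of f]] by (simp add: Re_cinner_self[symmetric])
        also have "2 * \<dots> \<le> (norm f)\<^sup>2"
          using norm_add_squared[of "f - S f" "S f"] by simp
        finally have "(norm (R f))\<^sup>2 \<le> (norm f)\<^sup>2"
          using zero_le_power2[of "norm (R f)"] by linarith
        then show ?thesis by simp
      qed
    qed
    have Rsym: "symmetric_fun R" unfolding symmetric_fun_def
    proof (intro allI)
      fix f g
      have "cinner (R f) g = cinner (R f) (S g) + cinner (R f) (g - S g)" by (simp add: cinner_diff_right)
      also have "\<dots> = cinner (S f) (R g) + cinner (f - S f) (R g)"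
        using B'sym[OF R1[of f] R1[of g]] B'sym[OF R2[of f] R2[of g]] by simp
      finally show "cinner (R f) g = cinner f (R g)" by (simp add: cinner_diff_left)
    qed
    have Rpos: "0 \<le> Re (cinner (R f) f)" for f
    proof -
      have "Re (cinner (R f) f) = Re (cinner (R f) (S f)) + Re (cinner (f - S f) (R f))"
        by (simp add: cinner_diff_left Re_cinner_commute[of "R f" "S f"] Re_cinner_commute[of "R f" f])
      then show ?thesis using accretiveD[OF B'acc R1[of f]] accretiveD[OF B'acc R2[of f]] by simp
    qed
    have RST: "(R (S f), R f - R (S f)) \<in> T" for f
    proof -
      have "(S f - S (S f), R f - R (S f)) \<in> B'" by (rule linear_relationD(4)[OF B'rel R1 R1])
      then show ?thesis using R2[of "S f"] unfolding BB'[symmetric] by blast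
    qed
    have SR: "S (R f) = R (S f)" for f using SU[OF RST[of f]] by simp
    have RR: "R (R f) = S f - S (S f)" for f
      using RI[of "R f" "S f - S (S f)"] R2[of "S f"] by (simp add: SR)
    have RT: "(R (P (P f)), R (Q (Q f))) \<in> T" for f
      using RST[of f] by (simp add: QQ bounded_clinearD[OF Rlin] S_def[symmetric])
    have RP: "R (P x) = P (R x)" and RQ: "R (Q x) = Q (R x)" for x using CP[OF Rlin RT] CQ[OF Rlin RT] by blast+
    have R_eq: "R f = Q (P f)" for f
    proof (rule positive_sqrt_unique[OF Rlin Rsym Rpos bounded_clinear_compose[OF Q P]])
      show "symmetric_fun (\<lambda>x. Q (P x))" by (simp add: symmetric_fun_def symmetric_funD[OF sQ] symmetric_funD[OF sP] PQ)
      show "0 \<le> Re (cinner (Q (P x)) x)" for x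
        using pos[of x] symmetric_funD[OF sP, of "Q x" x] by (simp add: PQ)
      show "R (Q (P x)) = Q (P (R x))" for x by (simp add: RP RQ)
      show "R (R x) = Q (P (Q (P x)))" for x
        by (simp add: RR PQ QQ) (simp add: S_def Pl)
    qed
    have "B \<subseteq> B'"
    proof (rule subrelI)
      fix u w assume "(u, w) \<in> B"
      then obtain x where x: "u = P x" "w = Q x" using BE by blast
      obtain F where F: "(\<lambda>n. P (F n)) \<longlonglongrightarrow> x" using approx by blast
      show "(u, w) \<in> B'" unfolding x
      proof (rule closed_relationD[OF nonneg_selfadjointD(6)[OF B'] _ Pt[OF F] Qt[OF F]])
        show "(P (P (F n)), Q (P (F n))) \<in> B'" for n using R1[of "F n"] by (simp add: R_eq S_def)
      qed
    qed
    moreover have "B' \<subseteq> B" using adjoint_antimono[OF \<open>B \<subseteq> B'\<close>] by (simp add: Badj nonneg_selfadjointD(4)[OF B'])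
    ultimately show "B' = B" by blast
  qed
qed

lemma op_sqrt_in_UNIV:
  assumes T: "nonneg_selfadjoint T"
  shows "nonneg_selfadjoint (op_sqrt_in UNIV T)" "op_sqrt_in UNIV T O op_sqrt_in UNIV T = T"
    "nonneg_selfadjoint B \<Longrightarrow> B O B = T \<Longrightarrow> B = op_sqrt_in UNIV T"
    "(u, w) \<in> op_sqrt_in UNIV T \<Longrightarrow>
      \<exists>X W. (\<forall>n::nat. X n \<in> Domain T \<and> (X n, W n) \<in> op_sqrt_in UNIV T) \<and> X \<longlonglongrightarrow> u \<and> W \<longlonglongrightarrow> w"
proof -
  obtain B0 where B0: "nonneg_selfadjoint B0" "B0 O B0 = T"
    "\<And>B'. nonneg_selfadjoint B' \<Longrightarrow> B' O B' = T \<Longrightarrow> B' = B0"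
    "\<And>u w. (u, w) \<in> B0 \<Longrightarrow> \<exists>X W. (\<forall>n::nat. X n \<in> Domain T \<and> (X n, W n) \<in> B0) \<and> X \<longlonglongrightarrow> u \<and> W \<longlonglongrightarrow> w"
    by (rule nonneg_selfadjoint_sqrt[OF T]) (rule that)
  have eq: "op_sqrt_in UNIV T = B0"
    unfolding op_sqrt_in_def
    by (rule the_equality) (use B0 selfadjoint_in_UNIV in blast)+
  show "nonneg_selfadjoint (op_sqrt_in UNIV T)" "op_sqrt_in UNIV T O op_sqrt_in UNIV T = T"
    "nonneg_selfadjoint B \<Longrightarrow> B O B = T \<Longrightarrow> B = op_sqrt_in UNIV T"
    unfolding eq using B0 by blast+
  show "\<exists>X W. (\<forall>n::nat. X n \<in> Domain T \<and> (X n, W n) \<in> op_sqrt_in UNIV T) \<and> X \<longlonglongrightarrow> u \<and> W \<longlonglongrightarrow> w"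
    if "(u, w) \<in> op_sqrt_in UNIV T"
    using B0(4) that unfolding eq by blast
qed


subsection \<open>The part in the closure of the range\<close>

text \<open>The kernel of \<open>T\<close> is the orthogonal complement of \<open>closure (Range T)\<close> and is also the kernel of
  the square root. A root of the part of \<open>T\<close> in that subspace, extended by zero, is a root of \<open>T\<close>;
  hence it is the restriction of the only root of \<open>T\<close>.\<close>

locale selfadjoint_sqrt =
  fixes T :: "('a::complex_hilbert \<times> 'a) set" and B :: "('a \<times> 'a) set" and M :: "'a set"
  assumes T: "nonneg_selfadjoint T"
  defines "B \<equiv> op_sqrt_in UNIV T" and "M \<equiv> closure (Range T)"
begin

lemma B: "nonneg_selfadjoint B" and BB: "B O B = T"
  and B_unique: "nonneg_selfadjoint C \<Longrightarrow> C O C = T \<Longrightarrow> C = B"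
  unfolding B_def using op_sqrt_in_UNIV[OF T] by blast+

lemmas BD = nonneg_selfadjointD[OF B] and TD = nonneg_selfadjointD[OF T]

lemma M: "complex_subspace M" "closed M"
  unfolding M_def using complex_subspace_closure[OF complex_subspace_Range[OF TD(2)]] by simp_all

lemma M_decomposition:
  obtains m k where "x = m + k" "m \<in> M" "\<And>v. v \<in> M \<Longrightarrow> cinner k v = 0"
proof (rule orthogonal_projection[OF M, of x])
  fix p assume "p \<in> M" "\<And>v. v \<in> M \<Longrightarrow> cinner (x - p) v = 0"
  then show thesis by (intro that[of p "x - p"]) simp_all
qed

lemma kernel: "(k, 0) \<in> B" "(k, 0) \<in> T" if k: "\<And>v. v \<in> M \<Longrightarrow> cinner k v = 0"
proof -
  have "(k, 0) \<in> adjoint_relation T"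
  proof (rule adjoint_relationI)
    fix x y assume "(x, y) \<in> T"
    then have "y \<in> M" unfolding M_def using closure_subset[of "Range T"] by auto
    then show "cinner y k = cinner x 0" using k[of y] cinner_commute[of y k] by simp
  qed
  then show T0: "(k, 0) \<in> T" by (simp add: TD(4))
  then obtain y where y: "(k, y) \<in> B" "(y, 0) \<in> B" unfolding BB[symmetric] by blast
  have "cinner y y = cinner k 0" by (rule BD(7)[OF y(1) y(2), THEN trans]) simp
  then have "y = 0" using Re_cinner_self[of y] by simp
  then show "(k, 0) \<in> B" using y by simp
qed

lemma in_M_if_orthogonal:
  assumes "\<And>k. (\<And>v. v \<in> M \<Longrightarrow> cinner k v = 0) \<Longrightarrow> cinner k y = 0"
  shows "y \<in> M"
proof (rule M_decomposition[of y])
  fix m k assume mk: "y = m + k" "m \<in> M" "\<And>v. v \<in> M \<Longrightarrow> cinner k v = 0"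
  have "cinner k y = 0" by (rule assms) (rule mk(3))
  then have "cinner k k = 0" using mk(3)[OF mk(2)] by (simp add: mk(1) cinner_add_right)
  then show "y \<in> M" using Re_cinner_self[of k] mk by simp
qed

lemma orthogonal_in_M: "k = 0" if "k \<in> M" "\<And>v. v \<in> M \<Longrightarrow> cinner k v = 0"
  using that(2)[OF that(1)] Re_cinner_self[of k] by simp

lemma Range_B: "(x, y) \<in> B \<Longrightarrow> y \<in> M"
proof (rule in_M_if_orthogonal)
  fix k assume xy: "(x, y) \<in> B" and k: "\<And>v. v \<in> M \<Longrightarrow> cinner k v = 0"
  have "cinner 0 x = cinner k y" by (rule BD(7)[OF kernel(1) xy]) (rule k)
  then show "cinner k y = 0" by simp
qed

lemma part_in_M:
  assumes "(x, y) \<in> B"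
  obtains m k where "x = m + k" "m \<in> M" "\<And>v. v \<in> M \<Longrightarrow> cinner k v = 0" "(m, y) \<in> B"
proof (rule M_decomposition[of x])
  fix m k assume mk: "x = m + k" "m \<in> M" "\<And>v. v \<in> M \<Longrightarrow> cinner k v = 0"
  have "(m, y) \<in> B" using linear_relationD(4)[OF BD(2) assms kernel(1)[OF mk(3)]] mk(1) by simp
  show thesis by (rule that[of m k]; fact)
qed

lemma selfadjoint_part: "selfadjoint_in M {(x, y) \<in> B. x \<in> M}"
proof -
  let ?C = "{(x, y) \<in> B. x \<in> M}"
  have "linear_operator ?C"
  proof (rule linear_operatorI)
    show "linear_relation ?C" unfolding linear_relation_def
      using linear_relationD(1-3)[OF BD(2)] complex_subspaceD(1-3)[OF M(1)] by auto
    show "y = 0" if "(0, y) \<in> ?C" for y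
      using that linear_operator_unique[OF BD(1) _ linear_relationD(1)[OF BD(2)]] by auto
  qed
  moreover have "?C \<subseteq> M \<times> M" using Range_B by auto
  moreover have "closure (Domain ?C) = M"
  proof
    show "closure (Domain ?C) \<subseteq> M" by (rule closure_minimal[OF _ M(2)]) auto
    show "M \<subseteq> closure (Domain ?C)"
    proof
      fix m assume m: "m \<in> M"
      have "m \<in> closure (Domain B)" using BD(3) by simp
      show "m \<in> closure (Domain ?C)" unfolding closure_approachable
      proof (intro allI impI)
        fix e :: real assume "0 < e"
        then obtain x where x: "x \<in> Domain B" "dist x m < e"
          using \<open>m \<in> closure (Domain B)\<close> unfolding closure_approachable by blast
        obtain y where "(x, y) \<in> B" using x(1) by blast
        then show "\<exists>p\<in>Domain ?C. dist p m < e"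
        proof (rule part_in_M)
          fix p k assume pk: "x = p + k" "p \<in> M" "\<And>v. v \<in> M \<Longrightarrow> cinner k v = 0" "(p, y) \<in> B"
          have "cinner k (p - m) = 0" by (rule pk(3)[OF complex_subspaceD(5)[OF M(1) pk(2) m]])
          then have "(norm (k + (p - m)))\<^sup>2 = (norm k)\<^sup>2 + (norm (p - m))\<^sup>2"
            by (simp only: norm_add_squared) simp
          moreover have "k + (p - m) = x - m" using pk(1) by simp
          ultimately have "(norm (p - m))\<^sup>2 \<le> (norm (x - m))\<^sup>2" by simp
          then have "norm (p - m) \<le> norm (x - m)" by simp
          then have "dist p m < e" using x(2) by (simp add: dist_norm)
          moreover have "p \<in> Domain ?C" using pk by blast
          ultimately show ?thesis by blast
        qed
      qed
    qed
  qed
  moreover have "adjoint_relation ?C \<inter> M \<times> M = ?C"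
  proof (intro equalityI subsetI)
    fix z assume "z \<in> adjoint_relation ?C \<inter> M \<times> M"
    then obtain u w where z: "z = (u, w)" and uw: "(u, w) \<in> adjoint_relation ?C" "u \<in> M" "w \<in> M" by (cases z) auto
    have "(u, w) \<in> adjoint_relation B"
    proof (rule adjoint_relationI)
      fix x y assume "(x, y) \<in> B"
      then show "cinner y u = cinner x w"
      proof (rule part_in_M)
        fix p k assume pk: "x = p + k" "p \<in> M" "\<And>v. v \<in> M \<Longrightarrow> cinner k v = 0" "(p, y) \<in> B"
        have "cinner y u = cinner p w" by (rule adjoint_relationD[OF uw(1)]) (use pk in simp)
        then show "cinner y u = cinner x w" using pk(3)[OF uw(3)] by (simp add: pk(1) cinner_add_left)
      qed
    qed
    then show "z \<in> ?C" using uw by (simp add: z BD(4))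
  next
    fix z assume "z \<in> ?C"
    then obtain u w where z: "z = (u, w)" and uw: "(u, w) \<in> B" "u \<in> M" by auto
    have "(u, w) \<in> adjoint_relation ?C"
      by (rule adjoint_relationI) (use BD(7)[OF _ uw(1)] in auto)
    then show "z \<in> adjoint_relation ?C \<inter> M \<times> M" using uw Range_B[OF uw(1)] by (simp add: z)
  qed
  ultimately show ?thesis by (simp add: selfadjoint_in_def)
qed

lemma part_squared: "{(x, y) \<in> B. x \<in> M} O {(x, y) \<in> B. x \<in> M} = {(x, y) \<in> T. x \<in> M}"
  unfolding BB[symmetric] using Range_B by (auto 4 4)

lemma part_unique:
  assumes C: "selfadjoint_in M C" "accretive C" "C O C = {(x, y) \<in> T. x \<in> M}"
  shows "C = {(x, y) \<in> B. x \<in> M}"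
proof -
  have Cop: "linear_operator C" and CM: "C \<subseteq> M \<times> M" and Cdense: "closure (Domain C) = M"
    and Cadj: "adjoint_relation C \<inter> M \<times> M = C"
    using C(1) by (auto simp: selfadjoint_in_def)
  note CD = linear_relationD[OF linear_operator_relation[OF Cop]]
  define N where "N = {k. \<forall>v\<in>M. cinner k v = 0}"
  have N0: "0 \<in> N" and Na: "\<And>x y. x \<in> N \<Longrightarrow> y \<in> N \<Longrightarrow> x + y \<in> N" and Ns: "\<And>c x. x \<in> N \<Longrightarrow> c *\<^sub>C x \<in> N"
    by (auto simp: N_def cinner_simps)
  have NM: "k = 0" if "k \<in> N" "k \<in> M" for k using orthogonal_in_M[OF that(2)] that(1) by (simp add: N_def)
  have perp: "cinner k v = 0" "cinner v k = 0" if "k \<in> N" "v \<in> M" for k v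
    using that cinner_commute[of v k] by (auto simp: N_def)
  define E where "E = {(m + k, c) | m c k. (m, c) \<in> C \<and> k \<in> N}"
  have EI: "(m + k, c) \<in> E" if "(m, c) \<in> C" "k \<in> N" for m c k using that by (auto simp: E_def)
  have CE: "C \<subseteq> E" using EI[OF _ N0] by auto
  have "linear_operator E"
  proof (rule linear_operatorI)
    show "linear_relation E" unfolding linear_relation_def
    proof (intro conjI allI impI)
      show "(0, 0) \<in> E" using EI[OF CD(1) N0] by simp
      fix x y assume "(x, y) \<in> E"
      then obtain m k where 1: "x = m + k" "(m, y) \<in> C" "k \<in> N" by (auto simp: E_def)
      show "(c *\<^sub>C x, c *\<^sub>C y) \<in> E" for c
        using EI[OF CD(3)[OF 1(2)] Ns[OF 1(3)], of c c] by (simp add: 1 scaleC_add_right)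
      fix x' y' assume "(x', y') \<in> E"
      then obtain m' k' where 2: "x' = m' + k'" "(m', y') \<in> C" "k' \<in> N" by (auto simp: E_def)
      show "(x + x', y + y') \<in> E"
        using EI[OF CD(2)[OF 1(2) 2(2)] Na[OF 1(3) 2(3)]] by (simp add: 1 2 add_ac)
    qed
    fix y assume "(0, y) \<in> E"
    then obtain m k where 1: "m + k = 0" "(m, y) \<in> C" "k \<in> N" by (auto simp: E_def)
    have "m \<in> M" using 1 CM by auto
    moreover have "k = - m" using 1(1) by (simp add: eq_neg_iff_add_eq_0 add.commute)
    ultimately have "k = 0" using NM[OF 1(3)] complex_subspaceD(4)[OF M(1)] by blast
    then have "m = 0" using 1 by simp
    then show "y = 0" using 1 linear_operator_unique[OF Cop _ CD(1)] by blast
  qed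
  moreover have "closure (Domain E) = UNIV"
  proof (rule closure_eq_UNIV_if_orthogonal_trivial[OF complex_subspace_Domain[OF linear_operator_relation[OF calculation]]])
    fix y assume y: "\<And>v. v \<in> Domain E \<Longrightarrow> cinner y v = 0"
    have "cinner y v = 0" if "v \<in> M" for v
      by (rule orthogonal_to_closure[of "Domain C"]) (use y CE that Cdense in auto)
    then have "y \<in> N" by (simp add: N_def)
    then have "y \<in> Domain E" using EI[OF CD(1), of y] by auto
    then show "y = 0" using y[of y] Re_cinner_self[of y] by simp
  qed
  moreover have "adjoint_relation E = E"
  proof (intro equalityI subrelI)
    fix u w assume uw: "(u, w) \<in> adjoint_relation E"
    have w: "w \<in> M"
    proof (rule in_M_if_orthogonal)
      fix k assume "\<And>v. v \<in> M \<Longrightarrow> cinner k v = 0"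
      then have "(0 + k, 0) \<in> E" by (intro EI CD(1)) (simp add: N_def)
      from adjoint_relationD[OF uw this] show "cinner k w = 0" by simp
    qed
    show "(u, w) \<in> E"
    proof (rule M_decomposition[of u])
      fix p k assume pk: "u = p + k" "p \<in> M" "\<And>v. v \<in> M \<Longrightarrow> cinner k v = 0"
      have kN: "k \<in> N" using pk by (simp add: N_def)
      have "(p, w) \<in> adjoint_relation C"
      proof (rule adjoint_relationI)
        fix x y assume xy: "(x, y) \<in> C"
        have "cinner y u = cinner x w" using adjoint_relationD[OF uw, of x y] xy CE by blast
        moreover have "y \<in> M" using xy CM by auto
        ultimately show "cinner y p = cinner x w" using perp(2)[OF kN] by (simp add: pk(1) cinner_add_right)
      qed
      then have "(p, w) \<in> C" using Cadj pk(2) w by blast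
      then show "(u, w) \<in> E" using EI[OF _ kN] pk(1) by simp
    qed
  next
    fix u w assume "(u, w) \<in> E"
    then obtain m k where 1: "u = m + k" "(m, w) \<in> C" "k \<in> N" by (auto simp: E_def)
    show "(u, w) \<in> adjoint_relation E"
    proof (rule adjoint_relationI)
      fix x y assume "(x, y) \<in> E"
      then obtain m' k' where 2: "x = m' + k'" "(m', y) \<in> C" "k' \<in> N" by (auto simp: E_def)
      have "(m, w) \<in> adjoint_relation C" using 1(2) Cadj by blast
      then have "cinner y m = cinner m' w" by (rule adjoint_relationD[OF _ 2(2)])
      moreover have "y \<in> M" "w \<in> M" using 1 2 CM by auto
      ultimately show "cinner y u = cinner x w"
        using perp(2)[OF 1(3)] perp(1)[OF 2(3)] by (simp add: 1(1) 2(1) cinner_simps)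
    qed
  qed
  moreover have "accretive E" unfolding accretive_def
  proof (clarify)
    fix x y assume "(x, y) \<in> E"
    then obtain m k where 1: "x = m + k" "(m, y) \<in> C" "k \<in> N" by (auto simp: E_def)
    moreover have "y \<in> M" using 1 CM by auto
    ultimately show "0 \<le> Re (cinner y x)" using accretiveD[OF C(2) 1(2)] perp(2)[OF 1(3)] by (simp add: cinner_add_right)
  qed
  ultimately have E: "nonneg_selfadjoint E" by (simp add: nonneg_selfadjoint_def)
  have "E O E = T"
  proof (intro equalityI subrelI)
    fix x z assume "(x, z) \<in> E O E"
    then obtain y where y: "(x, y) \<in> E" "(y, z) \<in> E" by blast
    then obtain m k m' k' where 1: "x = m + k" "(m, y) \<in> C" "k \<in> N" and 2: "y = m' + k'" "(m', z) \<in> C" "k' \<in> N"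
      by (auto simp: E_def)
    have "k' = y - m'" using 2 by simp
    then have "k' \<in> M" using complex_subspaceD(5)[OF M(1), of y m'] 1 2 CM by auto
    then have "k' = 0" by (rule NM[OF 2(3)])
    then have "(m, z) \<in> C O C" using 1 2 by auto
    then have "(m, z) \<in> T" by (simp add: C(3))
    moreover have "(k, 0) \<in> T" by (rule kernel(2)) (use 1(3) N_def in blast)
    ultimately show "(x, z) \<in> T" using linear_relationD(2)[OF TD(2)] 1(1) by fastforce
  next
    fix u w assume uw: "(u, w) \<in> T"
    show "(u, w) \<in> E O E"
    proof (rule M_decomposition[of u])
      fix p k assume pk: "u = p + k" "p \<in> M" "\<And>v. v \<in> M \<Longrightarrow> cinner k v = 0"
      have "(p, w) \<in> T" using linear_relationD(4)[OF TD(2) uw kernel(2)[OF pk(3)]] pk(1) by simp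
      then have "(p, w) \<in> C O C" using pk(2) by (simp add: C(3))
      then obtain y where "(p, y) \<in> C" "(y, w) \<in> C" by blast
      moreover have "k \<in> N" using pk by (simp add: N_def)
      ultimately show "(u, w) \<in> E O E" using EI[of p y k] CE pk(1) by blast
    qed
  qed
  then have EB: "E = B" by (rule B_unique[OF E])
  show ?thesis
  proof (intro equalityI subrelI)
    fix x y assume "(x, y) \<in> C"
    then show "(x, y) \<in> {(x, y) \<in> B. x \<in> M}" using CE CM EB by auto
  next
    fix x y assume "(x, y) \<in> {(x, y) \<in> B. x \<in> M}"
    then have xy: "(x, y) \<in> E" "x \<in> M" by (auto simp: EB)
    then obtain m k where 1: "x = m + k" "(m, y) \<in> C" "k \<in> N" by (auto simp: E_def)
    have "k = x - m" using 1 by simp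
    then have "k \<in> M" using complex_subspaceD(5)[OF M(1), of x m] xy(2) 1 CM by auto
    then have "k = 0" by (rule NM[OF 1(3)])
    then show "(x, y) \<in> C" using 1 by simp
  qed
qed

lemma op_sqrt_part: "op_sqrt_in M {(x, y) \<in> T. x \<in> M} = {(x, y) \<in> B. x \<in> M}"
  unfolding op_sqrt_in_def
proof (rule the_equality)
  have "accretive {(x, y) \<in> B. x \<in> M}" using BD(5) by (auto simp: accretive_def)
  then show "selfadjoint_in M {(x, y) \<in> B. x \<in> M} \<and> accretive {(x, y) \<in> B. x \<in> M} \<and>
      {(x, y) \<in> B. x \<in> M} O {(x, y) \<in> B. x \<in> M} = {(x, y) \<in> T. x \<in> M}"
    using selfadjoint_part part_squared by blast
qed (use part_unique in blast)

text \<open>Applied to the multiples of \<open>v\<close> the inequality becomes \<open>|(v, f)|\<^sup>2 \<le> c \<parallel>B v\<parallel>\<^sup>2\<close>. Thus \<open>(f, v)\<close> is a bounded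
  functional for the form \<open>(B u, B v)\<close>; along a representing sequence \<open>B (X n)\<close> converges, and the
  limit is the preimage of \<open>f\<close> in \<open>M\<close>. For the other direction complete the square.\<close>

lemma inverse_sqrt_bound:
  fixes g :: "'a \<Rightarrow> 'a"
  defines "g \<equiv> app ({(x, y) \<in> B. x \<in> M}\<inverse>)"
  shows "f \<in> Range B \<and> (norm (g f))\<^sup>2 \<le> c \<longleftrightarrow>
    (\<forall>(v, w) \<in> B. 0 \<le> c + (norm w)\<^sup>2 + 2 * Im (cinner v f))"
proof -
  let ?C = "{(x, y) \<in> B. x \<in> M}"
  have inv_op: "linear_operator (?C\<inverse>)"
  proof (rule linear_operatorI)
    show "linear_relation (?C\<inverse>)"
      using selfadjoint_part linear_relation_converse[of ?C] by (simp add: selfadjoint_in_def linear_operator_def)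
    fix y assume "(0, y) \<in> ?C\<inverse>"
    then have y: "(y, 0) \<in> B" "y \<in> M" by auto
    have "cinner y v = 0" if "v \<in> M" for v
    proof (rule orthogonal_to_closure[of "Range T"])
      fix w assume "w \<in> Range T"
      then obtain x z where "(x, z) \<in> B" "(z, w) \<in> B" unfolding BB[symmetric] by blast
      then have "cinner 0 z = cinner y w" using BD(7)[OF y(1)] by blast
      then show "cinner y w = 0" by simp
    qed (use that M_def in simp)
    then show "y = 0" by (rule orthogonal_in_M[OF y(2)])
  qed
  have g: "(g f, f) \<in> B" "g f \<in> M" if f: "f \<in> Range B"
  proof -
    obtain x where "(x, f) \<in> B" using f by blast
    then have "f \<in> Domain (?C\<inverse>)" by (rule part_in_M) blast
    from app_in[OF inv_op this] show "(g f, f) \<in> B" "g f \<in> M" by (auto simp: g_def)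
  qed
  show ?thesis
  proof (intro iffI ballI conjI)
    assume f: "f \<in> Range B \<and> (norm (g f))\<^sup>2 \<le> c"
    have "0 \<le> c + (norm w)\<^sup>2 + 2 * Im (cinner v f)" if vw: "(v, w) \<in> B" for v w
    proof -
      have "cinner v f = cinner w (g f)" using BD(7)[OF vw g(1)] f by simp
      then have "- (norm w * norm (g f)) \<le> Im (cinner v f)"
        using cauchy_schwarz[of w "g f"] abs_Im_le_cmod[of "cinner v f"] by simp
      moreover have "0 \<le> (norm w - norm (g f))\<^sup>2" by simp
      ultimately show ?thesis using f by (simp add: power2_diff)
    qed
    then show "case p of (v, w) \<Rightarrow> 0 \<le> c + (norm w)\<^sup>2 + 2 * Im (cinner v f)" if "p \<in> B" for p
      using that by auto
  next
    assume all: "\<forall>(v, w) \<in> B. 0 \<le> c + (norm w)\<^sup>2 + 2 * Im (cinner v f)"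
    have c0: "0 \<le> c" using all linear_relationD(1)[OF BD(2)] by fastforce
    have bound: "(cmod (cinner v f))\<^sup>2 \<le> c * (norm w)\<^sup>2" if vw: "(v, w) \<in> B" for v w
    proof (cases "cinner v f = 0")
      case False
      let ?z = "cinner v f"
      have "((cmod ?z)\<^sup>2)\<^sup>2 \<le> ((cmod ?z)\<^sup>2 * (norm w)\<^sup>2) * c"
      proof (rule discriminant_bound)
        fix t :: real
        let ?a = "\<i> * complex_of_real t * cnj ?z"
        have "(?a *\<^sub>C v, ?a *\<^sub>C w) \<in> B" by (rule linear_relationD(3)[OF BD(2) vw])
        then have "0 \<le> c + (norm (?a *\<^sub>C w))\<^sup>2 + 2 * Im (cinner (?a *\<^sub>C v) f)" using all by fast
        moreover have "cinner (?a *\<^sub>C v) f = \<i> * complex_of_real (t * (cmod ?z)\<^sup>2)"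
          by (simp add: cinner_scaleC_left complex_norm_square mult_ac del: of_real_power)
        then have "Im (cinner (?a *\<^sub>C v) f) = t * (cmod ?z)\<^sup>2" by (simp del: of_real_mult of_real_power)
        moreover have "norm (?a *\<^sub>C w) = \<bar>t\<bar> * cmod ?z * norm w" by (simp add: norm_mult)
        ultimately show "- c \<le> (cmod ?z)\<^sup>2 * (norm w)\<^sup>2 * t\<^sup>2 + 2 * t * (cmod ?z)\<^sup>2"
          by (simp only: power_mult_distrib power2_abs) (simp add: algebra_simps)
      qed simp
      then have "(cmod ?z)\<^sup>2 * (cmod ?z)\<^sup>2 \<le> (cmod ?z)\<^sup>2 * (c * (norm w)\<^sup>2)"
        by (simp add: power2_eq_square mult_ac)
      moreover have "0 < (cmod ?z)\<^sup>2" using False by simp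
      ultimately show ?thesis by (simp only: mult_le_cancel_left_pos)
    qed (use c0 in simp)
    note appB = app_in[OF BD(1)]
    have "\<exists>h. (h, f) \<in> B \<and> h \<in> M \<and> (norm h)\<^sup>2 \<le> c"
    proof (rule riesz_sequence[OF complex_subspace_Domain[OF BD(2)],
          of "\<lambda>u v. cinner (app B u) (app B v)" "cinner f" c])
      show "cinner (app B x) (app B y) = cnj (cinner (app B y) (app B x))" for x y by (rule cinner_commute)
      show "(cmod (cinner f v))\<^sup>2 \<le> c * Re (cinner (app B v) (app B v))" if "v \<in> Domain B" for v
      proof -
        have "cmod (cinner f v) = cmod (cinner v f)" by (metis cinner_commute complex_mod_cnj)
        then show ?thesis using bound[OF appB[OF that]] by (simp add: Re_cinner_self)
      qed
    next
      fix X :: "nat \<Rightarrow> 'a"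
      assume X: "\<And>n. X n \<in> Domain B"
        "\<And>\<epsilon>. 0 < \<epsilon> \<Longrightarrow> \<exists>N. \<forall>m\<ge>N. \<forall>n\<ge>N. Re (cinner (app B (X m - X n)) (app B (X m - X n))) < \<epsilon>"
        "\<And>v. v \<in> Domain B \<Longrightarrow> (\<lambda>n. cinner (app B (X n)) (app B v)) \<longlonglongrightarrow> cinner f v"
      have "Cauchy (\<lambda>n. app B (X n))"
        using X(2) unfolding Re_cinner_self app_linear(3)[OF BD(1) X(1) X(1)] by (rule Cauchy_norm_squared)
      then obtain h where h: "(\<lambda>n. app B (X n)) \<longlonglongrightarrow> h" using Cauchy_convergent convergent_def by blast
      have hv: "cinner h w = cinner f v" if vw: "(v, w) \<in> B" for v w
        using LIMSEQ_unique[OF tendsto_cinner[OF h tendsto_const] X(3)[OF DomainI[OF vw]]]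
        by (simp add: app_eq[OF BD(1) vw])
      have "(h, f) \<in> adjoint_relation B"
        by (rule adjoint_relationI) (metis hv cinner_commute)
      then have hB: "(h, f) \<in> B" by (simp add: BD(4))
      have hM: "h \<in> M"
        by (rule closed_sequentially[OF M(2) _ h]) (rule Range_B[OF appB[OF X(1)]])
      have "(cmod (cinner h (app B (X n))))\<^sup>2 \<le> c * (norm (app B (X n)))\<^sup>2" for n
      proof -
        have "cmod (cinner h (app B (X n))) = cmod (cinner (X n) f)"
          using hv[OF appB[OF X(1)[of n]]] by (metis cinner_commute complex_mod_cnj)
        then show ?thesis using bound[OF appB[OF X(1)[of n]]] by simp
      qed
      moreover have "(\<lambda>n. (cmod (cinner h (app B (X n))))\<^sup>2) \<longlonglongrightarrow> (cmod (cinner h h))\<^sup>2"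
        by (intro tendsto_power tendsto_norm tendsto_cinner tendsto_const h)
      moreover have "(\<lambda>n. c * (norm (app B (X n)))\<^sup>2) \<longlonglongrightarrow> c * (norm h)\<^sup>2"
        by (intro tendsto_mult tendsto_const tendsto_power tendsto_norm h)
      ultimately have "(cmod (cinner h h))\<^sup>2 \<le> c * (norm h)\<^sup>2" by (intro LIMSEQ_le) auto
      moreover have "cmod (cinner h h) = (norm h)\<^sup>2" by (simp add: cinner_norm norm_power)
      ultimately have "(norm h)\<^sup>2 * (norm h)\<^sup>2 \<le> (norm h)\<^sup>2 * c"
        by (simp only: power2_eq_square mult_ac)
      then have "(norm h)\<^sup>2 \<le> c" using c0 by (cases "h = 0") (auto simp: power2_eq_square)
      then show ?thesis using hB hM by blast
    qed (simp_all add: app_linear[OF BD(1)] cinner_simps c0)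
    then obtain h where h: "(h, f) \<in> B" "h \<in> M" "(norm h)\<^sup>2 \<le> c" by blast
    then have "g f = h" unfolding g_def by (intro app_eq[OF inv_op]) auto
    then show "f \<in> Range B" "(norm (g f))\<^sup>2 \<le> c" using h by blast+
  qed
qed

end


section \<open>The Friedrichs extension\<close>

text \<open>For \<open>(u, w)\<close> in the adjoint take \<open>v\<close> in the domain of \<open>T\<close> with \<open>(1 + T) v = u + w\<close>. Then \<open>u - v\<close> is
  orthogonal to the range of \<open>1 + T\<close>, which is everything.\<close>

lemma nonneg_selfadjointI:
  assumes op: "linear_operator T" and dense: "closure (Domain T) = UNIV" and acc: "accretive T"
    and sym: "\<And>x y x' y'. (x, y) \<in> T \<Longrightarrow> (x', y') \<in> T \<Longrightarrow> cinner y x' = cinner x y'"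
    and surj: "\<And>f. \<exists>u. (u, f - u) \<in> T"
  shows "nonneg_selfadjoint T"
proof -
  have "(u, w) \<in> T" if uw: "(u, w) \<in> adjoint_relation T" for u w
  proof -
    obtain v where v: "(v, (u + w) - v) \<in> T" using surj by blast
    have "cinner (u - v) f = 0" for f
    proof -
      obtain x where x: "(x, f - x) \<in> T" using surj by blast
      have "cinner (f - x) u = cinner x w" by (rule adjoint_relationD[OF uw x])
      then have "cinner f u = cinner x (u + w)" by (simp add: cinner_simps algebra_simps)
      moreover have "cinner (f - x) v = cinner x (u + w - v)" by (rule sym[OF x v])
      then have "cinner f v = cinner x (u + w)" by (simp add: cinner_simps algebra_simps)
      ultimately have "cinner f (u - v) = 0" by (simp add: cinner_diff_right)
      then show ?thesis using cinner_commute[of "u - v" f] by simp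
    qed
    then have "u = v" using cinner_eqI[of "u - v" 0] by simp
    then show ?thesis using v by simp
  qed
  moreover have "(u, w) \<in> adjoint_relation T" if "(u, w) \<in> T" for u w
    by (rule adjoint_relationI) (rule sym[OF _ that])
  ultimately have "adjoint_relation T = T" by auto
  then show ?thesis using op dense acc by (simp add: nonneg_selfadjoint_def)
qed

locale dense_nonnegative_operator =
  fixes A :: "('a::complex_hilbert \<times> 'a) set"
  assumes nonnegative: "nonnegative_symmetric A" and closed_A: "closed A"
    and dense_A: "closure (Domain A) = UNIV"
begin

lemma A_op: "linear_operator A" and A_acc: "accretive A"
  and A_sym: "(x, y) \<in> A \<Longrightarrow> (x', y') \<in> A \<Longrightarrow> cinner y x' = cinner x y'"
  using nonnegative by (auto simp: nonnegative_symmetric_def symmetric_operator_def)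

lemma A_rel: "linear_relation A" using A_op by (rule linear_operator_relation)

lemma dom_A: "complex_subspace (Domain A)" by (rule complex_subspace_Domain[OF A_rel])

lemma app_A: "x \<in> Domain A \<Longrightarrow> (x, app A x) \<in> A" by (rule app_in[OF A_op])

lemma adj_op: "linear_operator (adjoint_relation A)" by (rule linear_operator_adjoint[OF dense_A])

lemma A_subset_adjoint: "A \<subseteq> adjoint_relation A"
  by (auto intro!: adjoint_relationI dest: A_sym)

subsection \<open>Construction from the closed form\<close>

abbreviation a :: "'a \<Rightarrow> 'a \<Rightarrow> complex" where "a x y \<equiv> cinner (app A x) y"

lemma a_sym: "x \<in> Domain A \<Longrightarrow> y \<in> Domain A \<Longrightarrow> a x y = cinner x (app A y)"
  by (rule A_sym[OF app_A app_A])

lemma a_props: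
  "x \<in> Domain A \<Longrightarrow> y \<in> Domain A \<Longrightarrow> a (x + y) z = a x z + a y z"
  "x \<in> Domain A \<Longrightarrow> a (c *\<^sub>C x) y = c * a x y"
  "x \<in> Domain A \<Longrightarrow> y \<in> Domain A \<Longrightarrow> a (x - y) z = a x z - a y z"
  "x \<in> Domain A \<Longrightarrow> y \<in> Domain A \<Longrightarrow> a x y = cnj (a y x)"
  "x \<in> Domain A \<Longrightarrow> 0 \<le> Re (a x x)"
proof -
  show "a x y = cnj (a y x)" if "x \<in> Domain A" "y \<in> Domain A"
    using a_sym[OF that] cinner_commute[of x "app A y"] by simp
qed (simp_all add: app_linear[OF A_op] cinner_simps accretiveD[OF A_acc app_A])

lemma a_cauchy_schwarz:
  assumes "x \<in> Domain A" "y \<in> Domain A"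
  shows "(cmod (a x y))\<^sup>2 \<le> Re (a x x) * Re (a y y)"
  by (rule semi_inner_cauchy_schwarz[OF dom_A _ _ _ _ assms]) (rule a_props; assumption)+

lemma dom_A_diff: "x \<in> Domain A \<Longrightarrow> y \<in> Domain A \<Longrightarrow> x - y \<in> Domain A"
  by (rule complex_subspaceD(5)[OF dom_A])

lemma a_parallelogram:
  assumes "x \<in> Domain A" "y \<in> Domain A"
  shows "Re (a (x + y) (x + y)) \<le> 2 * Re (a x x) + 2 * Re (a y y)"
  using a_props(5)[OF dom_A_diff[OF assms]] assms
  by (simp add: a_props(1,3) cinner_simps)

lemma form_convergesD:
  assumes "form_converges A X u"
  shows "X n \<in> Domain A" "X \<longlonglongrightarrow> u"
    "0 < \<epsilon> \<Longrightarrow> \<exists>N. \<forall>m\<ge>N. \<forall>n\<ge>N. Re (a (X m - X n) (X m - X n)) < \<epsilon>"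
  using assms by (auto simp: form_converges_def)

lemma form_bounded:
  assumes X: "form_converges A X u"
  obtains K where "0 < K" "\<forall>\<^sub>F n in sequentially. Re (a (X n) (X n)) \<le> K"
proof -
  obtain N where N: "\<And>m n. m \<ge> N \<Longrightarrow> n \<ge> N \<Longrightarrow> Re (a (X m - X n) (X m - X n)) < 1"
    using form_convergesD(3)[OF X, of 1] by auto
  let ?K = "2 * Re (a (X N) (X N)) + 2"
  have "Re (a (X n) (X n)) \<le> ?K" if "n \<ge> N" for n
    using a_parallelogram[OF dom_A_diff[OF form_convergesD(1)[OF X, of n] form_convergesD(1)[OF X, of N]] form_convergesD(1)[OF X, of N]]
      N[OF that order_refl] by simp
  then have "\<forall>\<^sub>F n in sequentially. Re (a (X n) (X n)) \<le> ?K" by (auto simp: eventually_sequentially)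
  moreover have "0 < ?K" using a_props(5)[OF form_convergesD(1)[OF X, of N]] by simp
  ultimately show thesis by (intro that) 
qed

text \<open>With \<open>u\<close> in place of \<open>X n\<close> the form would equal \<open>(u, A (Y n)) = (w, Y n)\<close>. The error
  \<open>(u - X n, A (Y n))\<close> is a limit of values \<open>a (X m - X n) (Y n)\<close> and thus small.\<close>

lemma form_limit:
  assumes uw: "(u, w) \<in> adjoint_relation A" and X: "form_converges A X u" and Y: "form_converges A Y v"
  shows "(\<lambda>n. a (X n) (Y n)) \<longlonglongrightarrow> cinner w v"
proof -
  note XA = form_convergesD(1)[OF X] and YA = form_convergesD(1)[OF Y]
  obtain K where K: "0 < K" "\<forall>\<^sub>F n in sequentially. Re (a (Y n) (Y n)) \<le> K" using form_bounded[OF Y] by blast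
  have wY: "cinner w (Y n) = cinner u (app A (Y n))" for n
    using adjoint_relationD[OF uw app_A[OF YA[of n]]] cinner_commute[of w "Y n"] cinner_commute[of u "app A (Y n)"] by simp
  have "(\<lambda>n. a (X n) (Y n) - cinner w (Y n)) \<longlonglongrightarrow> 0"
  proof (rule tendstoI)
    fix e :: real assume e: "0 < e"
    define \<delta> where "\<delta> = (e / 2)\<^sup>2 / K"
    have \<delta>: "0 < \<delta>" using e K by (simp add: \<delta>_def)
    obtain N where N: "\<And>m n. m \<ge> N \<Longrightarrow> n \<ge> N \<Longrightarrow> Re (a (X m - X n) (X m - X n)) < \<delta>"
      using form_convergesD(3)[OF X \<delta>] by blast
    have small: "cmod (a (X n) (Y n) - cinner w (Y n)) \<le> e / 2" if n: "n \<ge> N" and Kn: "Re (a (Y n) (Y n)) \<le> K" for n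
    proof (rule LIMSEQ_le_const2)
      have "(\<lambda>m. cmod (a (X n) (Y n) - cinner (X m) (app A (Y n)))) \<longlonglongrightarrow> cmod (a (X n) (Y n) - cinner u (app A (Y n)))"
        by (intro tendsto_norm tendsto_diff tendsto_const tendsto_cinner form_convergesD(2)[OF X])
      then show "(\<lambda>m. cmod (a (X n) (Y n) - cinner (X m) (app A (Y n)))) \<longlonglongrightarrow> cmod (a (X n) (Y n) - cinner w (Y n))"
        by (simp add: wY)
      show "\<exists>M. \<forall>m\<ge>M. cmod (a (X n) (Y n) - cinner (X m) (app A (Y n))) \<le> e / 2"
      proof (intro exI[of _ N] allI impI)
        fix m assume m: "m \<ge> N"
        have d: "X n - X m \<in> Domain A" by (rule dom_A_diff[OF XA XA])
        have "a (X n) (Y n) - cinner (X m) (app A (Y n)) = a (X n - X m) (Y n)"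
          using a_sym[OF XA[of m] YA[of n]] by (simp add: a_props(3)[OF XA XA])
        moreover have "(cmod (a (X n - X m) (Y n)))\<^sup>2 \<le> \<delta> * K"
          using order_trans[OF a_cauchy_schwarz[OF d YA[of n]] mult_mono[OF less_imp_le[OF N[OF n m]] Kn]]
            a_props(5)[OF YA[of n]] \<delta> by simp
        then have "(cmod (a (X n - X m) (Y n)))\<^sup>2 \<le> (e / 2)\<^sup>2" using K by (simp add: \<delta>_def)
        then have "cmod (a (X n - X m) (Y n)) \<le> e / 2" by (rule power2_le_imp_le) (use e in simp)
        ultimately show "cmod (a (X n) (Y n) - cinner (X m) (app A (Y n))) \<le> e / 2" by simp
      qed
    qed
    have "\<forall>\<^sub>F n in sequentially. cmod (a (X n) (Y n) - cinner w (Y n)) \<le> e / 2"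
      using K(2) eventually_ge_at_top[of N] by eventually_elim (use small in blast)
    then show "\<forall>\<^sub>F n in sequentially. dist (a (X n) (Y n) - cinner w (Y n)) 0 < e"
      by eventually_elim (use e in simp)
  qed
  moreover have "(\<lambda>n. cinner w (Y n)) \<longlonglongrightarrow> cinner w v"
    by (intro tendsto_cinner tendsto_const form_convergesD(2)[OF Y])
  ultimately have "(\<lambda>n. a (X n) (Y n) - cinner w (Y n) + cinner w (Y n)) \<longlonglongrightarrow> 0 + cinner w v" by (rule tendsto_add)
  then show ?thesis by simp
qed

text \<open>The Friedrichs extension, described as a restriction of the adjoint. In this form its
  selfadjointness can be proved first; its square root then shows that the limits defining the
  closed form exist (\<open>closed_form_eq\<close>), and that both descriptions agree (\<open>friedrichs_eq\<close>).\<close>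

definition AF where "AF = {(u, w) \<in> adjoint_relation A. u \<in> closed_form_domain A}"

lemma AF_iff: "(u, w) \<in> AF \<longleftrightarrow> (u, w) \<in> adjoint_relation A \<and> (\<exists>X. form_converges A X u)"
  by (simp add: AF_def closed_form_domain_def)

lemma A_subset_AF: "A \<subseteq> AF"
proof (rule subrelI)
  fix u w assume uw: "(u, w) \<in> A"
  have "app A 0 = 0" by (rule app_eq[OF A_op linear_relationD(1)[OF A_rel]])
  then have "form_converges A (\<lambda>_. u) u" using uw by (auto simp: form_converges_def)
  then show "(u, w) \<in> AF" using uw A_subset_adjoint by (auto simp: AF_iff)
qed

lemma form_converges_add:
  assumes X: "form_converges A X u" and Y: "form_converges A Y v"
  shows "form_converges A (\<lambda>n. X n + Y n) (u + v)"
  unfolding form_converges_def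
proof (intro conjI allI impI)
  note XA = form_convergesD(1)[OF X] and YA = form_convergesD(1)[OF Y]
  show "X n + Y n \<in> Domain A" for n by (rule complex_subspaceD(2)[OF dom_A XA YA])
  show "(\<lambda>n. X n + Y n) \<longlonglongrightarrow> u + v" by (rule tendsto_add[OF form_convergesD(2)[OF X] form_convergesD(2)[OF Y]])
  fix \<epsilon> :: real assume e: "0 < \<epsilon>"
  obtain N where N: "\<And>m n. m \<ge> N \<Longrightarrow> n \<ge> N \<Longrightarrow> Re (a (X m - X n) (X m - X n)) < \<epsilon> / 4"
    using form_convergesD(3)[OF X, of "\<epsilon> / 4"] e by auto
  obtain N' where N': "\<And>m n. m \<ge> N' \<Longrightarrow> n \<ge> N' \<Longrightarrow> Re (a (Y m - Y n) (Y m - Y n)) < \<epsilon> / 4"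
    using form_convergesD(3)[OF Y, of "\<epsilon> / 4"] e by auto
  have "Re (a (X m + Y m - (X n + Y n)) (X m + Y m - (X n + Y n))) < \<epsilon>" if "m \<ge> max N N'" "n \<ge> max N N'" for m n
  proof -
    have eq: "X m + Y m - (X n + Y n) = (X m - X n) + (Y m - Y n)" by simp
    show ?thesis unfolding eq
      using a_parallelogram[OF dom_A_diff[OF XA[of m] XA[of n]] dom_A_diff[OF YA[of m] YA[of n]]]
        N[of m n] N'[of m n] that by simp
  qed
  then show "\<exists>N. \<forall>m\<ge>N. \<forall>n\<ge>N. Re (a (X m + Y m - (X n + Y n)) (X m + Y m - (X n + Y n))) < \<epsilon>" by blast
qed

lemma form_converges_scaleC:
  assumes X: "form_converges A X u"
  shows "form_converges A (\<lambda>n. c *\<^sub>C X n) (c *\<^sub>C u)"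
  unfolding form_converges_def
proof (intro conjI allI impI)
  note XA = form_convergesD(1)[OF X]
  show "c *\<^sub>C X n \<in> Domain A" for n by (rule complex_subspaceD(3)[OF dom_A XA])
  show "(\<lambda>n. c *\<^sub>C X n) \<longlonglongrightarrow> c *\<^sub>C u" by (rule tendsto_scaleC[OF form_convergesD(2)[OF X]])
  fix \<epsilon> :: real assume e: "0 < \<epsilon>"
  define k where "k = (cmod c)\<^sup>2 + 1"
  have k: "0 < k" by (simp add: k_def add_nonneg_pos)
  obtain N where N: "\<And>m n. m \<ge> N \<Longrightarrow> n \<ge> N \<Longrightarrow> Re (a (X m - X n) (X m - X n)) < \<epsilon> / k"
    using form_convergesD(3)[OF X, of "\<epsilon> / k"] e k by auto
  have "Re (a (c *\<^sub>C X m - c *\<^sub>C X n) (c *\<^sub>C X m - c *\<^sub>C X n)) < \<epsilon>" if "m \<ge> N" "n \<ge> N" for m n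
  proof -
    let ?r = "Re (a (X m - X n) (X m - X n))"
    have d: "X m - X n \<in> Domain A" by (rule dom_A_diff[OF XA XA])
    have "a (c *\<^sub>C X m - c *\<^sub>C X n) (c *\<^sub>C X m - c *\<^sub>C X n) = complex_of_real ((cmod c)\<^sup>2) * a (X m - X n) (X m - X n)"
      unfolding scaleC_diff_right[symmetric] a_props(2)[OF d] cinner_scaleC_right complex_norm_square by simp
    then have "Re (a (c *\<^sub>C X m - c *\<^sub>C X n) (c *\<^sub>C X m - c *\<^sub>C X n)) = (cmod c)\<^sup>2 * ?r"
      by (simp del: of_real_power)
    also have "\<dots> \<le> k * ?r" using a_props(5)[OF d] by (intro mult_right_mono) (simp_all add: k_def)
    also have "\<dots> < \<epsilon>" using N[OF that] k by (simp add: less_divide_eq mult.commute)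
    finally show ?thesis .
  qed
  then show "\<exists>N. \<forall>m\<ge>N. \<forall>n\<ge>N. Re (a (c *\<^sub>C X m - c *\<^sub>C X n) (c *\<^sub>C X m - c *\<^sub>C X n)) < \<epsilon>" by blast
qed

text \<open>A sequence representing \<open>f\<close> for the inner product \<open>a x y + (x, y)\<close> converges in the sense of the form,
  and its limit \<open>u\<close> satisfies \<open>(1 + A\<^sup>*) u = f\<close>.\<close>

lemma AF_surjective: "\<exists>u. (u, f - u) \<in> AF"
proof (rule riesz_sequence[OF dom_A, of "\<lambda>x y. a x y + cinner x y" "cinner f" "(norm f)\<^sup>2"])
  show "a x y + cinner x y = cnj (a y x + cinner y x)" if "x \<in> Domain A" "y \<in> Domain A" for x y
    using a_props(4)[OF that] cinner_commute[of x y] by simp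
  show "(cmod (cinner f v))\<^sup>2 \<le> (norm f)\<^sup>2 * Re (a v v + cinner v v)" if "v \<in> Domain A" for v
  proof -
    have "(cmod (cinner f v))\<^sup>2 \<le> (norm f)\<^sup>2 * (norm v)\<^sup>2"
      using power_mono[OF cauchy_schwarz norm_ge_zero, of f v 2] by (simp add: power_mult_distrib)
    also have "\<dots> \<le> (norm f)\<^sup>2 * Re (a v v + cinner v v)"
      using a_props(5)[OF that] by (intro mult_left_mono) (simp_all add: Re_cinner_self)
    finally show ?thesis .
  qed
next
  fix X :: "nat \<Rightarrow> 'a"
  assume XA: "\<And>n. X n \<in> Domain A"
    and XC: "\<And>\<epsilon>. 0 < \<epsilon> \<Longrightarrow> \<exists>N. \<forall>m\<ge>N. \<forall>n\<ge>N. Re (a (X m - X n) (X m - X n) + cinner (X m - X n) (X m - X n)) < \<epsilon>"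
    and Xl: "\<And>v. v \<in> Domain A \<Longrightarrow> (\<lambda>n. a (X n) v + cinner (X n) v) \<longlonglongrightarrow> cinner f v"
  have split: "Re (a (X m - X n) (X m - X n) + cinner (X m - X n) (X m - X n))
      = Re (a (X m - X n) (X m - X n)) + (norm (X m - X n))\<^sup>2" for m n by (simp add: Re_cinner_self)
  have ge: "0 \<le> Re (a (X m - X n) (X m - X n))" for m n by (rule a_props(5)[OF dom_A_diff[OF XA XA]])
  have "Cauchy X"
  proof (rule Cauchy_norm_squared)
    fix \<epsilon> :: real assume "0 < \<epsilon>"
    then obtain N where N: "\<forall>m\<ge>N. \<forall>n\<ge>N. Re (a (X m - X n) (X m - X n)) + (norm (X m - X n))\<^sup>2 < \<epsilon>"
      using XC unfolding split by blast
    show "\<exists>N. \<forall>m\<ge>N. \<forall>n\<ge>N. (norm (X m - X n))\<^sup>2 < \<epsilon>"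
    proof (intro exI allI impI)
      fix m n assume "m \<ge> N" "n \<ge> N"
      then have "Re (a (X m - X n) (X m - X n)) + (norm (X m - X n))\<^sup>2 < \<epsilon>" using N by blast
      then show "(norm (X m - X n))\<^sup>2 < \<epsilon>" using ge[of m n] by linarith
    qed
  qed
  then obtain u where u: "X \<longlonglongrightarrow> u" using Cauchy_convergent convergent_def by blast
  have "form_converges A X u" unfolding form_converges_def
  proof (intro conjI allI impI XA u)
    fix \<epsilon> :: real assume "0 < \<epsilon>"
    then obtain N where N: "\<forall>m\<ge>N. \<forall>n\<ge>N. Re (a (X m - X n) (X m - X n)) + (norm (X m - X n))\<^sup>2 < \<epsilon>"
      using XC unfolding split by blast
    show "\<exists>N. \<forall>m\<ge>N. \<forall>n\<ge>N. Re (a (X m - X n) (X m - X n)) < \<epsilon>"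
    proof (intro exI allI impI)
      fix m n assume "m \<ge> N" "n \<ge> N"
      then have "Re (a (X m - X n) (X m - X n)) + (norm (X m - X n))\<^sup>2 < \<epsilon>" using N by blast
      then show "Re (a (X m - X n) (X m - X n)) < \<epsilon>"
        using zero_le_power2[of "norm (X m - X n)"] by linarith
    qed
  qed
  moreover have "(u, f - u) \<in> adjoint_relation A"
  proof (rule adjoint_relationI)
    fix x y assume xy: "(x, y) \<in> A"
    have x: "x \<in> Domain A" using xy by blast
    have "a (X n) x = cinner (X n) y" for n using a_sym[OF XA x] by (simp add: app_eq[OF A_op xy])
    then have "(\<lambda>n. cinner (X n) y + cinner (X n) x) \<longlonglongrightarrow> cinner f x" using Xl[OF x] by simp
    moreover have "(\<lambda>n. cinner (X n) y + cinner (X n) x) \<longlonglongrightarrow> cinner u y + cinner u x"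
      by (intro tendsto_add tendsto_cinner tendsto_const u)
    ultimately have "cinner f x = cinner u y + cinner u x" by (rule LIMSEQ_unique)
    then have "cinner u y = cinner (f - u) x" by (simp add: cinner_diff_left)
    then show "cinner y u = cinner x (f - u)"
      using cinner_commute[of y u] cinner_commute[of x "f - u"] by simp
  qed
  ultimately show "\<exists>u. (u, f - u) \<in> AF" by (auto simp: AF_iff)
qed (simp_all add: a_props(1,2,5) cinner_simps distrib_left)

lemma AF_selfadjoint: "nonneg_selfadjoint AF"
proof (rule nonneg_selfadjointI[OF _ _ _ _ AF_surjective])
  have "linear_relation AF" unfolding linear_relation_def
  proof (intro conjI allI impI)
    show "(0, 0) \<in> AF" using A_subset_AF linear_relationD(1)[OF A_rel] by blast
    fix u w assume 1: "(u, w) \<in> AF"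
    show "(c *\<^sub>C u, c *\<^sub>C w) \<in> AF" for c
      using 1 linear_relationD(3)[OF linear_relation_adjoint] form_converges_scaleC unfolding AF_iff by blast
    fix u' w' assume 2: "(u', w') \<in> AF"
    show "(u + u', w + w') \<in> AF"
      using 1 2 linear_relationD(2)[OF linear_relation_adjoint] form_converges_add unfolding AF_iff by blast
  qed
  then show "linear_operator AF"
    by (rule linear_operatorI)
      (use linear_operator_unique[OF adj_op _ linear_relationD(1)[OF linear_relation_adjoint]] in \<open>auto simp: AF_iff\<close>)
  show "closure (Domain AF) = UNIV" using dense_A closure_mono[OF Domain_mono[OF A_subset_AF]] by auto
  show "cinner w u' = cinner u w'" if uw: "(u, w) \<in> AF" "(u', w') \<in> AF" for u w u' w'
  proof -
    obtain X Y where X: "form_converges A X u" and Y: "form_converges A Y u'" using uw unfolding AF_iff by blast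
    have "(\<lambda>n. cnj (a (Y n) (X n))) \<longlonglongrightarrow> cnj (cinner w' u)"
      by (intro tendsto_cnj form_limit[OF _ Y X]) (use uw in \<open>simp add: AF_iff\<close>)
    moreover have "cnj (a (Y n) (X n)) = a (X n) (Y n)" for n
      using a_props(4)[OF form_convergesD(1)[OF X] form_convergesD(1)[OF Y]] by simp
    ultimately have "(\<lambda>n. a (X n) (Y n)) \<longlonglongrightarrow> cinner u w'"
      using cinner_commute[of u w'] by simp
    moreover have "(\<lambda>n. a (X n) (Y n)) \<longlonglongrightarrow> cinner w u'"
      by (rule form_limit[OF _ X Y]) (use uw in \<open>simp add: AF_iff\<close>)
    ultimately show ?thesis using LIMSEQ_unique by blast
  qed
  show "accretive AF" unfolding accretive_def
  proof clarify
    fix u w assume uw: "(u, w) \<in> AF"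
    then obtain X where X: "form_converges A X u" unfolding AF_iff by blast
    have "(\<lambda>n. Re (a (X n) (X n))) \<longlonglongrightarrow> Re (cinner w u)"
      by (intro tendsto_Re form_limit[OF _ X X]) (use uw in \<open>simp add: AF_iff\<close>)
    then show "0 \<le> Re (cinner w u)"
      by (rule LIMSEQ_le_const) (use a_props(5)[OF form_convergesD(1)[OF X]] in blast)
  qed
qed

subsection \<open>The square root and the form domain\<close>

definition B where "B = op_sqrt_in UNIV AF"

lemma B: "nonneg_selfadjoint B" and BB: "B O B = AF"
  unfolding B_def using op_sqrt_in_UNIV[OF AF_selfadjoint] by blast+

lemmas BD = nonneg_selfadjointD[OF B]

lemma B_on_A:
  assumes "(x, y) \<in> A"
  obtains z where "(x, z) \<in> B" "(z, y) \<in> B"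
  using assms A_subset_AF unfolding BB[symmetric] by blast

lemma a_eq_B:
  assumes "x \<in> Domain A" "(x, y) \<in> B" "(x', y') \<in> B"
  shows "a x x' = cinner y y'"
proof (rule B_on_A[OF app_A[OF assms(1)]])
  fix z assume z: "(x, z) \<in> B" "(z, app A x) \<in> B"
  have "z = y" by (rule linear_operator_unique[OF BD(1) z(1) assms(2)])
  then show ?thesis using BD(7)[OF z(2) assms(3)] by simp
qed

lemma dom_A_in_B: "x \<in> Domain A \<Longrightarrow> (x, app B x) \<in> B"
  using B_on_A[OF app_A] app_in[OF BD(1)] by blast

lemma a_diff_B:
  assumes "x \<in> Domain A" "x' \<in> Domain A"
  shows "Re (a (x - x') (x - x')) = (norm (app B x - app B x'))\<^sup>2"
proof -
  have 1: "(x - x', app B x - app B x') \<in> B"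
    by (rule linear_relationD(4)[OF BD(2) dom_A_in_B[OF assms(1)] dom_A_in_B[OF assms(2)]])
  show ?thesis using a_eq_B[OF dom_A_diff[OF assms] 1 1] by (simp add: Re_cinner_self)
qed

lemma form_converges_B:
  assumes X: "form_converges A X u"
  shows "(u, app B u) \<in> B" "(\<lambda>n. app B (X n)) \<longlonglongrightarrow> app B u"
proof -
  note XA = form_convergesD(1)[OF X]
  have "Cauchy (\<lambda>n. app B (X n))"
    using form_convergesD(3)[OF X] unfolding a_diff_B[OF XA XA] by (rule Cauchy_norm_squared)
  then obtain w where w: "(\<lambda>n. app B (X n)) \<longlonglongrightarrow> w" using Cauchy_convergent convergent_def by blast
  have uw: "(u, w) \<in> B" by (rule closed_relationD[OF BD(6) dom_A_in_B[OF XA] form_convergesD(2)[OF X] w])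
  then show "(u, app B u) \<in> B" by (intro app_in[OF BD(1)]) blast
  show "(\<lambda>n. app B (X n)) \<longlonglongrightarrow> app B u" using w app_eq[OF BD(1) uw] by simp
qed

lemma form_convergesI:
  assumes "\<And>n. X n \<in> Domain A" "X \<longlonglongrightarrow> u" "(\<lambda>n. app B (X n)) \<longlonglongrightarrow> w"
  shows "form_converges A X u"
  unfolding form_converges_def
proof (intro conjI allI impI assms(1,2))
  fix \<epsilon> :: real assume e: "0 < \<epsilon>"
  have "Cauchy (\<lambda>n. app B (X n))" using assms(3) by (rule LIMSEQ_imp_Cauchy)
  then obtain N where N: "\<forall>m\<ge>N. \<forall>n\<ge>N. norm (app B (X m) - app B (X n)) < sqrt \<epsilon>"
    using CauchyD[of _ "sqrt \<epsilon>"] e by (metis real_sqrt_gt_0_iff)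
  have "Re (a (X m - X n) (X m - X n)) < \<epsilon>" if "m \<ge> N" "n \<ge> N" for m n
  proof -
    have "(norm (app B (X m) - app B (X n)))\<^sup>2 < (sqrt \<epsilon>)\<^sup>2"
      using N that by (intro power_strict_mono) auto
    then show ?thesis using e by (simp add: a_diff_B[OF assms(1) assms(1)])
  qed
  then show "\<exists>N. \<forall>m\<ge>N. \<forall>n\<ge>N. Re (a (X m - X n) (X m - X n)) < \<epsilon>" by blast
qed

text \<open>By definition the domain of \<open>AF\<close> lies in the form closure of the domain of \<open>A\<close>, and the domain of \<open>AF\<close> is a
  core of its square root.\<close>

lemma core:
  assumes "(u, w) \<in> B"
  obtains X where "\<And>n::nat. X n \<in> Domain A" "X \<longlonglongrightarrow> u" "(\<lambda>n. app B (X n)) \<longlonglongrightarrow> w"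
proof -
  let ?G = "{(x, y) \<in> B. x \<in> Domain A}"
  have AFG: "(u, w) \<in> closure ?G" if u: "u \<in> Domain AF" "(u, w) \<in> B" for u w
  proof -
    obtain X where X: "form_converges A X u" using u(1) AF_iff by blast
    have "(\<lambda>n. (X n, app B (X n))) \<longlonglongrightarrow> (u, app B u)"
      by (rule tendsto_Pair[OF form_convergesD(2)[OF X] form_converges_B(2)[OF X]])
    moreover have "app B u = w" by (rule app_eq[OF BD(1) u(2)])
    moreover have "(X n, app B (X n)) \<in> ?G" for n
      using dom_A_in_B[OF form_convergesD(1)[OF X]] form_convergesD(1)[OF X] by blast
    ultimately show ?thesis unfolding closure_sequential
      by (intro exI[of _ "\<lambda>n. (X n, app B (X n))"]) simp
  qed
  obtain X W where XW: "\<forall>n::nat. X n \<in> Domain AF \<and> (X n, W n) \<in> B" "X \<longlonglongrightarrow> u" "W \<longlonglongrightarrow> w"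
    using op_sqrt_in_UNIV(4)[OF AF_selfadjoint] assms unfolding B_def by blast
  have "(u, w) \<in> closure ?G"
    by (rule closed_relationD[OF closed_closure _ XW(2,3)]) (use XW(1) AFG in blast)
  then obtain Z where Z: "\<forall>n. Z n \<in> ?G" "Z \<longlonglongrightarrow> (u, w)" unfolding closure_sequential by blast
  have Zn: "(fst (Z n), snd (Z n)) \<in> B" "fst (Z n) \<in> Domain A" for n using Z(1)[rule_format, of n] by auto
  have "app B (fst (Z n)) = snd (Z n)" for n by (rule app_eq[OF BD(1) Zn(1)])
  then show thesis
    using that[of "\<lambda>n. fst (Z n)"] Zn(2) tendsto_fst[OF Z(2)] tendsto_snd[OF Z(2)] by simp
qed

lemma closed_form_domain_eq: "closed_form_domain A = Domain B"
proof (intro equalityI subsetI)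
  fix u assume "u \<in> closed_form_domain A"
  then show "u \<in> Domain B" using form_converges_B(1) unfolding closed_form_domain_def by blast
next
  fix u assume "u \<in> Domain B"
  then obtain w where uw: "(u, w) \<in> B" by blast
  show "u \<in> closed_form_domain A"
  proof (rule core[OF uw])
    fix X assume "\<And>n::nat. X n \<in> Domain A" "X \<longlonglongrightarrow> u" "(\<lambda>n. app B (X n)) \<longlonglongrightarrow> w"
    then have "form_converges A X u" by (rule form_convergesI)
    then show ?thesis by (auto simp: closed_form_domain_def)
  qed
qed

lemma closed_form_eq:
  assumes "u \<in> Domain B" "v \<in> Domain B"
  shows "closed_form A u v = cinner (app B u) (app B v)"
  unfolding closed_form_def
proof (rule the_equality)
  show lim: "\<forall>X Y. form_converges A X u \<longrightarrow> form_converges A Y v \<longrightarrow>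
      (\<lambda>n. a (X n) (Y n)) \<longlonglongrightarrow> cinner (app B u) (app B v)"
  proof (intro allI impI)
    fix X Y assume X: "form_converges A X u" and Y: "form_converges A Y v"
    have "(\<lambda>n. cinner (app B (X n)) (app B (Y n))) \<longlonglongrightarrow> cinner (app B u) (app B v)"
      by (rule tendsto_cinner[OF form_converges_B(2)[OF X] form_converges_B(2)[OF Y]])
    moreover have "a (X n) (Y n) = cinner (app B (X n)) (app B (Y n))" for n
      by (rule a_eq_B) (intro dom_A_in_B form_convergesD(1)[OF X] form_convergesD(1)[OF Y])+
    ultimately show "(\<lambda>n. a (X n) (Y n)) \<longlonglongrightarrow> cinner (app B u) (app B v)" by simp
  qed
  fix c
  assume c: "\<forall>X Y. form_converges A X u \<longrightarrow> form_converges A Y v \<longrightarrow> (\<lambda>n. a (X n) (Y n)) \<longlonglongrightarrow> c"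
  obtain X Y where "form_converges A X u" "form_converges A Y v"
    using assms unfolding closed_form_domain_eq[symmetric] closed_form_domain_def by blast
  then show "c = cinner (app B u) (app B v)" using lim c LIMSEQ_unique by blast
qed

lemma friedrichs_eq: "friedrichs A = AF"
proof (intro equalityI subrelI)
  fix u w assume "(u, w) \<in> friedrichs A"
  then have u: "u \<in> Domain B" and c: "\<And>v. v \<in> Domain B \<Longrightarrow> closed_form A u v = cinner w v"
    by (auto simp: friedrichs_def closed_form_domain_eq)
  have "(app B u, w) \<in> adjoint_relation B"
  proof (rule adjoint_relationI)
    fix x y assume xy: "(x, y) \<in> B"
    have "cinner (app B u) y = cinner w x"
      using c[of x] closed_form_eq[OF u, of x] xy by (auto simp: app_eq[OF BD(1) xy])
    then show "cinner y (app B u) = cinner x w"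
      using cinner_commute[of y "app B u"] cinner_commute[of x w] by simp
  qed
  then show "(u, w) \<in> AF" using app_in[OF BD(1) u] unfolding BB[symmetric] BD(4) by blast
next
  fix u w assume "(u, w) \<in> AF"
  then obtain z where z: "(u, z) \<in> B" "(z, w) \<in> B" unfolding BB[symmetric] by blast
  have u: "u \<in> Domain B" using z by blast
  have "closed_form A u v = cinner w v" if v: "v \<in> Domain B" for v
    using closed_form_eq[OF u v] BD(7)[OF z(2) app_in[OF BD(1) v]] by (simp add: app_eq[OF BD(1) z(1)])
  then show "(u, w) \<in> friedrichs A" using u by (simp add: friedrichs_def closed_form_domain_eq)
qed

lemma sqrtF_eq: "sqrtF A = B" by (simp add: friedrichs_eq B_def)

lemma formD_eq: "formD A = Domain B" by (simp add: formD_def sqrtF_eq)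

lemma friedrichs_iff: "(u, w) \<in> friedrichs A \<longleftrightarrow> (u, w) \<in> adjoint_relation A \<and> u \<in> formD A"
  by (simp add: friedrichs_eq AF_def formD_eq closed_form_domain_eq)

lemma inv_sqrt_hat_eq: "inv_sqrt_hat A = {(x, y) \<in> B. x \<in> closure (Range AF)}\<inverse>"
proof -
  interpret S: selfadjoint_sqrt AF "op_sqrt_in UNIV AF" "closure (Range AF)"
    by unfold_locales (simp_all add: AF_selfadjoint)
  show ?thesis
    using S.op_sqrt_part by (simp add: inv_sqrt_hat_def friedrichs_hat_def ranF_def friedrichs_eq B_def)
qed

lemma inv_sqrt_hat_bound:
  "f \<in> Range B \<and> (norm (app (inv_sqrt_hat A) f))\<^sup>2 \<le> c \<longleftrightarrow>
    (\<forall>(v, w) \<in> B. 0 \<le> c + (norm w)\<^sup>2 + 2 * Im (cinner v f))"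
proof -
  interpret S: selfadjoint_sqrt AF "op_sqrt_in UNIV AF" "closure (Range AF)"
    by unfold_locales (simp_all add: AF_selfadjoint)
  show ?thesis using S.inverse_sqrt_bound[of f c] by (simp add: inv_sqrt_hat_eq B_def)
qed

end


section \<open>Boundary pairs\<close>

lemma bounded_everywhere_definedD:
  assumes "bounded_everywhere_defined T"
  shows "linear_operator T" "(x, app T x) \<in> T" "bounded_clinear (app T)"
proof -
  show op: "linear_operator T" using assms by (simp add: bounded_everywhere_defined_def)
  have dom: "Domain T = UNIV" using assms by (simp add: bounded_everywhere_defined_def)
  show ap: "(x, app T x) \<in> T" for x by (rule app_in[OF op]) (simp add: dom)
  obtain C where C: "\<forall>(x, y) \<in> T. norm y \<le> C * norm x"
    using assms by (auto simp: bounded_everywhere_defined_def)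
  have "norm (app T x) \<le> C * norm x" for x using bspec[OF C ap[of x]] by simp
  then show "bounded_clinear (app T)"
    by (intro bounded_clinearI[of _ C]) (simp_all add: app_linear[OF op] dom)
qed

text \<open>Since \<open>K\<close> is bounded below, \<open>(h, e)\<close> is a bounded functional of \<open>e\<close> for the inner product
  \<open>(K e, K e')\<close>. Along a representing sequence \<open>K (X n)\<close> converges to a preimage of \<open>h\<close>.\<close>

lemma adjoint_surjective:
  fixes K :: "'a::complex_hilbert \<Rightarrow> 'b::complex_hilbert"
  assumes K: "bounded_clinear K" and C: "0 \<le> C" "\<And>e. norm e \<le> C * norm (K e)"
  obtains x where "bounded_adjoint K x = h" "norm x \<le> C * norm h"
proof -
  note Kl = bounded_clinearD[OF K]
  have "\<exists>x. bounded_adjoint K x = h \<and> norm x \<le> C * norm h"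
  proof (rule riesz_sequence[OF complex_subspace_UNIV, of "\<lambda>e e'. cinner (K e) (K e')" "cinner h" "(C * norm h)\<^sup>2"])
    show "cinner (K x) (K y) = cnj (cinner (K y) (K x))" for x y by (rule cinner_commute)
    show "(cmod (cinner h e))\<^sup>2 \<le> (C * norm h)\<^sup>2 * Re (cinner (K e) (K e))" for e
    proof -
      have "cmod (cinner h e) \<le> norm h * (C * norm (K e))"
        using order_trans[OF cauchy_schwarz mult_left_mono[OF C(2) norm_ge_zero]] .
      then have "(cmod (cinner h e))\<^sup>2 \<le> (norm h * (C * norm (K e)))\<^sup>2" by (rule power_mono) simp
      then show ?thesis by (simp add: Re_cinner_self power_mult_distrib mult_ac)
    qed
  next
    fix X :: "nat \<Rightarrow> 'a"
    assume X: "\<And>\<epsilon>. 0 < \<epsilon> \<Longrightarrow> \<exists>N. \<forall>m\<ge>N. \<forall>n\<ge>N. Re (cinner (K (X m - X n)) (K (X m - X n))) < \<epsilon>"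
      "\<And>e. e \<in> UNIV \<Longrightarrow> (\<lambda>n. cinner (K (X n)) (K e)) \<longlonglongrightarrow> cinner h e"
    have "Cauchy (\<lambda>n. K (X n))" using X(1) unfolding Re_cinner_self Kl(5) by (rule Cauchy_norm_squared)
    then obtain x where x: "(\<lambda>n. K (X n)) \<longlonglongrightarrow> x" using Cauchy_convergent convergent_def by blast
    have xe: "cinner x (K e) = cinner h e" for e
      using LIMSEQ_unique[OF tendsto_cinner[OF x tendsto_const] X(2)] by simp
    have 1: "bounded_adjoint K x = h"
    proof (rule cinner_eqI)
      fix e
      have "cinner e (bounded_adjoint K x) = cinner (K e) x" by (rule cinner_bounded_adjoint[OF K, symmetric])
      then show "cinner (bounded_adjoint K x) e = cinner h e"
        using cinner_commute[of "bounded_adjoint K x" e] cinner_commute[of x "K e"] xe[of e] by simp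
    qed
    have "Re (cinner x (K (X n))) \<le> norm h * C * norm (K (X n))" for n
    proof -
      have "Re (cinner x (K (X n))) \<le> norm h * norm (X n)"
        using order_trans[OF complex_Re_le_cmod cauchy_schwarz] unfolding xe .
      also have "\<dots> \<le> norm h * (C * norm (K (X n)))" by (intro mult_left_mono C) auto
      finally show ?thesis by simp
    qed
    moreover have "(\<lambda>n. Re (cinner x (K (X n)))) \<longlonglongrightarrow> Re (cinner x x)"
      by (intro tendsto_Re tendsto_cinner tendsto_const x)
    moreover have "(\<lambda>n. norm h * C * norm (K (X n))) \<longlonglongrightarrow> norm h * C * norm x"
      by (intro tendsto_mult tendsto_const tendsto_norm x)
    ultimately have "Re (cinner x x) \<le> norm h * C * norm x" by (intro LIMSEQ_le) auto
    then have "norm x * norm x \<le> norm x * (C * norm h)" by (simp add: Re_cinner_self power2_eq_square mult_ac)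
    then have "norm x \<le> C * norm h" using C(1) by (cases "x = 0") auto
    then show ?thesis using 1 by blast
  qed (simp_all add: Kl cinner_simps)
  then show thesis using that by blast
qed

locale boundary_setting = dense_nonnegative_operator A
  for A :: "('a::complex_hilbert \<times> 'a) set" +
  fixes \<Gamma> :: "'a \<Rightarrow> 'h::complex_hilbert"
  assumes bp: "boundary_pair A \<Gamma>"
begin

abbreviation "D \<equiv> formD A"
abbreviation "F \<equiv> friedrichs A"
abbreviation "adj \<equiv> adjoint_relation A"
abbreviation "N \<equiv> defect A"
abbreviation "\<gamma> \<equiv> gammaf A \<Gamma>"
abbreviation "\<gamma>adj \<equiv> gamma_adj A \<Gamma>"
abbreviation "\<rho> \<equiv> resolvent_set F"

definition R :: "complex \<Rightarrow> 'a \<Rightarrow> 'a" where "R z = app (resolvent F z)"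

lemma F_sa: "nonneg_selfadjoint F" by (simp add: friedrichs_eq AF_selfadjoint)

lemmas FD = nonneg_selfadjointD[OF F_sa]
lemmas adjD = linear_relationD[OF linear_relation_adjoint[of A]]

lemma F_subset_adj: "(u, w) \<in> F \<Longrightarrow> (u, w) \<in> adj" by (simp add: friedrichs_iff)

lemma Domain_F_D: "(u, w) \<in> F \<Longrightarrow> u \<in> D" by (simp add: friedrichs_iff)

lemma A_subset_F: "A \<subseteq> F" by (simp add: friedrichs_eq A_subset_AF)

lemma D_subspace: "complex_subspace D" by (simp add: formD_eq complex_subspace_Domain[OF BD(2)])

lemma N_iff: "n \<in> N z \<longleftrightarrow> (n, z *\<^sub>C n) \<in> adj" by (simp add: defect_def)

lemma N_subspace: "complex_subspace (N z)"
  unfolding complex_subspace_def N_iff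
proof (intro conjI ballI allI)
  show "(0, z *\<^sub>C 0) \<in> adj" using adjD(1) by simp
  fix x assume "x \<in> N z"
  then have x: "(x, z *\<^sub>C x) \<in> adj" by (simp add: N_iff)
  show "(c *\<^sub>C x, z *\<^sub>C c *\<^sub>C x) \<in> adj" for c
    using adjD(3)[OF x, of c] by (simp add: scaleC_scaleC mult.commute)
  show "(x + y, z *\<^sub>C (x + y)) \<in> adj" if "y \<in> N z" for y
    using adjD(2)[OF x, of y "z *\<^sub>C y"] that by (simp add: N_iff scaleC_add_right)
qed

lemma N_closed: "closed (N z)"
  unfolding closed_sequential_limits
proof (intro allI impI, elim conjE)
  fix X u assume X: "\<forall>n. X n \<in> N z" "X \<longlonglongrightarrow> u"
  have "(u, z *\<^sub>C u) \<in> adj"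
    by (rule closed_relationD[OF closed_adjoint _ X(2) tendsto_scaleC[OF X(2)]]) (use X(1) N_iff in blast)
  then show "u \<in> N z" by (simp add: N_iff)
qed

subsection \<open>The resolvent of the Friedrichs extension\<close>

lemma R:
  assumes z: "z \<in> \<rho>"
  shows "(R z f, f + z *\<^sub>C R z f) \<in> F" "(u, w) \<in> F \<Longrightarrow> R z (w - z *\<^sub>C u) = u" "bounded_clinear (R z)"
    "R z f \<in> D"
proof -
  have b: "bounded_everywhere_defined (resolvent F z)" using z by (simp add: resolvent_set_def)
  show 1: "(R z f, f + z *\<^sub>C R z f) \<in> F" using bounded_everywhere_definedD(2)[OF b, of f] by (simp add: R_def)
  show "R z (w - z *\<^sub>C u) = u" if "(u, w) \<in> F"
    unfolding R_def by (rule app_eq[OF bounded_everywhere_definedD(1)[OF b]]) (use that in simp)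
  show "bounded_clinear (R z)" unfolding R_def by (rule bounded_everywhere_definedD(3)[OF b])
  show "R z f \<in> D" using 1 by (rule Domain_F_D)
qed

text \<open>The form of a selfadjoint operator is real, so the imaginary part of \<open>z\<close> contributes
  orthogonally. In particular the norm is the same for \<open>z\<close> and its conjugate.\<close>

lemma shifted_norm:
  assumes "(u, w) \<in> F"
  shows "(norm (w - z *\<^sub>C u))\<^sup>2 = (norm (w - complex_of_real (Re z) *\<^sub>C u))\<^sup>2 + (Im z * norm u)\<^sup>2"
proof -
  let ?v = "w - complex_of_real (Re z) *\<^sub>C u"
  have "z *\<^sub>C u = complex_of_real (Re z) *\<^sub>C u + (\<i> * complex_of_real (Im z)) *\<^sub>C u"
    by (metis complex_eq scaleC_add_left)
  then have eq: "w - z *\<^sub>C u = ?v - (\<i> * complex_of_real (Im z)) *\<^sub>C u" by simp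
  have "cinner w u = cinner u w" by (rule FD(7)[OF assms assms])
  then have "Im (cinner w u) = 0" using Im_cinner_commute[of w u] by simp
  then have "Re (cinner ?v ((\<i> * complex_of_real (Im z)) *\<^sub>C u)) = 0"
    by (simp add: cinner_simps cinner_norm del: of_real_power)
  then show ?thesis unfolding eq norm_diff_squared by (simp add: norm_mult power_mult_distrib)
qed

lemma in_resolvent_set:
  assumes c: "0 < c" "\<And>u w. (u, w) \<in> F \<Longrightarrow> c * norm u \<le> norm (w - z *\<^sub>C u)"
  shows "z \<in> \<rho>"
proof -
  have norm_cnj: "norm (w - cnj z *\<^sub>C u) = norm (w - z *\<^sub>C u)" if "(u, w) \<in> F" for u w
    using shifted_norm[OF that, of z] shifted_norm[OF that, of "cnj z"]
    by (simp add: power_mult_distrib flip: power2_eq_iff_nonneg[OF norm_ge_zero norm_ge_zero])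
  have sh: "c * norm u \<le> norm y" if "(u, y) \<in> shift F z" for u y
    using c(2)[of u "y + z *\<^sub>C u"] that by simp
  have ran: "Range (shift F z) = UNIV"
  proof (rule Range_UNIV_if_bounded_below[OF linear_relation_shift[OF FD(2)] closed_shift[OF FD(6)] c(1) sh])
    fix v assume v: "\<And>x y. (x, y) \<in> shift F z \<Longrightarrow> cinner v y = 0"
    have "(v, cnj z *\<^sub>C v) \<in> adjoint_relation F"
    proof (rule adjoint_relationI)
      fix x y assume "(x, y) \<in> F"
      then have "cinner v (y - z *\<^sub>C x) = 0" by (intro v[of x]) simp
      then have "cinner (y - z *\<^sub>C x) v = 0" using cinner_commute[of "y - z *\<^sub>C x" v] by simp
      then show "cinner y v = cinner x (cnj z *\<^sub>C v)" by (simp add: cinner_simps)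
    qed
    then have "(v, cnj z *\<^sub>C v) \<in> F" by (simp add: FD(4))
    then have "c * norm v \<le> 0" using c(2) norm_cnj by fastforce
    then show "v = 0" using c(1) by (simp add: mult_le_0_iff)
  qed
  have lin: "linear_relation (resolvent F z)"
    unfolding resolvent_def by (rule linear_relation_converse[OF linear_relation_shift[OF FD(2)]])
  have "linear_operator (resolvent F z)"
  proof (rule linear_operatorI[OF lin])
    fix y assume "(0, y) \<in> resolvent F z"
    then have "c * norm y \<le> norm (0 :: 'a)" by (intro sh) simp
    then show "y = 0" using c(1) by (simp add: mult_le_0_iff)
  qed
  moreover have "Domain (resolvent F z) = UNIV" using ran by (simp add: resolvent_def)
  moreover have "norm y \<le> (1 / c) * norm x" if "(x, y) \<in> resolvent F z" for x y
    using sh[of y x] that c(1) by (simp add: field_simps)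
  ultimately show ?thesis unfolding resolvent_set_def bounded_everywhere_defined_def by blast
qed

lemma resolvent_cnj:
  assumes z: "z \<in> \<rho>" shows "cnj z \<in> \<rho>"
proof -
  obtain C where C: "0 < C" "\<And>x. norm (R z x) \<le> C * norm x" using bounded_clinear_bound[OF R(3)[OF z]] by blast
  show ?thesis
  proof (rule in_resolvent_set[of "1 / C"])
    fix u w assume uw: "(u, w) \<in> F"
    have "norm u \<le> C * norm (w - z *\<^sub>C u)" using C(2)[of "w - z *\<^sub>C u"] by (simp add: R(2)[OF z uw])
    moreover have "norm (w - cnj z *\<^sub>C u) = norm (w - z *\<^sub>C u)"
      using shifted_norm[OF uw, of z] shifted_norm[OF uw, of "cnj z"]
      by (simp add: power_mult_distrib flip: power2_eq_iff_nonneg[OF norm_ge_zero norm_ge_zero])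
    ultimately show "1 / C * norm u \<le> norm (w - cnj z *\<^sub>C u)" using C(1) by (simp add: field_simps)
  qed (use C in simp)
qed

lemma R_adjoint:
  assumes z: "z \<in> \<rho>"
  shows "cinner x (R (cnj z) y) = cinner (R z x) y"
proof -
  have "cinner (x + z *\<^sub>C R z x) (R (cnj z) y) = cinner (R z x) (y + cnj z *\<^sub>C R (cnj z) y)"
    by (rule FD(7)[OF R(1)[OF z] R(1)[OF resolvent_cnj[OF z]]])
  then show ?thesis by (simp add: cinner_simps)
qed

lemma \<rho>_points: "- 1 \<in> \<rho>" "\<i> \<in> \<rho>" "- \<i> \<in> \<rho>"
proof -
  show "- 1 \<in> \<rho>"
    by (rule in_resolvent_set[of 1]) (use accretive_bounded_below[OF FD(5), of _ _ 1] in auto)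
  show i: "\<i> \<in> \<rho>"
  proof (rule in_resolvent_set[of 1])
    fix u w assume "(u, w) \<in> F"
    from shifted_norm[OF this, of \<i>] have "(norm u)\<^sup>2 \<le> (norm (w - \<i> *\<^sub>C u))\<^sup>2" by simp
    then show "1 * norm u \<le> norm (w - \<i> *\<^sub>C u)" by simp
  qed simp
  show "- \<i> \<in> \<rho>" using resolvent_cnj[OF i] by simp
qed

subsection \<open>Decompositions of the form space\<close>

lemma D_N_trivial:
  assumes z: "z \<in> \<rho>" and n: "n \<in> D" "n \<in> N z"
  shows "n = 0"
proof -
  have "(n, z *\<^sub>C n) \<in> F" using n by (simp add: friedrichs_iff N_iff)
  from R(2)[OF z this] show ?thesis using bounded_clinearD(3)[OF R(3)[OF z]] by simp
qed

lemma N_transfer: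
  assumes z: "z \<in> \<rho>" and n: "n \<in> N w"
  shows "n + (z - w) *\<^sub>C R z n \<in> N z"
proof -
  have "(n + (z - w) *\<^sub>C R z n, w *\<^sub>C n + (z - w) *\<^sub>C (n + z *\<^sub>C R z n)) \<in> adj"
    using adjD(2)[OF _ adjD(3)[OF F_subset_adj[OF R(1)[OF z]]]] n N_iff by blast
  moreover have "w *\<^sub>C n + (z - w) *\<^sub>C (n + z *\<^sub>C R z n) = z *\<^sub>C (n + (z - w) *\<^sub>C R z n)"
    by (simp add: scaleC_add_right scaleC_diff_left scaleC_diff_right scaleC_scaleC algebra_simps)
  ultimately show ?thesis by (simp add: N_iff)
qed

lemma scaled_R_in_D: "z \<in> \<rho> \<Longrightarrow> c *\<^sub>C R z f \<in> D"
  by (rule complex_subspaceD(3)[OF D_subspace R(4)])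

lemma Lspace_decomposition:
  assumes z: "z \<in> \<rho>" and u: "u \<in> Lspace A"
  obtains f n where "f \<in> D" "n \<in> N z" "u = f + n"
proof -
  obtain f n where fn: "f \<in> D" "n \<in> N (- 1)" "u = f + n" using u by (auto simp: Lspace_def)
  show thesis
  proof (rule that[of "f - (z - (- 1)) *\<^sub>C R z n" "n + (z - (- 1)) *\<^sub>C R z n"])
    show "f - (z - (- 1)) *\<^sub>C R z n \<in> D" by (rule complex_subspaceD(5)[OF D_subspace fn(1) scaled_R_in_D[OF z]])
    show "n + (z - (- 1)) *\<^sub>C R z n \<in> N z" by (rule N_transfer[OF z fn(2)])
  qed (simp add: fn)
qed

lemma in_Lspace:
  assumes "f \<in> D" "n \<in> N z" shows "f + n \<in> Lspace A"
proof -
  have "(f - (- 1 - z) *\<^sub>C R (- 1) n) + (n + (- 1 - z) *\<^sub>C R (- 1) n) \<in> Lspace A"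
    unfolding Lspace_def
    using complex_subspaceD(5)[OF D_subspace assms(1) scaled_R_in_D[OF \<rho>_points(1)]]
      N_transfer[OF \<rho>_points(1) assms(2)] by blast
  then show ?thesis by simp
qed

lemma D_Lspace: "f \<in> D \<Longrightarrow> f \<in> Lspace A"
  using in_Lspace[of f 0] complex_subspaceD(1)[OF N_subspace] by simp

lemma N_Lspace: "n \<in> N z \<Longrightarrow> n \<in> Lspace A"
  using in_Lspace[of 0 n] complex_subspaceD(1)[OF D_subspace] by simp

lemma decomposition_unique:
  assumes z: "z \<in> \<rho>" and "f \<in> D" "n \<in> N z" "f' \<in> D" "n' \<in> N z" "f + n = f' + n'"
  shows "f' = f" "n' = n"
proof -
  have eq: "n' - n = f - f'" using assms(6) by (simp add: algebra_simps)
  have "n' - n \<in> N z" by (rule complex_subspaceD(5)[OF N_subspace assms(5,3)])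
  moreover have "n' - n \<in> D" unfolding eq by (rule complex_subspaceD(5)[OF D_subspace assms(2,4)])
  ultimately have "n' - n = 0" using D_N_trivial[OF z] by blast
  then show "n' = n" "f' = f" using eq by simp_all
qed

lemma proj:
  assumes z: "z \<in> \<rho>" and fn: "f \<in> D" "n \<in> N z"
  shows "projF A z (f + n) = f" "projN A z (f + n) = n"
proof -
  show "projF A z (f + n) = f" unfolding projF_def
  proof (rule the_equality)
    fix f' assume f': "f' \<in> D \<and> f + n - f' \<in> N z"
    show "f' = f" by (rule decomposition_unique(1)[OF z fn, of f' "f + n - f'"]) (use f' in auto)
  qed (use fn in simp)
  show "projN A z (f + n) = n" unfolding projN_def
  proof (rule the_equality)
    fix n' assume n': "n' \<in> N z \<and> f + n - n' \<in> D"
    show "n' = n" by (rule decomposition_unique(2)[OF z fn, of "f + n - n'" n']) (use n' in auto)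
  qed (use fn in simp)
qed

lemma adj_decomposition:
  assumes z: "z \<in> \<rho>" and uw: "(u, w) \<in> adj"
  shows "u - R z (w - z *\<^sub>C u) \<in> N z"
proof -
  let ?v = "R z (w - z *\<^sub>C u)"
  have "(u - ?v, w - (w - z *\<^sub>C u + z *\<^sub>C ?v)) \<in> adj" by (rule adjD(4)[OF uw F_subset_adj[OF R(1)[OF z]]])
  moreover have "w - (w - z *\<^sub>C u + z *\<^sub>C ?v) = z *\<^sub>C (u - ?v)" by (simp add: scaleC_diff_right)
  ultimately show ?thesis by (simp add: N_iff)
qed

lemma adj_Lspace: assumes "(u, w) \<in> adj" shows "u \<in> Lspace A"
proof -
  let ?v = "R (- 1) (w - (- 1) *\<^sub>C u)"
  have "?v + (u - ?v) \<in> Lspace A"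
    by (rule in_Lspace[OF R(4)[OF \<rho>_points(1)] adj_decomposition[OF \<rho>_points(1) assms]])
  moreover have "v + (u - v) = u" for v :: 'a by simp
  ultimately show ?thesis by (simp only:)
qed

subsection \<open>The \<open>\<gamma>\<close>-field\<close>

lemma \<Gamma>_add: "u \<in> Lspace A \<Longrightarrow> v \<in> Lspace A \<Longrightarrow> \<Gamma> (u + v) = \<Gamma> u + \<Gamma> v"
  and \<Gamma>_scaleC: "u \<in> Lspace A \<Longrightarrow> \<Gamma> (c *\<^sub>C u) = c *\<^sub>C \<Gamma> u"
  and \<Gamma>_kernel: "u \<in> Lspace A \<Longrightarrow> \<Gamma> u = 0 \<longleftrightarrow> u \<in> D"
  and \<Gamma>_surj: "\<exists>u\<in>Lspace A. \<Gamma> u = e"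
proof -
  have lin: "linear_on (Lspace A) \<Gamma>" and ker: "{u \<in> Lspace A. \<Gamma> u = 0} = D" and surj: "\<Gamma> ` Lspace A = UNIV"
    using bp by (auto simp: boundary_pair_def)
  show "u \<in> Lspace A \<Longrightarrow> v \<in> Lspace A \<Longrightarrow> \<Gamma> (u + v) = \<Gamma> u + \<Gamma> v"
    "u \<in> Lspace A \<Longrightarrow> \<Gamma> (c *\<^sub>C u) = c *\<^sub>C \<Gamma> u" using lin by (auto simp: linear_on_def)
  show "u \<in> Lspace A \<Longrightarrow> \<Gamma> u = 0 \<longleftrightarrow> u \<in> D" using ker by blast
  show "\<exists>u\<in>Lspace A. \<Gamma> u = e" using surj by (metis UNIV_I imageE)
qed

lemma \<Gamma>_D: "f \<in> D \<Longrightarrow> \<Gamma> f = 0" using \<Gamma>_kernel D_Lspace by blast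

lemma \<Gamma>_D_add: "f \<in> D \<Longrightarrow> u \<in> Lspace A \<Longrightarrow> \<Gamma> (f + u) = \<Gamma> u"
  using \<Gamma>_add[OF D_Lspace] \<Gamma>_D by simp

lemma \<gamma>_ex1: assumes z: "z \<in> \<rho>" shows "\<exists>!u. u \<in> N z \<and> \<Gamma> u = e"
proof -
  obtain u where u: "u \<in> Lspace A" "\<Gamma> u = e" using \<Gamma>_surj by blast
  obtain f n where fn: "f \<in> D" "n \<in> N z" "u = f + n" by (rule Lspace_decomposition[OF z u(1)])
  have "\<Gamma> n = e" using \<Gamma>_D_add[OF fn(1) N_Lspace[OF fn(2)]] u fn by simp
  moreover have "n' = n" if n': "n' \<in> N z" "\<Gamma> n' = e" for n'
  proof -
    have "n' + (- 1) *\<^sub>C n \<in> N z"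
      using complex_subspaceD(2)[OF N_subspace n'(1) complex_subspaceD(3)[OF N_subspace fn(2)]] .
    moreover have "\<Gamma> (n' + (- 1) *\<^sub>C n) = \<Gamma> n' + (- 1) *\<^sub>C \<Gamma> n"
      using \<Gamma>_add[OF N_Lspace[OF n'(1)] N_Lspace[OF complex_subspaceD(3)[OF N_subspace fn(2)]]]
        \<Gamma>_scaleC[OF N_Lspace[OF fn(2)]] by (simp only:)
    then have "\<Gamma> (n' + (- 1) *\<^sub>C n) = 0" using n' \<open>\<Gamma> n = e\<close> by simp
    ultimately have "n' + (- 1) *\<^sub>C n = 0" using D_N_trivial[OF z] \<Gamma>_kernel N_Lspace by blast
    then show ?thesis by simp
  qed
  ultimately show ?thesis using fn(2) by blast
qed

lemma \<gamma>:
  assumes z: "z \<in> \<rho>"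
  shows "\<gamma> z e \<in> N z" "\<Gamma> (\<gamma> z e) = e" "n \<in> N z \<Longrightarrow> \<Gamma> n = e \<Longrightarrow> \<gamma> z e = n"
proof -
  have "\<gamma> z e \<in> N z \<and> \<Gamma> (\<gamma> z e) = e" unfolding gammaf_def by (rule theI'[OF \<gamma>_ex1[OF z]])
  then show 1: "\<gamma> z e \<in> N z" "\<Gamma> (\<gamma> z e) = e" by auto
  show "\<gamma> z e = n" if "n \<in> N z" "\<Gamma> n = e" using \<gamma>_ex1[OF z, of e] 1 that by blast
qed

lemma \<gamma>_adj_in: "z \<in> \<rho> \<Longrightarrow> (\<gamma> z e, z *\<^sub>C \<gamma> z e) \<in> adj" using \<gamma>(1) by (simp add: N_iff)

lemma \<gamma>_Lspace: "z \<in> \<rho> \<Longrightarrow> \<gamma> z e \<in> Lspace A" by (rule N_Lspace[OF \<gamma>(1)])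

lemma \<gamma>_transfer:
  assumes z: "z \<in> \<rho>" and w: "w \<in> \<rho>"
  shows "\<gamma> z e = \<gamma> w e + (z - w) *\<^sub>C R z (\<gamma> w e)"
proof (rule \<gamma>(3)[OF z N_transfer[OF z \<gamma>(1)[OF w]]])
  have "\<Gamma> ((z - w) *\<^sub>C R z (\<gamma> w e) + \<gamma> w e) = e"
    using \<Gamma>_D_add[OF scaled_R_in_D[OF z] \<gamma>_Lspace[OF w]] \<gamma>(2)[OF w] by simp
  then show "\<Gamma> (\<gamma> w e + (z - w) *\<^sub>C R z (\<gamma> w e)) = e" by (simp add: add.commute)
qed

lemma \<gamma>_linear:
  assumes z: "z \<in> \<rho>"
  shows "\<gamma> z (e + e') = \<gamma> z e + \<gamma> z e'" "\<gamma> z (c *\<^sub>C e) = c *\<^sub>C \<gamma> z e"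
proof -
  show "\<gamma> z (e + e') = \<gamma> z e + \<gamma> z e'"
    by (rule \<gamma>(3)[OF z complex_subspaceD(2)[OF N_subspace \<gamma>(1)[OF z] \<gamma>(1)[OF z]]])
      (simp add: \<Gamma>_add \<gamma>_Lspace[OF z] \<gamma>(2)[OF z])
  show "\<gamma> z (c *\<^sub>C e) = c *\<^sub>C \<gamma> z e"
    by (rule \<gamma>(3)[OF z complex_subspaceD(3)[OF N_subspace \<gamma>(1)[OF z]]])
      (simp add: \<Gamma>_scaleC \<gamma>_Lspace[OF z] \<gamma>(2)[OF z])
qed

text \<open>On the defect space of \<open>-1\<close> the norm of the form space is \<open>\<surd>2\<close> times the given norm.\<close>

lemma \<Gamma>_bounded_on_N: "\<exists>C>0. \<forall>n\<in>N (- 1). norm (\<Gamma> n) \<le> C * norm n"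
proof -
  obtain C where C: "\<forall>u\<in>Lspace A. norm (\<Gamma> u) \<le> C * sqrt (Re (Linner A u u))"
    using bp by (auto simp: boundary_pair_def)
  have B0: "app (sqrtF A) 0 = 0" unfolding sqrtF_eq by (rule app_eq[OF BD(1) linear_relationD(1)[OF BD(2)]])
  have "norm (\<Gamma> n) \<le> (\<bar>C\<bar> * sqrt 2 + 1) * norm n" if n: "n \<in> N (- 1)" for n
  proof -
    have "projF A (- 1) n = 0" "projN A (- 1) n = n"
      using proj[OF \<rho>_points(1) complex_subspaceD(1)[OF D_subspace] n] by simp_all
    then have "Re (Linner A n n) = 2 * (norm n)\<^sup>2" by (simp add: Linner_def B0 Re_cinner_self)
    then have "sqrt (Re (Linner A n n)) = sqrt 2 * norm n" by (simp add: real_sqrt_mult)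
    then have "norm (\<Gamma> n) \<le> C * (sqrt 2 * norm n)" using C N_Lspace[OF n] by fastforce
    also have "\<dots> \<le> \<bar>C\<bar> * (sqrt 2 * norm n)" by (intro mult_right_mono) auto
    finally show ?thesis using norm_ge_zero[of n] unfolding distrib_right by linarith
  qed
  moreover have "0 < \<bar>C\<bar> * sqrt 2 + 1" by (simp add: add_nonneg_pos)
  ultimately show ?thesis by blast
qed

lemma \<gamma>_bounded_minus1: "bounded_clinear (\<gamma> (- 1))"
proof -
  obtain C where C: "\<forall>n\<in>N (- 1). norm (\<Gamma> n) \<le> C * norm n" using \<Gamma>_bounded_on_N by blast
  have "\<exists>c. \<forall>n\<in>N (- 1). norm n \<le> c * norm (\<Gamma> n)"
  proof (rule bounded_inverse[OF N_subspace N_closed, of "- 1" \<Gamma> C])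
    show "linear_on (N (- 1)) \<Gamma>" unfolding linear_on_def using \<Gamma>_add \<Gamma>_scaleC N_Lspace by blast
    show "\<Gamma> ` N (- 1) = UNIV"
      using \<gamma>(1,2)[OF \<rho>_points(1)] by (metis UNIV_eq_I imageI)
    show "n = 0" if "n \<in> N (- 1)" "\<Gamma> n = 0" for n
      using D_N_trivial[OF \<rho>_points(1)] \<Gamma>_kernel N_Lspace that by blast
  qed (use C in blast)+
  then obtain c where "\<And>n. n \<in> N (- 1) \<Longrightarrow> norm n \<le> c * norm (\<Gamma> n)" by blast
  then have "norm (\<gamma> (- 1) e) \<le> c * norm e" for e
    using \<gamma>(1,2)[OF \<rho>_points(1)] by metis
  then show ?thesis by (rule bounded_clinearI[OF \<gamma>_linear[OF \<rho>_points(1)]])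
qed

lemma \<gamma>_bounded:
  assumes z: "z \<in> \<rho>" shows "bounded_clinear (\<gamma> z)"
proof -
  have "bounded_clinear (\<lambda>e. \<gamma> (- 1) e + (z - (- 1)) *\<^sub>C R z (\<gamma> (- 1) e))"
    by (intro bounded_clinear_add \<gamma>_bounded_minus1 bounded_clinear_compose[OF bounded_clinear_scaleC]
        bounded_clinear_compose[OF R(3)[OF z]])
  moreover have "\<gamma> z = (\<lambda>e. \<gamma> (- 1) e + (z - (- 1)) *\<^sub>C R z (\<gamma> (- 1) e))"
    using \<gamma>_transfer[OF z \<rho>_points(1)] by blast
  ultimately show ?thesis by simp
qed

lemma \<gamma>_bounded_below:
  assumes z: "z \<in> \<rho>"
  obtains C where "0 < C" "\<And>e. norm e \<le> C * norm (\<gamma> z e)"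
proof -
  obtain C1 where C1: "0 < C1" "\<And>n. n \<in> N (- 1) \<Longrightarrow> norm (\<Gamma> n) \<le> C1 * norm n" using \<Gamma>_bounded_on_N by blast
  obtain C2 where C2: "0 < C2" "\<And>x. norm (R (- 1) x) \<le> C2 * norm x"
    using bounded_clinear_bound[OF R(3)[OF \<rho>_points(1)]] by blast
  show thesis
  proof (rule that)
    show "0 < C1 * (1 + cmod (- 1 - z) * C2)" using C1 C2 by (simp add: add_pos_nonneg)
    fix e
    have "norm (\<gamma> (- 1) e) \<le> norm (\<gamma> z e) + cmod (- 1 - z) * norm (R (- 1) (\<gamma> z e))"
      using norm_triangle_ineq[of "\<gamma> z e" "(- 1 - z) *\<^sub>C R (- 1) (\<gamma> z e)"]
      unfolding \<gamma>_transfer[OF \<rho>_points(1) z] norm_scaleC .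
    also have "\<dots> \<le> norm (\<gamma> z e) + cmod (- 1 - z) * (C2 * norm (\<gamma> z e))"
      by (intro add_left_mono mult_left_mono C2) simp
    finally have 1: "norm (\<gamma> (- 1) e) \<le> (1 + cmod (- 1 - z) * C2) * norm (\<gamma> z e)" by (simp add: algebra_simps)
    have "norm e \<le> C1 * norm (\<gamma> (- 1) e)" using C1(2)[OF \<gamma>(1)[OF \<rho>_points(1)], of e] by (simp add: \<gamma>(2)[OF \<rho>_points(1)])
    also have "\<dots> \<le> C1 * ((1 + cmod (- 1 - z) * C2) * norm (\<gamma> z e))" using C1 1 by (intro mult_left_mono) auto
    finally show "norm e \<le> C1 * (1 + cmod (- 1 - z) * C2) * norm (\<gamma> z e)" by (simp add: mult.assoc)
  qed
qed

lemma cinner_\<gamma>adj: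
  assumes z: "z \<in> \<rho>" shows "cinner (\<gamma>adj z x) e = cinner x (\<gamma> z e)"
proof -
  have "cinner (\<gamma> z e) x = cinner e (\<gamma>adj z x)"
    unfolding gamma_adj_def by (rule cinner_bounded_adjoint[OF \<gamma>_bounded[OF z]])
  then show ?thesis using cinner_commute[of "\<gamma>adj z x" e] cinner_commute[of x "\<gamma> z e"] by simp
qed

lemma \<gamma>adj_bounded: "z \<in> \<rho> \<Longrightarrow> bounded_clinear (\<gamma>adj z)"
  unfolding gamma_adj_def by (rule bounded_clinear_adjoint[OF \<gamma>_bounded])

lemma \<gamma>adj_surjective:
  assumes z: "z \<in> \<rho>"
  obtains C where "0 < C" "\<And>h. \<exists>f. \<gamma>adj z f = h \<and> norm f \<le> C * norm h"
proof -
  obtain C where C: "0 < C" "\<And>e. norm e \<le> C * norm (\<gamma> z e)" using \<gamma>_bounded_below[OF z] by blast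
  have "\<exists>f. \<gamma>adj z f = h \<and> norm f \<le> C * norm h" for h
    by (rule adjoint_surjective[OF \<gamma>_bounded[OF z] less_imp_le[OF C(1)] C(2), of h]) (auto simp: gamma_adj_def)
  then show thesis using that C(1) by blast
qed

lemma Qscaled_eq:
  assumes z: "z \<in> \<rho>" shows "Qscaled A \<Gamma> z e = (z + \<i>) *\<^sub>C \<gamma>adj \<i> (\<gamma> z e)"
  by (simp add: Qscaled_def Qfun_def scaleC_scaleC)

lemma Qscaled_bounded:
  assumes z: "z \<in> \<rho>" shows "bounded_clinear (Qscaled A \<Gamma> z)"
proof -
  have "bounded_clinear (\<lambda>e. (z + \<i>) *\<^sub>C \<gamma>adj \<i> (\<gamma> z e))"
    by (intro bounded_clinear_compose[OF bounded_clinear_scaleC] bounded_clinear_compose[OF \<gamma>adj_bounded[OF \<rho>_points(2)]]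
        \<gamma>_bounded z)
  moreover have "Qscaled A \<Gamma> z = (\<lambda>e. (z + \<i>) *\<^sub>C \<gamma>adj \<i> (\<gamma> z e))" using Qscaled_eq[OF z] by blast
  ultimately show ?thesis by simp
qed

subsection \<open>The boundary map on the domain of the adjoint\<close>

text \<open>For \<open>(u, w)\<close> in the graph of the adjoint this is the vector
  \<open>G u + 2i \<gamma>\<^sup>*(i) \<gamma>(i) \<Gamma> u\<close> of a boundary triplet, see \<open>triplet_bmap\<close>.\<close>

definition bmap :: "'a \<Rightarrow> 'a \<Rightarrow> 'h" where "bmap u w = \<gamma>adj \<i> (w + \<i> *\<^sub>C u)"

lemma cinner_bmap: "cinner (bmap u w) e = cinner (w + \<i> *\<^sub>C u) (\<gamma> \<i> e)"
  unfolding bmap_def by (rule cinner_\<gamma>adj[OF \<rho>_points(2)])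

lemma bmap_linear: "bmap (u + u') (w + w') = bmap u w + bmap u' w'" "bmap (c *\<^sub>C u) (c *\<^sub>C w) = c *\<^sub>C bmap u w"
  by (rule cinner_eqI; simp add: cinner_bmap cinner_simps algebra_simps)+

lemma adj_split:
  assumes z: "z \<in> \<rho>" and uw: "(u, w) \<in> adj"
  shows "u = R z (w - z *\<^sub>C u) + \<gamma> z (\<Gamma> u)"
proof -
  let ?v = "R z (w - z *\<^sub>C u)"
  have n: "u - ?v \<in> N z" by (rule adj_decomposition[OF z uw])
  have "\<Gamma> (?v + (u - ?v)) = \<Gamma> (u - ?v)" by (rule \<Gamma>_D_add[OF R(4)[OF z] N_Lspace[OF n]])
  then have "\<gamma> z (\<Gamma> u) = u - ?v" by (intro \<gamma>(3)[OF z n]) simp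
  then show ?thesis by simp
qed

lemma adj_combine:
  assumes z: "z \<in> \<rho>"
  shows "(R z f + \<gamma> z e, f + z *\<^sub>C (R z f + \<gamma> z e)) \<in> adj" "\<Gamma> (R z f + \<gamma> z e) = e"
proof -
  have "(R z f + \<gamma> z e, (f + z *\<^sub>C R z f) + z *\<^sub>C \<gamma> z e) \<in> adj"
    by (rule adjD(2)[OF F_subset_adj[OF R(1)[OF z]] \<gamma>_adj_in[OF z]])
  then show "(R z f + \<gamma> z e, f + z *\<^sub>C (R z f + \<gamma> z e)) \<in> adj" by (simp add: scaleC_add_right add.assoc)
  show "\<Gamma> (R z f + \<gamma> z e) = e" using \<Gamma>_D_add[OF R(4)[OF z] \<gamma>_Lspace[OF z]] \<gamma>(2)[OF z] by simp
qed

text \<open>By \<open>\<gamma>_transfer\<close> the vector \<open>\<gamma> (cnj z) e\<close> is \<open>\<gamma> \<i> e\<close> plus a multiple of its resolvent at \<open>cnj z\<close>.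
  Moving this resolvent to \<open>w - z u\<close> gives the part \<open>R z (w - z u)\<close> of \<open>u\<close> in the domain of \<open>F\<close>, and the
  remaining part \<open>\<gamma> z (\<Gamma> u)\<close> comes from \<open>Q\<close>. Together they restore \<open>w + i u\<close>.\<close>

lemma bmap_eq:
  assumes z: "z \<in> \<rho>" and uw: "(u, w) \<in> adj"
  shows "bmap u w = \<gamma>adj (cnj z) (w - z *\<^sub>C u) + Qscaled A \<Gamma> z (\<Gamma> u)"
proof (rule cinner_eqI)
  fix e
  let ?g = "\<gamma> \<i> e" and ?f = "w - z *\<^sub>C u"
  have "cinner (\<gamma>adj (cnj z) ?f) e = cinner ?f (?g + (cnj z - \<i>) *\<^sub>C R (cnj z) ?g)"
    by (simp only: cinner_\<gamma>adj[OF resolvent_cnj[OF z]] \<gamma>_transfer[OF resolvent_cnj[OF z] \<rho>_points(2)])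
  also have "\<dots> = cinner ?f ?g + (z + \<i>) * cinner (R z ?f) ?g"
    by (simp add: cinner_add_right cinner_scaleC_right R_adjoint[OF z])
  finally have 1: "cinner (\<gamma>adj (cnj z) ?f) e = cinner ?f ?g + (z + \<i>) * cinner (R z ?f) ?g" .
  have 2: "cinner (Qscaled A \<Gamma> z (\<Gamma> u)) e = (z + \<i>) * cinner (\<gamma> z (\<Gamma> u)) ?g"
    by (simp add: Qscaled_eq[OF z] cinner_scaleC_left cinner_\<gamma>adj[OF \<rho>_points(2)])
  have "cinner (R z ?f) ?g + cinner (\<gamma> z (\<Gamma> u)) ?g = cinner u ?g"
    using adj_split[OF z uw] by (simp flip: cinner_add_left)
  then have 3: "cinner (\<gamma> z (\<Gamma> u)) ?g = cinner u ?g - cinner (R z ?f) ?g" by (simp add: eq_diff_eq add.commute)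
  show "cinner (bmap u w) e = cinner (\<gamma>adj (cnj z) ?f + Qscaled A \<Gamma> z (\<Gamma> u)) e"
    unfolding cinner_bmap cinner_add_left[of "\<gamma>adj (cnj z) ?f"] 1 2 3
    by (simp add: cinner_simps algebra_simps)
qed

lemma bmap_surjective:
  obtains u w where "(u, w) \<in> adj" "\<Gamma> u = e" "bmap u w = h"
proof -
  obtain f where f: "\<gamma>adj \<i> f = h" using \<gamma>adj_surjective[OF \<rho>_points(2)] by metis
  \<comment> \<open>decompose at \<open>- \<i>\<close>, where \<open>w - z u\<close> is the vector \<open>w + i u\<close> that \<open>bmap\<close> depends on\<close>
  let ?u = "R (- \<i>) f + \<gamma> (- \<i>) e"
  show thesis
  proof (rule that[OF adj_combine[OF \<rho>_points(3), of f e]])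
    show "bmap ?u (f + (- \<i>) *\<^sub>C ?u) = h" by (simp add: bmap_def f)
  qed
qed

lemma bmap_A: "bmap u w = 0" "\<Gamma> u = 0" if uw: "(u, w) \<in> A"
proof -
  show "bmap u w = 0"
  proof (rule cinner_eqI)
    fix e
    have "cinner w (\<gamma> \<i> e) = cinner u (\<i> *\<^sub>C \<gamma> \<i> e)"
      by (rule adjoint_relationD[OF \<gamma>_adj_in[OF \<rho>_points(2)] uw])
    then show "cinner (bmap u w) e = cinner 0 e" by (simp add: cinner_bmap cinner_simps)
  qed
  show "\<Gamma> u = 0" by (rule \<Gamma>_D[OF Domain_F_D]) (use uw A_subset_F in blast)
qed

text \<open>By assumption \<open>w + i u\<close> is orthogonal to the defect space of \<open>i\<close>, which is the orthogonal complement of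
  the closed range of \<open>A + i\<close>. So \<open>w + i u = (A + i) x\<close> with \<open>x\<close> in the domain of \<open>A\<close>, and \<open>x = u\<close> because
  \<open>F + i\<close> is injective.\<close>

lemma bmap_kernel:
  assumes uw: "(u, w) \<in> adj" and 0: "\<Gamma> u = 0" "bmap u w = 0"
  shows "(u, w) \<in> A"
proof -
  let ?f = "w + \<i> *\<^sub>C u"
  have uF: "(u, w) \<in> F" using uw 0(1) \<Gamma>_kernel adj_Lspace by (simp add: friedrichs_iff)
  have below: "norm x \<le> norm (y + \<i> *\<^sub>C x)" if xy: "(x, y) \<in> A" for x y
  proof -
    have "(x, y) \<in> F" using xy A_subset_F by blast
    from shifted_norm[OF this, of "- \<i>"]
    have "(norm x)\<^sup>2 \<le> (norm (y + \<i> *\<^sub>C x))\<^sup>2" by simp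
    then show ?thesis by simp
  qed
  have lin: "linear_relation (shift A (- \<i>))" by (rule linear_relation_shift[OF A_rel])
  have "closed (Range (shift A (- \<i>)))"
  proof (rule closed_Range_if_bounded_below[OF lin closed_shift[OF closed_A], of 1])
    show "1 * norm x \<le> norm y" if "(x, y) \<in> shift A (- \<i>)" for x y
      using below[of x "y + (- \<i>) *\<^sub>C x"] that by simp
  qed simp
  then have "?f \<in> Range (shift A (- \<i>))"
  proof (rule orthogonal_projection[OF complex_subspace_Range[OF lin], of ?f])
    fix p assume p: "p \<in> Range (shift A (- \<i>))" "\<And>v. v \<in> Range (shift A (- \<i>)) \<Longrightarrow> cinner (?f - p) v = 0"
    let ?r = "?f - p"
    have "(?r, \<i> *\<^sub>C ?r) \<in> adj"
    proof (rule adjoint_relationI)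
      fix x y assume "(x, y) \<in> A"
      then have "y + \<i> *\<^sub>C x \<in> Range (shift A (- \<i>))" by (intro RangeI[of x]) simp
      from p(2)[OF this] have "cinner (y + \<i> *\<^sub>C x) ?r = 0" using cinner_commute[of "y + \<i> *\<^sub>C x" ?r] by simp
      then have "cinner y ?r + \<i> * cinner x ?r = 0" by (simp only: cinner_add_left cinner_scaleC_left)
      then show "cinner y ?r = cinner x (\<i> *\<^sub>C ?r)"
        by (simp only: cinner_scaleC_right complex_cnj_i eq_neg_iff_add_eq_0 mult_minus_left)
    qed
    then have "\<gamma> \<i> (\<Gamma> ?r) = ?r" by (intro \<gamma>(3)[OF \<rho>_points(2)]) (simp_all add: N_iff)
    then have "cinner ?f ?r = cinner (bmap u w) (\<Gamma> ?r)" by (simp add: cinner_bmap)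
    moreover have "cinner p ?r = 0" using p(2)[OF p(1)] cinner_commute[of p ?r] by simp
    ultimately have "cinner ?r ?r = 0" using 0(2) by (simp add: cinner_diff_left)
    then have "?f = p" using Re_cinner_self[of ?r] by simp
    then show ?thesis using p(1) by simp
  qed
  then obtain x where "(x, ?f) \<in> shift A (- \<i>)" by blast
  then have x: "(x, ?f - \<i> *\<^sub>C x) \<in> A" by simp
  have "x = u"
    using R(2)[OF \<rho>_points(3), of x "?f - \<i> *\<^sub>C x"] R(2)[OF \<rho>_points(3) uF] x A_subset_F by auto
  then show ?thesis using x by simp
qed

text \<open>Test the triplet identity with \<open>v = \<gamma> \<i> e\<close>. Its part in the form domain is zero, so all terms
  containing the square root disappear and \<open>(G u, e)\<close> is left as \<open>((F + i) f, \<gamma> \<i> e)\<close>, where \<open>f\<close> is the part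
  of \<open>u\<close> in the domain of \<open>F\<close>.\<close>

lemma triplet_bmap:
  assumes bt: "boundary_triplet A G \<Gamma>" and uw: "(u, w) \<in> adj"
  shows "G u + (2 * \<i>) *\<^sub>C \<gamma>adj \<i> (\<gamma> \<i> (\<Gamma> u)) = bmap u w"
proof (rule cinner_eqI)
  fix e
  let ?f = "R \<i> (w - \<i> *\<^sub>C u)" and ?n = "\<gamma> \<i> (\<Gamma> u)" and ?g = "\<gamma> \<i> e"
  note i = \<rho>_points(2)
  have u: "u = ?f + ?n" by (rule adj_split[OF i uw])
  have fD: "?f \<in> D" by (rule R(4)[OF i])
  have nN: "?n \<in> N \<i>" and gN: "?g \<in> N \<i>" by (rule \<gamma>(1)[OF i])+
  have fF: "(?f, w - \<i> *\<^sub>C ?n) \<in> F"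
  proof -
    have "\<i> *\<^sub>C u = \<i> *\<^sub>C ?f + \<i> *\<^sub>C ?n" using u by (metis scaleC_add_right)
    moreover have "w - a + b = w - c" if "a = b + c" for a b c :: 'a using that by simp
    ultimately have "w - \<i> *\<^sub>C u + \<i> *\<^sub>C ?f = w - \<i> *\<^sub>C ?n" by blast
    then show ?thesis using R(1)[OF i, of "w - \<i> *\<^sub>C u"] by (simp only:)
  qed
  have L: "(u, (w - \<i> *\<^sub>C ?n) - \<i> *\<^sub>C ?n) \<in> Lop A"
    unfolding Lop_def using fF nN u by blast
  have appL: "app (Lop A) u = (w - \<i> *\<^sub>C ?n) - \<i> *\<^sub>C ?n" unfolding app_def
  proof (rule the_equality[where P = "\<lambda>y. (u, y) \<in> Lop A", OF L])
    fix y assume "(u, y) \<in> Lop A"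
    then obtain f' g' n' where y: "u = f' + n'" "y = g' - \<i> *\<^sub>C n'" "(f', g') \<in> F" "n' \<in> N \<i>"
      by (auto simp: Lop_def)
    have "f' = ?f" "n' = ?n"
      using decomposition_unique[OF i fD nN Domain_F_D[OF y(3)] y(4)] u y(1) by simp_all
    then show "y = (w - \<i> *\<^sub>C ?n) - \<i> *\<^sub>C ?n"
      using y linear_operator_unique[OF FD(1) fF] by blast
  qed
  have B0: "app (sqrtF A) 0 = 0" unfolding sqrtF_eq by (rule app_eq[OF BD(1) linear_relationD(1)[OF BD(2)]])
  have pu: "projF A \<i> u = ?f" "projN A \<i> u = ?n" using proj[OF i fD nN] u by simp_all
  have pg: "projF A \<i> ?g = 0" "projN A \<i> ?g = ?g"
    using proj[OF i complex_subspaceD(1)[OF D_subspace] gN] by simp_all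
  have "lform A u ?g = cinner (app (Lop A) u) ?g - cinner (G u) (\<Gamma> ?g)"
    using bt L \<gamma>_Lspace[OF i] unfolding boundary_triplet_def by blast
  then have "cinner (G u) e = cinner ((w - \<i> *\<^sub>C ?n) - \<i> *\<^sub>C ?n) ?g + \<i> * cinner ?f ?g + \<i> * cinner ?n ?g"
    by (simp add: lform_def pu pg B0 \<gamma>(2)[OF i] appL algebra_simps)
  moreover have "cinner u ?g = cinner ?f ?g + cinner ?n ?g" using u by (metis cinner_add_left)
  ultimately show "cinner (G u + (2 * \<i>) *\<^sub>C \<gamma>adj \<i> ?n) e = cinner (bmap u w) e"
    by (simp add: cinner_bmap cinner_simps cinner_\<gamma>adj[OF i] algebra_simps)
qed

end


section \<open>Extensions and boundary relations\<close>

context boundary_setting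
begin

definition ext :: "('h \<times> 'h) set \<Rightarrow> ('a \<times> 'a) set" where
  "ext Z = {(u, w) \<in> adj. (\<Gamma> u, bmap u w) \<in> Z}"

definition boundary_relation :: "('a \<times> 'a) set \<Rightarrow> ('h \<times> 'h) set" where
  "boundary_relation T = {(\<Gamma> u, bmap u w) | u w. (u, w) \<in> T}"

lemma extension_of_eq_ext:
  assumes "boundary_triplet A G \<Gamma>"
  shows "extension_of A G \<Gamma> Z = ext Z"
  unfolding extension_of_def ext_def using triplet_bmap[OF assms] by auto

lemma adj_\<Gamma>_linear:
  assumes "(u, w) \<in> adj"
  shows "(u', w') \<in> adj \<Longrightarrow> \<Gamma> (u + u') = \<Gamma> u + \<Gamma> u'" "\<Gamma> (c *\<^sub>C u) = c *\<^sub>C \<Gamma> u"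
  using \<Gamma>_add \<Gamma>_scaleC adj_Lspace assms by blast+

lemma ext_iff: "(u, w) \<in> ext Z \<longleftrightarrow> (u, w) \<in> adj \<and> (\<Gamma> u, bmap u w) \<in> Z"
  by (simp add: ext_def)

lemma ext_quasi_selfadjoint:
  assumes Z: "linear_relation Z"
  shows "quasi_selfadjoint_extension A (ext Z)"
proof -
  note ZD = linear_relationD[OF Z]
  have A_ext: "A \<subseteq> ext Z"
    using A_subset_adjoint bmap_A ZD(1) by (auto simp: ext_iff)
  have "linear_relation (ext Z)" unfolding linear_relation_def
  proof (intro conjI allI impI)
    show "(0, 0) \<in> ext Z" using A_ext linear_relationD(1)[OF A_rel] by blast
    fix u w assume 1: "(u, w) \<in> ext Z"
    have uw1: "(u, w) \<in> adj" using 1 by (simp add: ext_iff)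
    show "(c *\<^sub>C u, c *\<^sub>C w) \<in> ext Z" for c
      using 1 adjD(3)[OF uw1] ZD(3) by (simp add: ext_iff adj_\<Gamma>_linear(2)[OF uw1] bmap_linear)
    fix u' w' assume 2: "(u', w') \<in> ext Z"
    have uw: "(u, w) \<in> adj" "(u', w') \<in> adj" using uw1 2 by (simp_all add: ext_iff)
    show "(u + u', w + w') \<in> ext Z"
      using 1 2 adjD(2)[OF uw] ZD(2) by (simp add: ext_iff adj_\<Gamma>_linear(1)[OF uw] bmap_linear)
  qed
  then have "linear_operator (ext Z)"
  proof (rule linear_operatorI)
    fix y assume "(0, y) \<in> ext Z"
    then show "y = 0" using linear_operator_unique[OF adj_op _ adjD(1)] by (auto simp: ext_iff)
  qed
  then show ?thesis using A_ext by (auto simp: quasi_selfadjoint_extension_def ext_iff)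
qed

lemma boundary_relation_ext: "boundary_relation (ext Z) = Z"
proof (intro equalityI subrelI)
  fix e h assume "(e, h) \<in> Z"
  obtain u w where "(u, w) \<in> adj" "\<Gamma> u = e" "bmap u w = h" by (rule bmap_surjective)
  then have "(u, w) \<in> ext Z" using \<open>(e, h) \<in> Z\<close> by (simp add: ext_iff)
  then show "(e, h) \<in> boundary_relation (ext Z)"
    using \<open>\<Gamma> u = e\<close> \<open>bmap u w = h\<close> unfolding boundary_relation_def by blast
qed (auto simp: boundary_relation_def ext_iff)

lemma ext_boundary_relation:
  assumes T: "quasi_selfadjoint_extension A T"
  shows "linear_relation (boundary_relation T)" "ext (boundary_relation T) = T"
proof -
  have TA: "T \<subseteq> adj" "A \<subseteq> T" and "linear_relation T"
    using T by (auto simp: quasi_selfadjoint_extension_def linear_operator_relation)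
  note TD = linear_relationD[OF \<open>linear_relation T\<close>]
  have I: "(\<Gamma> u, bmap u w) \<in> boundary_relation T" if "(u, w) \<in> T" for u w
    using that unfolding boundary_relation_def by blast
  show "linear_relation (boundary_relation T)" unfolding linear_relation_def
  proof (intro conjI allI impI)
    show "(0, 0) \<in> boundary_relation T"
      using I[OF TD(1)] bmap_A[OF linear_relationD(1)[OF A_rel]] by simp
    fix e h assume "(e, h) \<in> boundary_relation T"
    then obtain u w where 1: "e = \<Gamma> u" "h = bmap u w" "(u, w) \<in> T" by (auto simp: boundary_relation_def)
    have uw: "(u, w) \<in> adj" using 1 TA by blast
    show "(c *\<^sub>C e, c *\<^sub>C h) \<in> boundary_relation T" for c
      using I[OF TD(3)[OF 1(3), of c]] by (simp add: 1 adj_\<Gamma>_linear(2)[OF uw] bmap_linear)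
    fix e' h' assume "(e', h') \<in> boundary_relation T"
    then obtain u' w' where 2: "e' = \<Gamma> u'" "h' = bmap u' w'" "(u', w') \<in> T" by (auto simp: boundary_relation_def)
    have uw': "(u', w') \<in> adj" using 2 TA by blast
    show "(e + e', h + h') \<in> boundary_relation T"
      using I[OF TD(2)[OF 1(3) 2(3)]] by (simp add: 1 2 adj_\<Gamma>_linear(1)[OF uw uw'] bmap_linear)
  qed
  show "ext (boundary_relation T) = T"
  proof (intro equalityI subrelI)
    fix u w assume "(u, w) \<in> ext (boundary_relation T)"
    then obtain u' w' where uw: "(u, w) \<in> adj" and e: "\<Gamma> u = \<Gamma> u'" "bmap u w = bmap u' w'" and uw': "(u', w') \<in> T"
      by (auto simp: ext_iff boundary_relation_def)
    have a: "((- 1) *\<^sub>C u', (- 1) *\<^sub>C w') \<in> adj" using adjD(3) uw' TA by blast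
    have "(u + (- 1) *\<^sub>C u', w + (- 1) *\<^sub>C w') \<in> A"
    proof (rule bmap_kernel)
      show "(u + (- 1) *\<^sub>C u', w + (- 1) *\<^sub>C w') \<in> adj" by (rule adjD(2)[OF uw a])
      show "\<Gamma> (u + (- 1) *\<^sub>C u') = 0"
        using adj_\<Gamma>_linear(1)[OF uw a] adj_\<Gamma>_linear(2)[of u' w' "- 1"] uw' TA e by auto
      show "bmap (u + (- 1) *\<^sub>C u') (w + (- 1) *\<^sub>C w') = 0"
        by (simp only: bmap_linear e) simp
    qed
    then have "(u - u', w - w') \<in> T" using TA by auto
    from TD(2)[OF this uw'] show "(u, w) \<in> T" by simp
  next
    fix u w assume "(u, w) \<in> T"
    then show "(u, w) \<in> ext (boundary_relation T)" using I TA by (auto simp: ext_iff)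
  qed
qed

subsection \<open>Accretivity\<close>

text \<open>Write \<open>u = f + n\<close> with \<open>f\<close> in the domain of \<open>F\<close> and \<open>n = \<gamma> \<i> (\<Gamma> u)\<close>, and expand. The mixed terms of the
  form and those of \<open>(bmap u w, \<Gamma> u)\<close> differ by twice \<open>Im (f, n)\<close>.\<close>

lemma form_identity:
  assumes uw: "(u, w) \<in> adj"
  obtains y where "(u - \<gamma> \<i> (\<Gamma> u), y) \<in> B"
    "Re (cinner w u) = (norm y)\<^sup>2 + Re (cinner (bmap u w) (\<Gamma> u)) + 2 * Im (cinner (u - \<gamma> \<i> (\<Gamma> u)) (\<gamma> \<i> (\<Gamma> u)))"
proof -
  let ?n = "\<gamma> \<i> (\<Gamma> u)"
  define f where "f = u - ?n"
  define g where "g = w - \<i> *\<^sub>C ?n"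
  have fR: "f = R \<i> (w - \<i> *\<^sub>C u)" unfolding f_def using adj_split[OF \<rho>_points(2) uw] by (metis add_diff_cancel_right')
  have "(f, g) \<in> adj" unfolding f_def g_def by (rule adjD(4)[OF uw \<gamma>_adj_in[OF \<rho>_points(2)]])
  moreover have "f \<in> D" unfolding fR by (rule R(4)[OF \<rho>_points(2)])
  ultimately have "(f, g) \<in> F" by (simp add: friedrichs_iff)
  then obtain y where y: "(f, y) \<in> B" "(y, g) \<in> B" unfolding friedrichs_eq BB[symmetric] by blast
  have gf: "cinner g f = cinner y y" by (rule BD(7)[OF y(2,1)])
  have u: "u = f + ?n" and w: "w = g + \<i> *\<^sub>C ?n" by (simp_all add: f_def g_def)
  have "Re (cinner w u) = Re (cinner (g + \<i> *\<^sub>C ?n) (f + ?n))" using u w by (simp only:)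
  also have "\<dots> = (norm y)\<^sup>2 + Re (cinner g ?n) + Im (cinner f ?n)"
    using Im_cinner_commute[of ?n f] by (simp add: cinner_simps gf Re_cinner_self cinner_norm[of ?n] del: of_real_power)
  finally have 1: "Re (cinner w u) = (norm y)\<^sup>2 + Re (cinner g ?n) + Im (cinner f ?n)" .
  have "cinner (bmap u w) (\<Gamma> u) = cinner (g + \<i> *\<^sub>C ?n + \<i> *\<^sub>C (f + ?n)) ?n"
    unfolding cinner_bmap using u w by (simp only:)
  then have "Re (cinner (bmap u w) (\<Gamma> u)) = Re (cinner g ?n) - Im (cinner f ?n)"
    by (simp add: cinner_simps cinner_norm[of ?n] del: of_real_power)
  with 1 show thesis using y(1) by (intro that[of y]) (simp_all add: f_def)
qed

text \<open>Moving \<open>u\<close> by the domain of \<open>A\<close> does not change its boundary values, while its part in the form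
  domain becomes arbitrary up to closure.\<close>

lemma accretive_ext_iff:
  "accretive (ext Z) \<longleftrightarrow>
    (\<forall>(e, h) \<in> Z. \<forall>(v, y) \<in> B. 0 \<le> Re (cinner h e) + (norm y)\<^sup>2 + 2 * Im (cinner v (\<gamma> \<i> e)))"
proof (intro iffI ballI)
  assume R: "\<forall>(e, h) \<in> Z. \<forall>(v, y) \<in> B. 0 \<le> Re (cinner h e) + (norm y)\<^sup>2 + 2 * Im (cinner v (\<gamma> \<i> e))"
  show "accretive (ext Z)" unfolding accretive_def
  proof clarify
    fix u w assume "(u, w) \<in> ext Z"
    then have uw: "(u, w) \<in> adj" and Z: "(\<Gamma> u, bmap u w) \<in> Z" by (auto simp: ext_iff)
    obtain y where y: "(u - \<gamma> \<i> (\<Gamma> u), y) \<in> B"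
      "Re (cinner w u) = (norm y)\<^sup>2 + Re (cinner (bmap u w) (\<Gamma> u)) + 2 * Im (cinner (u - \<gamma> \<i> (\<Gamma> u)) (\<gamma> \<i> (\<Gamma> u)))"
      using form_identity[OF uw] by blast
    show "0 \<le> Re (cinner w u)" using R Z y by fastforce
  qed
next
  fix p assume acc: "accretive (ext Z)" and p: "p \<in> Z"
  obtain e h where eh: "p = (e, h)" by (cases p)
  obtain u w where uw: "(u, w) \<in> adj" "\<Gamma> u = e" "bmap u w = h" by (rule bmap_surjective)
  let ?n = "\<gamma> \<i> e"
  have "0 \<le> Re (cinner h e) + (norm y)\<^sup>2 + 2 * Im (cinner v ?n)" if vy: "(v, y) \<in> B" for v y
  proof -
    obtain y0 where y0: "(u - ?n, y0) \<in> B" using form_identity[OF uw(1)] uw(2) by metis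
    have "(v - (u - ?n), y - y0) \<in> B" by (rule linear_relationD(4)[OF BD(2) vy y0])
    then obtain X where X: "\<And>n::nat. X n \<in> Domain A" "X \<longlonglongrightarrow> v - (u - ?n)" "(\<lambda>n. app B (X n)) \<longlonglongrightarrow> y - y0"
      by (rule core) blast
    have "0 \<le> Re (cinner h e) + (norm (y0 + app B (X n)))\<^sup>2 + 2 * Im (cinner (u - ?n + X n) ?n)" for n
    proof -
      have XA: "(X n, app A (X n)) \<in> A" by (rule app_A[OF X(1)])
      have XD: "(X n, app A (X n)) \<in> adj" using XA A_subset_adjoint by blast
      have adjX: "(u + X n, w + app A (X n)) \<in> adj" by (rule adjD(2)[OF uw(1) XD])
      have \<Gamma>X: "\<Gamma> (u + X n) = e" using adj_\<Gamma>_linear(1)[OF uw(1) XD] bmap_A(2)[OF XA] uw(2) by simp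
      have bX: "bmap (u + X n) (w + app A (X n)) = h" using bmap_A(1)[OF XA] uw(3) by (simp add: bmap_linear)
      obtain y' where y': "(u + X n - ?n, y') \<in> B"
        "Re (cinner (w + app A (X n)) (u + X n)) = (norm y')\<^sup>2 + Re (cinner h e) + 2 * Im (cinner (u + X n - ?n) ?n)"
        using form_identity[OF adjX] unfolding \<Gamma>X bX by blast
      have "(u - ?n + X n, y0 + app B (X n)) \<in> B" by (rule linear_relationD(2)[OF BD(2) y0 dom_A_in_B[OF X(1)]])
      moreover have eq: "u - ?n + X n = u + X n - ?n" by simp
      ultimately have "y' = y0 + app B (X n)" using linear_operator_unique[OF BD(1) y'(1)] by simp
      moreover have "(u + X n, w + app A (X n)) \<in> ext Z" using adjX p eh by (simp add: ext_iff \<Gamma>X bX)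
      ultimately show ?thesis using accretiveD[OF acc] y'(2) unfolding eq by fastforce
    qed
    moreover have "(\<lambda>n. Re (cinner h e) + (norm (y0 + app B (X n)))\<^sup>2 + 2 * Im (cinner (u - ?n + X n) ?n))
        \<longlonglongrightarrow> Re (cinner h e) + (norm (y0 + (y - y0)))\<^sup>2 + 2 * Im (cinner (u - ?n + (v - (u - ?n))) ?n)"
      by (intro tendsto_add tendsto_mult tendsto_const tendsto_power tendsto_norm tendsto_Im tendsto_cinner X)
    ultimately have "0 \<le> Re (cinner h e) + (norm (y0 + (y - y0)))\<^sup>2 + 2 * Im (cinner (u - ?n + (v - (u - ?n))) ?n)"
      by (intro LIMSEQ_le_const) blast+
    then show ?thesis by simp
  qed
  then show "case p of (e, h) \<Rightarrow> \<forall>(v, y) \<in> B. 0 \<le> Re (cinner h e) + (norm y)\<^sup>2 + 2 * Im (cinner v (\<gamma> \<i> e))"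
    unfolding eh by blast
qed

lemma accretive_ext_iff_bound:
  "accretive (ext Z) \<longleftrightarrow> Domain Z \<subseteq> D0 A \<Gamma> \<and>
    (\<forall>(e, h) \<in> Z. Re (cinner h e) \<ge> (norm (app (inv_sqrt_hat A) (\<gamma> \<i> e)))\<^sup>2)"
proof -
  have "(\<forall>(v, y) \<in> B. 0 \<le> Re (cinner h e) + (norm y)\<^sup>2 + 2 * Im (cinner v (\<gamma> \<i> e))) \<longleftrightarrow>
      e \<in> D0 A \<Gamma> \<and> (norm (app (inv_sqrt_hat A) (\<gamma> \<i> e)))\<^sup>2 \<le> Re (cinner h e)" for e h
    using inv_sqrt_hat_bound[of "\<gamma> \<i> e" "Re (cinner h e)"] by (simp add: D0_def sqrtF_eq)
  then show ?thesis unfolding accretive_ext_iff by auto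
qed

text \<open>Test the quadratic functional of \<open>accretive_ext_iff\<close> with the form part of \<open>\<gamma> (- 1) e\<close>. For
  \<open>u = \<gamma> (- 1) e\<close> the form of the adjoint is \<open>- \<parallel>u\<parallel>\<^sup>2\<close>, and its boundary data are \<open>e\<close> and the value of \<open>Q\<close> at \<open>e\<close>.\<close>

lemma strict_lower_bound:
  assumes acc: "accretive (ext Z)" and eh: "(e, h) \<in> Z"
  shows "(norm (\<gamma> (- 1) e))\<^sup>2 \<le> Re (cinner (h - Qscaled A \<Gamma> (- 1) e) e)"
proof -
  note m = \<rho>_points(1)
  let ?u = "\<gamma> (- 1) e"
  have u: "(?u, (- 1) *\<^sub>C ?u) \<in> adj" by (rule \<gamma>_adj_in[OF m])
  have "\<gamma>adj (cnj (- 1)) ((- 1) *\<^sub>C ?u - (- 1) *\<^sub>C ?u) = 0"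
    using bounded_clinearD(3)[OF \<gamma>adj_bounded[OF resolvent_cnj[OF m]]] by simp
  then have b: "bmap ?u ((- 1) *\<^sub>C ?u) = Qscaled A \<Gamma> (- 1) e"
    using bmap_eq[OF m u] by (simp only: \<gamma>(2)[OF m] add_0_left)
  obtain y where y: "(?u - \<gamma> \<i> e, y) \<in> B"
    "Re (cinner ((- 1) *\<^sub>C ?u) ?u) = (norm y)\<^sup>2 + Re (cinner (Qscaled A \<Gamma> (- 1) e) e) + 2 * Im (cinner (?u - \<gamma> \<i> e) (\<gamma> \<i> e))"
    using form_identity[OF u] unfolding b \<gamma>(2)[OF m] by blast
  have "0 \<le> Re (cinner h e) + (norm y)\<^sup>2 + 2 * Im (cinner (?u - \<gamma> \<i> e) (\<gamma> \<i> e))"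
    using acc eh y(1) unfolding accretive_ext_iff by fast
  then show ?thesis using y(2) by (simp add: cinner_diff_left Re_cinner_self)
qed

subsection \<open>Resolvents\<close>

lemma ext_resolvent:
  assumes z: "z \<in> \<rho>"
  shows "(u, f + z *\<^sub>C u) \<in> ext Z \<longleftrightarrow>
    (\<exists>e. u = R z f + \<gamma> z e \<and> (e, \<gamma>adj (cnj z) f) \<in> relation_minus Z (Qscaled A \<Gamma> z))"
proof
  assume u: "(u, f + z *\<^sub>C u) \<in> ext Z"
  then have uw: "(u, f + z *\<^sub>C u) \<in> adj" by (simp add: ext_iff)
  have "u = R z f + \<gamma> z (\<Gamma> u)" using adj_split[OF z uw] by simp
  moreover have "(\<Gamma> u, \<gamma>adj (cnj z) f) \<in> relation_minus Z (Qscaled A \<Gamma> z)"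
    using u bmap_eq[OF z uw] by (simp add: ext_iff)
  ultimately show "\<exists>e. u = R z f + \<gamma> z e \<and> (e, \<gamma>adj (cnj z) f) \<in> relation_minus Z (Qscaled A \<Gamma> z)" by blast
next
  assume "\<exists>e. u = R z f + \<gamma> z e \<and> (e, \<gamma>adj (cnj z) f) \<in> relation_minus Z (Qscaled A \<Gamma> z)"
  then obtain e where u: "u = R z f + \<gamma> z e" and e: "(e, \<gamma>adj (cnj z) f) \<in> relation_minus Z (Qscaled A \<Gamma> z)" by blast
  have uw: "(u, f + z *\<^sub>C u) \<in> adj" "\<Gamma> u = e" unfolding u by (rule adj_combine[OF z])+
  show "(u, f + z *\<^sub>C u) \<in> ext Z" using bmap_eq[OF z uw(1)] e uw by (simp add: ext_iff)
qed

lemma Range_ext_iff: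
  assumes z: "z \<in> \<rho>"
  shows "(\<forall>f. \<exists>u. (u, f + z *\<^sub>C u) \<in> ext Z) \<longleftrightarrow> Range (relation_minus Z (Qscaled A \<Gamma> z)) = UNIV"
proof
  assume L: "\<forall>f. \<exists>u. (u, f + z *\<^sub>C u) \<in> ext Z"
  have "h \<in> Range (relation_minus Z (Qscaled A \<Gamma> z))" for h
  proof -
    obtain f where "\<gamma>adj (cnj z) f = h" using \<gamma>adj_surjective[OF resolvent_cnj[OF z]] by metis
    then show ?thesis using L ext_resolvent[OF z] by blast
  qed
  then show "Range (relation_minus Z (Qscaled A \<Gamma> z)) = UNIV" by blast
next
  assume ran: "Range (relation_minus Z (Qscaled A \<Gamma> z)) = UNIV"
  show "\<forall>f. \<exists>u. (u, f + z *\<^sub>C u) \<in> ext Z"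
  proof
    fix f
    have "\<gamma>adj (cnj z) f \<in> Range (relation_minus Z (Qscaled A \<Gamma> z))" by (simp only: ran UNIV_I)
    then show "\<exists>u. (u, f + z *\<^sub>C u) \<in> ext Z" unfolding ext_resolvent[OF z] by blast
  qed
qed

lemma resolvent_ext_iff:
  assumes z: "z \<in> \<rho>"
  shows "(f, u) \<in> resolvent (ext Z) z \<longleftrightarrow>
    (\<exists>e. u = R z f + \<gamma> z e \<and> (\<gamma>adj (cnj z) f, e) \<in> (relation_minus Z (Qscaled A \<Gamma> z))\<inverse>)"
  by (simp only: resolvent_iff ext_resolvent[OF z] converse_iff)

text \<open>Bounds pass from the resolvent to the inverse of \<open>Z - Q\<close> since \<open>\<gamma> z\<close> is bounded below and
  preimages under \<open>\<gamma>adj (cnj z)\<close> can be chosen boundedly; in the other direction all factors are bounded.\<close>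

lemma resolvent_set_ext_iff:
  assumes z: "z \<in> \<rho>" and Z: "linear_relation Z"
  shows "z \<in> resolvent_set (ext Z) \<longleftrightarrow>
    bounded_everywhere_defined ((relation_minus Z (Qscaled A \<Gamma> z))\<inverse>)"
proof
  let ?W = "(relation_minus Z (Qscaled A \<Gamma> z))\<inverse>"
  note z' = resolvent_cnj[OF z]
  have W: "linear_relation ?W"
    using Qscaled_bounded[OF z] unfolding bounded_clinear_def
    by (intro linear_relation_converse linear_relation_minus[OF Z]) blast
  have R0: "R z 0 = 0" "\<gamma> z 0 = 0" "\<gamma>adj (cnj z) 0 = 0"
    using bounded_clinearD(3) R(3)[OF z] \<gamma>_bounded[OF z] \<gamma>adj_bounded[OF z'] by blast+
  obtain CR where CR: "0 < CR" "\<And>f. norm (R z f) \<le> CR * norm f" using bounded_clinear_bound[OF R(3)[OF z]] by blast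
  {
    assume "z \<in> resolvent_set (ext Z)"
    then have bed: "bounded_everywhere_defined (resolvent (ext Z) z)" by (simp add: resolvent_set_def)
    note res = bounded_everywhere_definedD[OF bed]
    obtain CT where CT: "0 < CT" "\<And>f. norm (app (resolvent (ext Z) z) f) \<le> CT * norm f"
      using bounded_clinear_bound[OF res(3)] by blast
    obtain C\<gamma> where C\<gamma>: "0 < C\<gamma>" "\<And>e. norm e \<le> C\<gamma> * norm (\<gamma> z e)" using \<gamma>_bounded_below[OF z] by blast
    obtain Ca where Ca: "0 < Ca" "\<And>h. \<exists>f. \<gamma>adj (cnj z) f = h \<and> norm f \<le> Ca * norm h"
      using \<gamma>adj_surjective[OF z'] by blast
    have "linear_operator ?W"
    proof (rule linear_operatorI[OF W])
      fix e assume "(0, e) \<in> ?W"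
      then have "(0, \<gamma> z e) \<in> resolvent (ext Z) z"
        unfolding resolvent_ext_iff[OF z] by (intro exI[of _ e]) (simp only: R0 add_0_left simp_thms)
      then have "\<gamma> z e = 0"
        using linear_operator_unique[OF res(1) _ linear_relationD(1)[OF linear_operator_relation[OF res(1)]]] by blast
      then show "e = 0" using C\<gamma>(2)[of e] by simp
    qed
    moreover have "Domain ?W = UNIV"
    proof -
      have "g \<in> Domain ?W" for g
      proof -
        obtain f where "\<gamma>adj (cnj z) f = g" using Ca(2) by blast
        then show ?thesis using res(2)[of f] unfolding resolvent_ext_iff[OF z] by blast
      qed
      then show ?thesis by blast
    qed
    moreover have "norm e \<le> (C\<gamma> * ((CT + CR) * Ca)) * norm g" if ge: "(g, e) \<in> ?W" for g e
    proof -
      obtain f where f: "\<gamma>adj (cnj z) f = g" "norm f \<le> Ca * norm g" using Ca(2) by blast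
      have "(f, R z f + \<gamma> z e) \<in> resolvent (ext Z) z"
        unfolding resolvent_ext_iff[OF z] f(1) using ge by blast
      then have eq: "app (resolvent (ext Z) z) f = R z f + \<gamma> z e" by (rule app_eq[OF res(1)])
      have "norm (\<gamma> z e) \<le> norm (R z f + \<gamma> z e) + norm (R z f)"
        using norm_triangle_ineq4[of "R z f + \<gamma> z e" "R z f"] by simp
      also have "\<dots> \<le> CT * norm f + CR * norm f" using CT(2)[of f] CR(2)[of f] unfolding eq by (rule add_mono)
      also have "\<dots> = (CT + CR) * norm f" by (simp add: distrib_right)
      also have "\<dots> \<le> (CT + CR) * (Ca * norm g)" using f(2) CT(1) CR(1) by (intro mult_left_mono) auto
      finally have "C\<gamma> * norm (\<gamma> z e) \<le> C\<gamma> * ((CT + CR) * (Ca * norm g))" using C\<gamma>(1) by (intro mult_left_mono) auto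
      then show ?thesis using C\<gamma>(2)[of e] by (simp add: mult.assoc)
    qed
    ultimately show "bounded_everywhere_defined ?W" unfolding bounded_everywhere_defined_def by blast
  next
    assume bed: "bounded_everywhere_defined ?W"
    note wD = bounded_everywhere_definedD[OF bed]
    have ap: "(f, R z f + \<gamma> z (app ?W (\<gamma>adj (cnj z) f))) \<in> resolvent (ext Z) z" for f
      unfolding resolvent_ext_iff[OF z] using wD(2) by blast
    have uniq: "u = R z f + \<gamma> z (app ?W (\<gamma>adj (cnj z) f))" if "(f, u) \<in> resolvent (ext Z) z" for f u
      using that app_eq[OF wD(1)] unfolding resolvent_ext_iff[OF z] by blast
    have lin: "linear_relation (resolvent (ext Z) z)"
      using ext_quasi_selfadjoint[OF Z] unfolding resolvent_def
      by (intro linear_relation_converse linear_relation_shift) (simp add: quasi_selfadjoint_extension_def linear_operator_def)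
    have "single_valued (resolvent (ext Z) z)" by (rule single_valuedI) (metis uniq)
    then have "linear_operator (resolvent (ext Z) z)" using lin by (simp add: linear_operator_def)
    moreover have "Domain (resolvent (ext Z) z) = UNIV" using ap by blast
    moreover have "bounded_clinear (\<lambda>f. R z f + \<gamma> z (app ?W (\<gamma>adj (cnj z) f)))"
      by (intro bounded_clinear_add R(3)[OF z] bounded_clinear_compose[OF \<gamma>_bounded[OF z]]
          bounded_clinear_compose[OF wD(3)] \<gamma>adj_bounded[OF z'])
    then obtain C where C: "\<And>f. norm (R z f + \<gamma> z (app ?W (\<gamma>adj (cnj z) f))) \<le> C * norm f"
      using bounded_clinear_bound by blast
    have "\<forall>(f, u) \<in> resolvent (ext Z) z. norm u \<le> C * norm f"
    proof clarify
      fix f u assume "(f, u) \<in> resolvent (ext Z) z"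
      then show "norm u \<le> C * norm f" using uniq C[of f] by metis
    qed
    ultimately show "z \<in> resolvent_set (ext Z)"
      unfolding resolvent_set_def bounded_everywhere_defined_def by blast
  }
qed

lemma krein_formula:
  assumes z: "z \<in> \<rho>" "z \<in> resolvent_set (ext Z)" and Z: "linear_relation Z"
  shows "app (resolvent (ext Z) z) f =
    app (resolvent F z) f + \<gamma> z (app ((relation_minus Z (Qscaled A \<Gamma> z))\<inverse>) (\<gamma>adj (cnj z) f))"
proof -
  let ?W = "(relation_minus Z (Qscaled A \<Gamma> z))\<inverse>"
  have W: "bounded_everywhere_defined ?W" using resolvent_set_ext_iff[OF z(1) Z] z(2) by blast
  have "bounded_everywhere_defined (resolvent (ext Z) z)" using z(2) by (simp add: resolvent_set_def)
  then have "linear_operator (resolvent (ext Z) z)" by (rule bounded_everywhere_definedD)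
  moreover have "(f, R z f + \<gamma> z (app ?W (\<gamma>adj (cnj z) f))) \<in> resolvent (ext Z) z"
    unfolding resolvent_ext_iff[OF z(1)] using bounded_everywhere_definedD(2)[OF W] by blast
  ultimately show ?thesis unfolding R_def[symmetric] by (rule app_eq)
qed

lemma kernel_ext:
  assumes z: "z \<in> \<rho>"
  shows "rel_kernel (shift (ext Z) z) = \<gamma> z ` rel_kernel (relation_minus Z (Qscaled A \<Gamma> z))"
proof -
  have 0: "R z 0 = 0" "\<gamma>adj (cnj z) 0 = 0"
    using bounded_clinearD(3) R(3)[OF z] \<gamma>adj_bounded[OF resolvent_cnj[OF z]] by blast+
  have "u \<in> rel_kernel (shift (ext Z) z) \<longleftrightarrow>
      (\<exists>e. u = \<gamma> z e \<and> (e, 0) \<in> relation_minus Z (Qscaled A \<Gamma> z))" for u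
    using ext_resolvent[OF z, of u 0 Z] unfolding 0 rel_kernel_def mem_Collect_eq shift_iff by (simp only: add_0_left)
  then show ?thesis unfolding rel_kernel_def by blast
qed

lemma eigenvalue_ext_iff:
  assumes z: "z \<in> \<rho>" and Z: "linear_relation Z"
  shows "eigenvalue (ext Z) z \<longleftrightarrow> rel_kernel (relation_minus Z (Qscaled A \<Gamma> z)) \<noteq> {0}"
proof -
  let ?K = "rel_kernel (relation_minus Z (Qscaled A \<Gamma> z))"
  have \<gamma>0: "\<gamma> z e = 0 \<longleftrightarrow> e = 0" for e
    using \<gamma>(2)[OF z, of e] \<Gamma>_D[OF complex_subspaceD(1)[OF D_subspace]] bounded_clinearD(3)[OF \<gamma>_bounded[OF z]] by metis
  have "0 \<in> ?K"
    using linear_relationD(1)[OF Z] bounded_clinearD(3)[OF Qscaled_bounded[OF z]] by (simp add: rel_kernel_def)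
  moreover have "eigenvalue (ext Z) z \<longleftrightarrow> (\<exists>u \<in> rel_kernel (shift (ext Z) z). u \<noteq> 0)"
    by (auto simp: eigenvalue_def rel_kernel_def)
  ultimately show ?thesis unfolding kernel_ext[OF z] using \<gamma>0 by blast
qed

subsection \<open>The correspondence\<close>

lemma ext_dense: assumes "linear_relation Z" shows "linear_operator (ext Z)" "closure (Domain (ext Z)) = UNIV"
proof -
  show "linear_operator (ext Z)" using ext_quasi_selfadjoint[OF assms] by (simp add: quasi_selfadjoint_extension_def)
  have "A \<subseteq> ext Z" using ext_quasi_selfadjoint[OF assms] by (simp add: quasi_selfadjoint_extension_def)
  then show "closure (Domain (ext Z)) = UNIV" using dense_A closure_mono[OF Domain_mono] by blast
qed

text \<open>Both properties amount to the surjectivity of \<open>Z - Q\<close> at \<open>-1\<close>, which on one side is the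
  surjectivity of \<open>ext Z + 1\<close> and on the other side the maximality of a bounded perturbation of \<open>Z\<close>. Here \<open>\<delta>\<close>
  is the constant of strict accretivity of \<open>Z - Q\<close>: already \<open>Z - Q - \<delta>\<close> is accretive, so
  maximality makes \<open>Z - Q\<close> itself onto.\<close>

lemma m_accretive_ext_iff:
  assumes Z: "linear_relation Z" and acc: "accretive (ext Z)"
  shows "m_accretive_operator (ext Z) \<longleftrightarrow> m_accretive_relation Z"
proof -
  note m = \<rho>_points(1)
  let ?Q = "Qscaled A \<Gamma> (- 1)"
  let ?M = "relation_minus Z ?Q"
  have Q: "bounded_clinear ?Q" by (rule Qscaled_bounded[OF m])
  have Mlin: "linear_relation ?M" using Q by (intro linear_relation_minus[OF Z]) (simp add: bounded_clinear_def)
  obtain C where C: "0 < C" "\<And>e. norm e \<le> C * norm (\<gamma> (- 1) e)" using \<gamma>_bounded_below[OF m] by blast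
  define \<delta> where "\<delta> = 1 / C\<^sup>2"
  have \<delta>: "0 < \<delta>" using C by (simp add: \<delta>_def)
  have lower: "\<delta> * (norm e)\<^sup>2 \<le> Re (cinner k e)" if "(e, k) \<in> ?M" for e k
  proof -
    have "(norm e)\<^sup>2 \<le> C\<^sup>2 * (norm (\<gamma> (- 1) e))\<^sup>2"
      using power_mono[OF C(2)[of e] norm_ge_zero, of 2] by (simp add: power_mult_distrib)
    then have "\<delta> * (norm e)\<^sup>2 \<le> (norm (\<gamma> (- 1) e))\<^sup>2" using C(1) by (simp add: \<delta>_def field_simps)
    also have "\<dots> \<le> Re (cinner k e)" using strict_lower_bound[OF acc, of e "k + ?Q e"] that by simp
    finally show ?thesis .
  qed
  have surj: "m_accretive_operator (ext Z) \<longleftrightarrow> Range ?M = UNIV"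
  proof
    assume "m_accretive_operator (ext Z)"
    then have T: "m_accretive_relation (ext Z)" using m_accretive_operator_iff[OF ext_dense[OF Z]] by blast
    have "\<exists>u. (u, f + (- 1) *\<^sub>C u) \<in> ext Z" for f
    proof (rule m_accretive_surjective[OF T zero_less_one, of f])
      fix u w assume "(u, w) \<in> ext Z" "w + complex_of_real 1 *\<^sub>C u = f"
      then show "\<exists>u. (u, f + (- 1) *\<^sub>C u) \<in> ext Z" by (intro exI[of _ u]) auto
    qed
    then show "Range ?M = UNIV" using Range_ext_iff[OF m] by blast
  next
    assume "Range ?M = UNIV"
    then have ran: "\<forall>f. \<exists>u. (u, f + (- 1) *\<^sub>C u) \<in> ext Z" using Range_ext_iff[OF m] by blast
    have "m_accretive_relation (ext Z)"
    proof (rule m_accretiveI_shifted[OF linear_operator_relation[OF ext_dense(1)[OF Z]] acc zero_less_one])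
      fix f
      obtain u where "(u, f + (- 1) *\<^sub>C u) \<in> ext Z" using ran by blast
      then show "\<exists>x y. (x, y) \<in> ext Z \<and> y + complex_of_real 1 *\<^sub>C x = f"
        by (intro exI[of _ u] exI[of _ "f + (- 1) *\<^sub>C u"]) simp
    qed
    then show "m_accretive_operator (ext Z)" using m_accretive_operator_iff[OF ext_dense[OF Z]] by blast
  qed
  show ?thesis unfolding surj
  proof
    assume ran: "Range ?M = UNIV"
    have "accretive ?M" unfolding accretive_def
    proof clarify
      fix e k assume "(e, k) \<in> ?M"
      from lower[OF this] show "0 \<le> Re (cinner k e)"
        using \<delta> by (meson mult_nonneg_nonneg less_imp_le order_trans zero_le_power2)
    qed
    then have M: "m_accretive_relation ?M" by (rule m_accretiveI_surjective[OF Mlin _ ran])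
    have restore: "relation_minus ?M (\<lambda>e. - ?Q e) = Z" by (auto simp: set_eq_iff)
    have "0 \<le> Re (cinner h e)" if "(e, h) \<in> Z" for e h
      using acc that linear_relationD(1)[OF BD(2)] unfolding accretive_ext_iff by fastforce
    then have "accretive (relation_minus ?M (\<lambda>e. - ?Q e))" unfolding restore by (auto simp: accretive_def)
    from m_accretive_bounded_perturbation[OF M bounded_clinear_uminus[OF Q] this]
    show "m_accretive_relation Z" unfolding restore .
  next
    assume Zm: "m_accretive_relation Z"
    have Qd: "bounded_clinear (\<lambda>e. ?Q e + complex_of_real \<delta> *\<^sub>C e)" by (rule bounded_clinear_add[OF Q bounded_clinear_scaleC])
    have "accretive (relation_minus Z (\<lambda>e. ?Q e + complex_of_real \<delta> *\<^sub>C e))" unfolding accretive_def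
    proof clarify
      fix e k assume "(e, k) \<in> relation_minus Z (\<lambda>e. ?Q e + complex_of_real \<delta> *\<^sub>C e)"
      then have "(e, k + complex_of_real \<delta> *\<^sub>C e) \<in> ?M" by (simp add: add_ac)
      from lower[OF this] show "0 \<le> Re (cinner k e)" by (simp add: cinner_simps Re_cinner_self)
    qed
    from m_accretive_bounded_perturbation[OF Zm Qd this]
    have Md: "m_accretive_relation (relation_minus Z (\<lambda>e. ?Q e + complex_of_real \<delta> *\<^sub>C e))" .
    have "h \<in> Range ?M" for h
    proof (rule m_accretive_surjective[OF Md \<delta>, of h])
      fix e k assume "(e, k) \<in> relation_minus Z (\<lambda>e. ?Q e + complex_of_real \<delta> *\<^sub>C e)"
        "k + complex_of_real \<delta> *\<^sub>C e = h"
      then have "(e, h) \<in> ?M" by (auto simp: add_ac)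
      then show "h \<in> Range ?M" by blast
    qed
    then show "Range ?M = UNIV" by blast
  qed
qed

lemma admissible_iff:
  assumes "linear_relation Z"
  shows "admissible_relation A \<Gamma> Z \<longleftrightarrow> m_accretive_operator (ext Z)"
proof
  assume "admissible_relation A \<Gamma> Z"
  then have "m_accretive_relation Z" "accretive (ext Z)"
    by (auto simp: admissible_relation_def accretive_ext_iff_bound)
  then show "m_accretive_operator (ext Z)" using m_accretive_ext_iff[OF assms] by blast
next
  assume T: "m_accretive_operator (ext Z)"
  then have acc: "accretive (ext Z)" by (simp add: m_accretive_operator_def)
  have "m_accretive_relation Z" using m_accretive_ext_iff[OF assms acc] T by blast
  with acc show "admissible_relation A \<Gamma> Z"
    unfolding admissible_relation_def accretive_ext_iff_bound by blast
qed

lemma admissible_linear: "admissible_relation A \<Gamma> Z \<Longrightarrow> linear_relation Z"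
  by (simp add: admissible_relation_def m_accretive_relation_def)

lemma ext_bijection:
  "bij_betw ext {Z. admissible_relation A \<Gamma> Z} {T. quasi_selfadjoint_extension A T \<and> m_accretive_operator T}"
proof (rule bij_betw_byWitness[where f' = boundary_relation])
  show "\<forall>Z \<in> {Z. admissible_relation A \<Gamma> Z}. boundary_relation (ext Z) = Z"
    by (simp add: boundary_relation_ext)
  show "\<forall>T \<in> {T. quasi_selfadjoint_extension A T \<and> m_accretive_operator T}. ext (boundary_relation T) = T"
    by (simp add: ext_boundary_relation(2))
  show "ext ` {Z. admissible_relation A \<Gamma> Z} \<subseteq> {T. quasi_selfadjoint_extension A T \<and> m_accretive_operator T}"
    using admissible_linear ext_quasi_selfadjoint admissible_iff by blast
  show "boundary_relation ` {T. quasi_selfadjoint_extension A T \<and> m_accretive_operator T} \<subseteq> {Z. admissible_relation A \<Gamma> Z}"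
    using ext_boundary_relation admissible_iff by auto
qed

end

theorem theorem4p2:
  fixes A :: "('a::complex_hilbert \<times> 'a) set"
    and \<Gamma> G :: "'a \<Rightarrow> 'h::complex_hilbert"
  assumes "nonnegative_symmetric A"
    and "closed A"
    and "closure (Domain A) = UNIV"
    and "boundary_pair A \<Gamma>"
    and "boundary_triplet A G \<Gamma>"
    and "D0 A \<Gamma> \<noteq> {0}"
  shows "bij_betw (extension_of A G \<Gamma>)
           {Z. admissible_relation A \<Gamma> Z}
           {T. quasi_selfadjoint_extension A T \<and> m_accretive_operator T} \<and>
         (\<forall>Z. admissible_relation A \<Gamma> Z \<longrightarrow>
           (\<forall>z \<in> resolvent_set (friedrichs A).
             (z \<in> resolvent_set (extension_of A G \<Gamma> Z) \<longleftrightarrow>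
                bounded_everywhere_defined ((relation_minus Z (Qscaled A \<Gamma> z))\<inverse>)) \<and>
             (z \<in> resolvent_set (extension_of A G \<Gamma> Z) \<longrightarrow>
                (\<forall>f. app (resolvent (extension_of A G \<Gamma> Z) z) f =
                     app (resolvent (friedrichs A) z) f +
                     gammaf A \<Gamma> z (app ((relation_minus Z (Qscaled A \<Gamma> z))\<inverse>)
                                    (gamma_adj A \<Gamma> (cnj z) f)))) \<and>
             (eigenvalue (extension_of A G \<Gamma> Z) z \<longleftrightarrow>
                rel_kernel (relation_minus Z (Qscaled A \<Gamma> z)) \<noteq> {0}) \<and>
             (eigenvalue (extension_of A G \<Gamma> Z) z \<longrightarrow>
                rel_kernel (shift (extension_of A G \<Gamma> Z) z) =
                gammaf A \<Gamma> z ` rel_kernel (relation_minus Z (Qscaled A \<Gamma> z)))))"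
proof -
  interpret boundary_setting A \<Gamma> by unfold_locales (rule assms)+
  have ext: "extension_of A G \<Gamma> = ext" using extension_of_eq_ext[OF assms(5)] by blast
  show ?thesis
    unfolding ext
  proof (intro conjI allI impI ballI)
    show "bij_betw ext {Z. admissible_relation A \<Gamma> Z}
        {T. quasi_selfadjoint_extension A T \<and> m_accretive_operator T}" by (rule ext_bijection)
    fix Z z assume Z: "admissible_relation A \<Gamma> Z" and z: "z \<in> \<rho>"
    note lin = admissible_linear[OF Z]
    show "z \<in> resolvent_set (ext Z) \<longleftrightarrow> bounded_everywhere_defined ((relation_minus Z (Qscaled A \<Gamma> z))\<inverse>)"
      by (rule resolvent_set_ext_iff[OF z lin])
    show "app (resolvent (ext Z) z) f =
        app (resolvent F z) f + \<gamma> z (app ((relation_minus Z (Qscaled A \<Gamma> z))\<inverse>) (\<gamma>adj (cnj z) f))"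
      if "z \<in> resolvent_set (ext Z)" for f
      by (rule krein_formula[OF z that lin])
    show "eigenvalue (ext Z) z \<longleftrightarrow> rel_kernel (relation_minus Z (Qscaled A \<Gamma> z)) \<noteq> {0}"
      by (rule eigenvalue_ext_iff[OF z lin])
    show "rel_kernel (shift (ext Z) z) = \<gamma> z ` rel_kernel (relation_minus Z (Qscaled A \<Gamma> z))"
      by (rule kernel_ext[OF z])
  qed
qed


end
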